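(* There is a polynomial-time algorithm that, given a chordal graph $G$ as input, returns YES if $G$ is contact $B_0$-VPG, and otherwise returns NO together with an induced subgraph of $G$ isomorphic to a graph in $\mathcal{T} \cup \{K_5, K_4^-\}$.
   Context: All graphs are finite and simple. A contact $B_0$-VPG representation of a graph $G$ assigns to each vertex $v$ a path $P_v$ on a rectangular grid such that: each $P_v$ is a horizontal or a vertical path on the grid (no bends) of length at least one (it contains at least one grid-edge); no two paths share a grid-edge; no two paths cross (no grid-point is an interior point of two distinct paths); and distinct vertices $u,v$ are adjacent if and only if $P_u$ and $P_v$ have at least one grid-point in common. A graph is contact $B_0$-VPG if it has such a representation. A graph is chordal if it has no induced cycle of length at least four. $K_4^-$ is $K_4$ minus one edge. $H_0$ is the graph composed of three copies of $K_4$ sharing one common vertex, with no further edges. $\mathcal{T}$ is the family containing $H_0$ and all graphs whose vertex set can be partitioned into a nontrivial tree $T_0$ (at least two vertices) of maximum degree at most three and a disjoint union of triangles, such that each triangle is complete to one vertex $v$ of $T_0$ and anticomplete to $T_0-\{v\}$, every leaf of $T_0$ is complete to exactly two of the triangles, every vertex of degree two in $T_0$ is complete to exactly one of the triangles, and vertices of degree three in $T_0$ have no neighbours outside $T_0$. (Complete/anticomplete: adjacent to all/none of the vertices.) *)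

theory Defs
  imports
    "Graph_Theory.Graph_Theory"
    "HOL-Library.Disjoint_Sets"
    "HOL-Computational_Algebra.Polynomial"
begin

section \<open>Graphs\<close>

text \<open>
  A finite simple graph is a \<open>pair_graph\<close>: a finite, loop-free, symmetric digraph whose arcs
  are pairs of vertices, so that every edge \<open>uv\<close> is represented by the two arcs
  \<open>(u, v)\<close> and \<open>(v, u)\<close>.
\<close>

abbreviation adjacent :: "'a pair_pre_digraph \<Rightarrow> 'a \<Rightarrow> 'a \<Rightarrow> bool" where
  "adjacent G u v \<equiv> (u, v) \<in> parcs G"

definition complete_to :: "'a pair_pre_digraph \<Rightarrow> 'a set \<Rightarrow> 'a set \<Rightarrow> bool" where
  "complete_to G A B \<longleftrightarrow> (\<forall>a\<in>A. \<forall>b\<in>B. adjacent G a b)"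

definition anticomplete_to :: "'a pair_pre_digraph \<Rightarrow> 'a set \<Rightarrow> 'a set \<Rightarrow> bool" where
  "anticomplete_to G A B \<longleftrightarrow> (\<forall>a\<in>A. \<forall>b\<in>B. \<not> adjacent G a b)"

text \<open>The subgraph of \<open>G\<close> induced by \<open>W\<close> is isomorphic to \<open>H\<close>.\<close>

definition induces_copy :: "'a pair_pre_digraph \<Rightarrow> 'a set \<Rightarrow> 'b pair_pre_digraph \<Rightarrow> bool" where
  "induces_copy G W H \<longleftrightarrow>
     W \<subseteq> pverts G \<and> digraph_iso (with_proj G \<restriction> W) (with_proj H)"

definition cycle_graph :: "nat \<Rightarrow> nat pair_pre_digraph" where
  "cycle_graph k = \<lparr> pverts = {..<k},
     parcs = {(i, j). i < k \<and> j < k \<and> (j = (i + 1) mod k \<or> i = (j + 1) mod k)} \<rparr>"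

definition chordal :: "'a pair_pre_digraph \<Rightarrow> bool" where
  "chordal G \<longleftrightarrow> \<not> (\<exists>k\<ge>4. \<exists>W. induces_copy G W (cycle_graph k))"

definition complete_graph :: "nat \<Rightarrow> nat pair_pre_digraph" where
  "complete_graph n = \<lparr> pverts = {..<n}, parcs = {(i, j). i < n \<and> j < n \<and> i \<noteq> j} \<rparr>"

definition K4_minus :: "nat pair_pre_digraph" where
  "K4_minus = \<lparr> pverts = pverts (complete_graph 4),
     parcs = parcs (complete_graph 4) - {(2, 3), (3, 2)} \<rparr>"

section \<open>The family of obstructions\<close>

text \<open>The shared vertex is 0; the copies of $K_4$ are 0123, 0456 and 0789.\<close>

definition H0 :: "nat pair_pre_digraph" where
  "H0 = \<lparr> pverts = {..<10},
     parcs = {(u, v). u \<noteq> v \<and>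
       (\<exists>A \<in> {{0,1,2,3}, {0,4,5,6}, {0,7,8,9}}. u \<in> A \<and> v \<in> A)} \<rparr>"

text \<open>
  The library's \<open>tree\<close> cannot be used for symmetric digraphs: it counts the closed walk
  \<open>u, v, u\<close> along a single edge as a cycle. A cycle of the underlying undirected graph is a
  cycle with at least three arcs.
\<close>

definition undirected_tree :: "('a, 'b) pre_digraph \<Rightarrow> bool" where
  "undirected_tree T \<longleftrightarrow> Digraph_Component.connected T \<and>
     \<not> (\<exists>p. pre_digraph.cycle T p \<and> 3 \<le> length p)"

definition tree_with_triangles :: "'a pair_pre_digraph \<Rightarrow> 'a set \<Rightarrow> 'a set set \<Rightarrow> bool" where
  "tree_with_triangles H T \<D> \<longleftrightarrow>
     (let deg = out_degree (with_proj H \<restriction> T) in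
     pair_graph H \<and>
     T \<subseteq> pverts H \<and> 2 \<le> card T \<and> undirected_tree (with_proj H \<restriction> T) \<and>
     (\<forall>v\<in>T. deg v \<le> 3) \<and>
     partition_on (pverts H - T) \<D> \<and>
     (\<forall>D\<in>\<D>. complete_digraph 3 (with_proj H \<restriction> D)) \<and>
     (\<forall>D\<in>\<D>. \<forall>D'\<in>\<D>. D \<noteq> D' \<longrightarrow> anticomplete_to H D D') \<and>
     (\<forall>D\<in>\<D>. \<exists>v\<in>T. complete_to H D {v} \<and> anticomplete_to H D (T - {v})) \<and>
     (\<forall>v\<in>T. deg v = 1 \<longrightarrow> card {D \<in> \<D>. complete_to H {v} D} = 2) \<and>
     (\<forall>v\<in>T. deg v = 2 \<longrightarrow> card {D \<in> \<D>. complete_to H {v} D} = 1) \<and>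
     (\<forall>v\<in>T. deg v = 3 \<longrightarrow> anticomplete_to H {v} (pverts H - T)))"

definition family_T :: "nat pair_pre_digraph set" where
  "family_T = {H0} \<union> {H. \<exists>T \<D>. tree_with_triangles H T \<D>}"

section \<open>Contact representations by paths without bends\<close>

type_synonym grid_point = "int \<times> int"

text \<open>
  \<open>Horizontal y a b\<close> is the path from \<open>(a, y)\<close> to \<open>(b, y)\<close>, and
  \<open>Vertical x a b\<close> the path from \<open>(x, a)\<close> to \<open>(x, b)\<close>.
\<close>

datatype grid_path = Horizontal int int int | Vertical int int int

fun valid_grid_path :: "grid_path \<Rightarrow> bool" where
  "valid_grid_path (Horizontal y a b) \<longleftrightarrow> a < b"
| "valid_grid_path (Vertical x a b) \<longleftrightarrow> a < b"

fun path_points :: "grid_path \<Rightarrow> grid_point set" where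
  "path_points (Horizontal y a b) = {(i, y) | i. a \<le> i \<and> i \<le> b}"
| "path_points (Vertical x a b) = {(x, i) | i. a \<le> i \<and> i \<le> b}"

fun path_interior :: "grid_path \<Rightarrow> grid_point set" where
  "path_interior (Horizontal y a b) = {(i, y) | i. a < i \<and> i < b}"
| "path_interior (Vertical x a b) = {(x, i) | i. a < i \<and> i < b}"

fun path_edges :: "grid_path \<Rightarrow> grid_point set set" where
  "path_edges (Horizontal y a b) = {{(i, y), (i + 1, y)} | i. a \<le> i \<and> i < b}"
| "path_edges (Vertical x a b) = {{(x, i), (x, i + 1)} | i. a \<le> i \<and> i < b}"

definition contact_B0_VPG_rep :: "'a pair_pre_digraph \<Rightarrow> ('a \<Rightarrow> grid_path) \<Rightarrow> bool" where
  "contact_B0_VPG_rep G P \<longleftrightarrow>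
     (\<forall>v\<in>pverts G. valid_grid_path (P v)) \<and>
     (\<forall>u\<in>pverts G. \<forall>v\<in>pverts G. u \<noteq> v \<longrightarrow>
        path_edges (P u) \<inter> path_edges (P v) = {} \<and>
        path_interior (P u) \<inter> path_interior (P v) = {} \<and>
        (adjacent G u v \<longleftrightarrow> path_points (P u) \<inter> path_points (P v) \<noteq> {}))"

definition contact_B0_VPG :: "'a pair_pre_digraph \<Rightarrow> bool" where
  "contact_B0_VPG G \<longleftrightarrow> (\<exists>P. contact_B0_VPG_rep G P)"

section \<open>Algorithms\<close>

text \<open>
  Algorithms are structured programs for a random access machine with finitely many scalar
  registers and arrays of natural numbers, under the uniform cost measure. The arithmetic
  operations are addition and truncated subtraction only. Hence the bit length of every number
  arising in \<open>t\<close> steps is at most \<open>t\<close> plus that of the largest input number or program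
  constant, and polynomial time on this machine coincides with polynomial time on Turing
  machines; unit-cost multiplication would destroy this.
\<close>

type_synonym vname = string

datatype aexp =
    N nat
  | V vname
  | Load vname aexp
  | Plus aexp aexp
  | Minus aexp aexp

datatype com =
    Skip
  | Assign vname aexp
  | Store vname aexp aexp
  | Seq com com
  | If aexp com com
  | While aexp com

record state =
  reg :: "vname \<Rightarrow> nat"
  arr :: "vname \<Rightarrow> nat \<Rightarrow> nat"

primrec aval :: "aexp \<Rightarrow> state \<Rightarrow> nat" where
  "aval (N n) s = n"
| "aval (V x) s = reg s x"
| "aval (Load a e) s = arr s a (aval e s)"
| "aval (Plus e f) s = aval e s + aval f s"
| "aval (Minus e f) s = aval e s - aval f s"

primrec acost :: "aexp \<Rightarrow> nat" where
  "acost (N n) = 1"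
| "acost (V x) = 1"
| "acost (Load a e) = acost e + 1"
| "acost (Plus e f) = acost e + acost f + 1"
| "acost (Minus e f) = acost e + acost f + 1"

text \<open>
  \<open>exec c s t s'\<close>: started in state \<open>s\<close>, the program \<open>c\<close> halts in state \<open>s'\<close> after \<open>t\<close>
  steps. A guard holds iff its value is nonzero.
\<close>

inductive exec :: "com \<Rightarrow> state \<Rightarrow> nat \<Rightarrow> state \<Rightarrow> bool" where
  Skip: "exec Skip s 1 s"
| Assign: "exec (Assign x e) s (acost e + 1) (s\<lparr>reg := (reg s)(x := aval e s)\<rparr>)"
| Store: "exec (Store a e f) s (acost e + acost f + 1)
            (s\<lparr>arr := (arr s)(a := (arr s a)(aval e s := aval f s))\<rparr>)"
| Seq: "exec c s t s' \<Longrightarrow> exec d s' t' s'' \<Longrightarrow> exec (Seq c d) s (t + t') s''"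
| IfTrue: "aval e s \<noteq> 0 \<Longrightarrow> exec c s t s' \<Longrightarrow> exec (If e c d) s (acost e + t + 1) s'"
| IfFalse: "aval e s = 0 \<Longrightarrow> exec d s t s' \<Longrightarrow> exec (If e c d) s (acost e + t + 1) s'"
| WhileFalse: "aval e s = 0 \<Longrightarrow> exec (While e c) s (acost e + 1) s"
| WhileTrue: "aval e s \<noteq> 0 \<Longrightarrow> exec c s t s' \<Longrightarrow> exec (While e c) s' t' s'' \<Longrightarrow>
    exec (While e c) s (acost e + t + t' + 1) s''"

inductive_cases SkipE: "exec Skip s t s'"
inductive_cases AssignE: "exec (Assign x e) s t s'"
inductive_cases StoreE: "exec (Store a e f) s t s'"
inductive_cases SeqE: "exec (Seq c d) s t s'"
inductive_cases IfE: "exec (If e c d) s t s'"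
inductive_cases WhileE: "exec (While e c) s t s'"

lemma exec_deterministic:
  "exec c s t s' \<Longrightarrow> exec c s u r \<Longrightarrow> u = t \<and> r = s'"
proof (induction arbitrary: u r rule: exec.induct)
  case (Skip s)
  then show ?case by (rule SkipE) simp
next
  case (Assign x e s)
  then show ?case by (rule AssignE) simp
next
  case (Store a e f s)
  then show ?case by (rule StoreE) simp
next
  case (Seq c s t s' d t' s'')
  show ?case by (rule SeqE[OF Seq.prems]) (auto dest: Seq.IH)
next
  case (IfTrue e s c t s' d)
  show ?case by (rule IfE[OF IfTrue.prems]) (use IfTrue.hyps in \<open>auto dest: IfTrue.IH\<close>)
next
  case (IfFalse e s d t s' c)
  show ?case by (rule IfE[OF IfFalse.prems]) (use IfFalse.hyps in \<open>auto dest: IfFalse.IH\<close>)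
next
  case (WhileFalse e s c)
  show ?case by (rule WhileE[OF WhileFalse.prems]) (use WhileFalse.hyps in auto)
next
  case (WhileTrue e s c t s' t' s'')
  show ?case by (rule WhileE[OF WhileTrue.prems]) (use WhileTrue.hyps in \<open>auto dest: WhileTrue.IH\<close>)
qed

text \<open>
  A graph with vertex set \<open>{..<n}\<close> is given by the number \<open>n\<close> and its adjacency matrix, stored
  row by row. All other registers and array cells are initially 0. Its size is polynomially
  related to \<open>n\<close>, so running times are measured as functions of \<open>n\<close>.
\<close>

definition input_state :: "nat pair_pre_digraph \<Rightarrow> state" where
  "input_state G = (let n = card (pverts G) in
     \<lparr> reg = (\<lambda>_. 0)(''n'' := n),
       arr = (\<lambda>_ _. 0)(''adj'' := (\<lambda>i. if i < n * n \<and> adjacent G (i div n) (i mod n) then 1 else 0)) \<rparr>)"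

text \<open>
  The answer is read off register \<open>answer\<close>: 1 for YES and 0 for NO. An induced subgraph is
  returned as the characteristic vector of its vertex set.
\<close>

definition answers_YES :: "state \<Rightarrow> bool" where
  "answers_YES s \<longleftrightarrow> reg s ''answer'' = 1"

definition answers_NO :: "state \<Rightarrow> bool" where
  "answers_NO s \<longleftrightarrow> reg s ''answer'' = 0"

definition returned_vertices :: "state \<Rightarrow> nat set" where
  "returned_vertices s = {v. arr s ''subgraph'' v \<noteq> 0}"

end

theory Submission
  imports Defs
begin

text \<open>
  Pairwise touching paths share a grid point, at which four grid edges meet. So there is no $K_5$, all
  members of a $K_4$ end at their common point, and of two adjacent vertices at least one ends at
  their contact; two paths share at most one point, which excludes $K_4^-$. A path has two ends. If
  both ends of \<open>x\<close> are needed in other blocks, then every remaining neighbour of \<open>x\<close> has to end at its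
  contact with \<open>x\<close>. These forced contacts form a least fixed point, and a vertex forced to end in three
  blocks is an obstruction.

  A chordal graph without $K_4^-$ has the property that non-adjacent neighbours of a vertex are
  separated by it. Hence the derivation of three forced contacts at a vertex unfolds to an induced tree
  with triangles. Conversely, without an obstruction a representation is built block by block: after
  scaling, a block is attached either at an inner point of a path already present, or, if a member of
  the block forces this, at a free end.

  The algorithm computes the fixed point and, if an obstruction is present, deletes vertices greedily
  as long as one remains. A minimal obstructed graph is a member of the family.
\<close>

section \<open>Forced contacts\<close>

text \<open>Blocks never appear as objects. If every vertex separates its non-adjacent neighbours
  (\<open>separating\<close>), two neighbours of a vertex lie in a common block iff they are
  adjacent. So \<open>independent3\<close> expresses three blocks by three missing edges, and
  \<open>component\<close> supplies the side of the graph beyond a neighbour. The obstacle is that a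
  derivation of \<open>forced\<close> is a tree of rule applications, while an obstruction has to be
  an induced subgraph: vertices used in different branches might coincide or be adjacent. Separation
  puts different branches into different components. Chordality yields it only in the absence of
  diamonds, which are therefore treated as an obstruction of their own. In the construction, a new
  block must meet the part already drawn in a single vertex. This is why \<open>partial_rep\<close>
  also demands that the drawn part be as connected as \<open>U\<close> allows and closed under
  triangles over its edges. Since \<open>obstructed\<close> speaks about subsets of one fixed graph
  and is monotone, it suffices to know that the unfolded tree with triangles is again obstructed: a
  minimal obstructed set containing it cannot be larger.\<close>

locale adjacency =
  fixes E :: "'a rel"
  assumes sym_E: "(u, v) \<in> E \<Longrightarrow> (v, u) \<in> E"
    and irrefl_E: "(u, u) \<notin> E"
begin

definition independent3 :: "'a \<Rightarrow> 'a \<Rightarrow> 'a \<Rightarrow> bool" where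
  "independent3 a b c \<longleftrightarrow> a \<noteq> b \<and> a \<noteq> c \<and> b \<noteq> c \<and> (a, b) \<notin> E \<and> (a, c) \<notin> E \<and> (b, c) \<notin> E"

definition clique4 :: "'a \<Rightarrow> 'a \<Rightarrow> 'a \<Rightarrow> 'a \<Rightarrow> bool" where
  "clique4 a b c d \<longleftrightarrow>
     (a, b) \<in> E \<and> (a, c) \<in> E \<and> (a, d) \<in> E \<and> (b, c) \<in> E \<and> (b, d) \<in> E \<and> (c, d) \<in> E"

definition diamond :: "'a \<Rightarrow> 'a \<Rightarrow> 'a \<Rightarrow> 'a \<Rightarrow> bool" where
  "diamond a b c d \<longleftrightarrow>
     (a, b) \<in> E \<and> (a, c) \<in> E \<and> (a, d) \<in> E \<and> (b, c) \<in> E \<and> (b, d) \<in> E \<and> c \<noteq> d \<and> (c, d) \<notin> E"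

text \<open>
  \<open>forced W u x\<close>: in every representation of the subgraph induced by \<open>W\<close>, the path of \<open>u\<close> ends
  where it meets the path of \<open>x\<close>. The branching rule holds because both ends of \<open>x\<close> are used up
  elsewhere.
\<close>

inductive forced :: "'a set \<Rightarrow> 'a \<Rightarrow> 'a \<Rightarrow> bool" for W where
  clique: "u \<in> W \<Longrightarrow> x \<in> W \<Longrightarrow> a \<in> W \<Longrightarrow> b \<in> W \<Longrightarrow> clique4 u x a b \<Longrightarrow> forced W u x"
| branch: "u \<in> W \<Longrightarrow> x \<in> W \<Longrightarrow> y \<in> W \<Longrightarrow> z \<in> W \<Longrightarrow>
    (u, x) \<in> E \<Longrightarrow> (x, y) \<in> E \<Longrightarrow> (x, z) \<in> E \<Longrightarrow> independent3 u y z \<Longrightarrow>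
    forced W x y \<Longrightarrow> forced W x z \<Longrightarrow> forced W u x"

text \<open>Pairwise non-adjacent neighbours of \<open>u\<close> meet its path at different points,
  so \<open>u\<close> would need three ends. Independence stands for lying in three different
  blocks.\<close>

definition overcommitted :: "'a set \<Rightarrow> 'a \<Rightarrow> bool" where
  "overcommitted W u \<longleftrightarrow> (\<exists>x\<in>W. \<exists>y\<in>W. \<exists>z\<in>W. (u, x) \<in> E \<and> (u, y) \<in> E \<and> (u, z) \<in> E \<and>
     independent3 x y z \<and> forced W u x \<and> forced W u y \<and> forced W u z)"

text \<open>The last two alternatives are \<open>K4_minus\<close> and
  \<open>complete_graph 5\<close>, described through edges: distinctness follows from irreflexivity,
  except for the two non-adjacent vertices of a diamond, where \<open>diamond\<close> demands
  it.\<close>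

definition obstructed :: "'a set \<Rightarrow> bool" where
  "obstructed W \<longleftrightarrow>
     (\<exists>u\<in>W. overcommitted W u) \<or>
     (\<exists>a\<in>W. \<exists>b\<in>W. \<exists>c\<in>W. \<exists>d\<in>W. diamond a b c d) \<or>
     (\<exists>a\<in>W. \<exists>b\<in>W. \<exists>c\<in>W. \<exists>d\<in>W. \<exists>e\<in>W.
        clique4 a b c d \<and> (a, e) \<in> E \<and> (b, e) \<in> E \<and> (c, e) \<in> E \<and> (d, e) \<in> E)"

lemma forced_mem: "forced W u x \<Longrightarrow> u \<in> W \<and> x \<in> W"
  by (induction rule: forced.induct) auto

lemma forced_mono: "forced W u x \<Longrightarrow> W \<subseteq> W' \<Longrightarrow> forced W' u x"
  by (induction rule: forced.induct) (auto intro: forced.intros)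

lemma overcommitted_mono: "overcommitted W u \<Longrightarrow> W \<subseteq> W' \<Longrightarrow> overcommitted W' u"
  unfolding overcommitted_def by (meson forced_mono subsetD)

text \<open>Non-edges are required only between vertices of the configuration itself, so further
  vertices destroy nothing. The single deletion pass rests on this, and so does the argument that a
  minimal obstructed set has no vertex beyond a given obstruction.\<close>

lemma obstructed_mono: "obstructed W \<Longrightarrow> W \<subseteq> W' \<Longrightarrow> obstructed W'"
  unfolding obstructed_def
  apply (elim disjE)
    apply (meson overcommitted_mono subsetD)
   apply (meson subsetD)
  apply (meson subsetD)
  done

section \<open>Neighbours separated by a vertex\<close>

text \<open>The vertex \<open>y\<close> belongs to it in any case, also for \<open>y = x\<close> or
  \<open>y\<close> outside \<open>W\<close>; hence the side conditions of
  \<open>component_subset\<close>.\<close>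

definition component :: "'a set \<Rightarrow> 'a \<Rightarrow> 'a \<Rightarrow> 'a set" where
  "component W x y = {w. (y, w) \<in> (Restr E (W - {x}))\<^sup>*}"

text \<open>Equivalently, all blocks of the graph induced by \<open>W\<close> are complete, that is,
  its connected components are block graphs. This form yields disjoint parts directly and passes to
  subsets.\<close>

definition separating :: "'a set \<Rightarrow> bool" where
  "separating W \<longleftrightarrow> (\<forall>x\<in>W. \<forall>y\<in>W. \<forall>z\<in>W.
     (x, y) \<in> E \<and> (x, z) \<in> E \<and> y \<noteq> z \<and> (y, z) \<notin> E \<longrightarrow> z \<notin> component W x y)"

definition long_induced_cycle :: "'a list \<Rightarrow> bool" where
  "long_induced_cycle p \<longleftrightarrow> distinct p \<and> 4 \<le> length p \<and>
     (\<forall>i<length p. \<forall>j<length p.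
        (p ! i, p ! j) \<in> E \<longleftrightarrow> j = (i + 1) mod length p \<or> i = (j + 1) mod length p)"

abbreviation walk :: "'a list \<Rightarrow> bool" where
  "walk p \<equiv> successively (\<lambda>a b. (a, b) \<in> E) p"

lemma walk_of_rtrancl:
  assumes "(y, z) \<in> (Restr E U)\<^sup>*" "y \<in> U"
  shows "\<exists>p. p \<noteq> [] \<and> hd p = y \<and> last p = z \<and> set p \<subseteq> U \<and> walk p"
  using assms
proof (induction rule: converse_rtrancl_induct)
  case base
  then show ?case by (intro exI[of _ "[z]"]) auto
next
  case (step a b)
  then obtain p where "p \<noteq> []" "hd p = b" "last p = z" "set p \<subseteq> U" "walk p" by auto
  with step show ?case
    by (intro exI[of _ "a # p"]) (auto simp: successively_Cons)
qed

lemma walk_shortcut: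
  assumes "walk p" "i < j" "j < length p" "(p ! i, p ! j) \<in> E"
  shows "walk (take (i + 1) p @ drop j p) \<and> hd (take (i + 1) p @ drop j p) = hd p \<and>
    last (take (i + 1) p @ drop j p) = last p \<and> set (take (i + 1) p @ drop j p) \<subseteq> set p"
proof -
  have "walk (take (i + 1) p)" "walk (drop j p)"
    using assms(1) by (metis append_take_drop_id successively_append_iff)+
  moreover have "last (take (i + 1) p) = p ! i" "hd (drop j p) = p ! j"
    using assms by (auto simp: take_Suc_conv_app_nth hd_drop_conv_nth)
  ultimately have "walk (take (i + 1) p @ drop j p)"
    using assms by (auto simp: successively_append_iff)
  moreover have "hd (take (i + 1) p @ drop j p) = hd p" using assms by (cases p) auto
  moreover have "last (take (i + 1) p @ drop j p) = last p" using assms by auto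
  ultimately show ?thesis by (auto dest: in_set_takeD in_set_dropD)
qed

lemma walk_cut_repetition:
  assumes "walk p" "i < j" "j < length p" "p ! i = p ! j"
  shows "walk (take i p @ drop j p) \<and> hd (take i p @ drop j p) = hd p \<and>
    last (take i p @ drop j p) = last p \<and> set (take i p @ drop j p) \<subseteq> set p"
proof (cases i)
  case 0
  have "walk (drop j p)" using assms(1) by (metis append_take_drop_id successively_append_iff)
  moreover have "hd p = p ! 0" using assms by (intro hd_conv_nth) auto
  ultimately show ?thesis using 0 assms
    by (auto simp: hd_drop_conv_nth dest: in_set_dropD)
next
  case (Suc k)
  \<comment> \<open>A repetition after the first position amounts to a chord from the predecessor of
    \<open>i\<close> to \<open>j\<close>.\<close>
  have "(p ! k, p ! Suc k) \<in> E" using assms(1-3) Suc by (auto simp: successively_conv_nth)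
  then have "(p ! k, p ! j) \<in> E" using assms(4) Suc by simp
  then show ?thesis using walk_shortcut[of p k j] assms Suc by auto
qed

text \<open>A shortest walk avoiding \<open>x\<close> between two non-adjacent neighbours of
  \<open>x\<close> has neither chords nor repetitions, so \<open>x\<close> closes it to an induced
  cycle unless \<open>x\<close> has a neighbour inside the walk. Such a neighbour is adjacent to
  both ends, or else a prefix or suffix would be shorter; then the walk has three vertices and forms
  a diamond with \<open>x\<close>.\<close>

lemma separating_if_no_induced_cycle:
  assumes no_cyc: "\<And>p. set p \<subseteq> W \<Longrightarrow> \<not> long_induced_cycle p"
    and no_diamond: "\<And>a b c d. a \<in> W \<Longrightarrow> b \<in> W \<Longrightarrow> c \<in> W \<Longrightarrow> d \<in> W \<Longrightarrow> \<not> diamond a b c d"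
  shows "separating W"
proof (rule ccontr)
  assume "\<not> separating W"
  then obtain x y0 z0 where x: "x \<in> W" and y0: "y0 \<in> W" "z0 \<in> W" "(x, y0) \<in> E" "(x, z0) \<in> E"
    "y0 \<noteq> z0" "(y0, z0) \<notin> E" "(y0, z0) \<in> (Restr E (W - {x}))\<^sup>*"
    unfolding separating_def component_def by blast
  \<comment> \<open>The ends are not fixed: a prefix or suffix stopping at another neighbour of
    \<open>x\<close> must compete in the minimum as well.\<close>
  define good where "good = (\<lambda>p. p \<noteq> [] \<and> set p \<subseteq> W - {x} \<and> walk p \<and> (x, hd p) \<in> E \<and>
    (x, last p) \<in> E \<and> hd p \<noteq> last p \<and> (hd p, last p) \<notin> E)"
  have "y0 \<in> W - {x}" using y0 irrefl_E by auto
  from walk_of_rtrancl[OF y0(7) this] obtain p0 where "good p0"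
    using y0 unfolding good_def by auto
  from ex_has_least_nat[of good, OF this, of length] obtain p
    where p: "good p" and least: "\<And>q. good q \<Longrightarrow> length p \<le> length q" by auto
  have p': "p \<noteq> []" "set p \<subseteq> W - {x}" "walk p" "(x, hd p) \<in> E"
    "(x, last p) \<in> E" "hd p \<noteq> last p" "(hd p, last p) \<notin> E"
    using p unfolding good_def by auto
  let ?k = "length p"
  have hd: "hd p = p ! 0" and last: "last p = p ! (?k - 1)"
    using p'(1) by (auto simp: hd_conv_nth last_conv_nth)
  have no_chord: False if "i < j" "j < ?k" "(p ! i, p ! j) \<in> E" "j \<noteq> i + 1" for i j
  proof -
    from walk_shortcut[OF p'(3) that(1-3)] have "good (take (i + 1) p @ drop j p)"
      using p' that unfolding good_def by auto
    from least[OF this] that show False by auto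
  qed
  have dist: "distinct p"
  proof (rule ccontr)
    assume "\<not> distinct p"
    then obtain i j where ij: "i < j" "j < ?k" "p ! i = p ! j"
      unfolding distinct_conv_nth by (metis linorder_neqE_nat)
    from walk_cut_repetition[OF p'(3) ij] have "good (take i p @ drop j p)"
      using p' ij unfolding good_def by auto
    from least[OF this] ij show False by auto
  qed
  have succ: "(p ! i, p ! (i + 1)) \<in> E" if "i + 1 < ?k" for i
    using p'(3) that by (auto simp: successively_conv_nth)
  have adj_p: "(p ! i, p ! j) \<in> E \<longleftrightarrow> j = i + 1 \<or> i = j + 1" if "i < ?k" "j < ?k" for i j
  proof (cases i j rule: linorder_cases)
    case less
    then show ?thesis using that succ no_chord by force
  next
    case equal
    then show ?thesis using irrefl_E by auto
  next
    case greater
    then show ?thesis using that succ[of j] no_chord[of j i] sym_E by force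
  qed
  have k3: "?k \<ge> 3"
  proof (rule ccontr)
    assume "\<not> ?k \<ge> 3"
    with p'(1) have "?k = 1 \<or> ?k = 2" by (cases p) (auto simp: not_le less_Suc_eq numeral_3_eq_3)
    then show False using p' hd last succ[of 0] by auto
  qed
  have inner: "(x, p ! j) \<notin> E" if j: "0 < j" "j < ?k - 1" for j
  proof
    assume xj: "(x, p ! j) \<in> E"
    have "walk (take (j + 1) p)" "walk (drop j p)"
      using p'(3) by (metis append_take_drop_id successively_append_iff)+
    have "j = 1"
    proof (rule ccontr)
      assume "j \<noteq> 1"
      with j have "(p ! 0, p ! j) \<notin> E" using adj_p[of 0 j] p'(1) by auto
      then have "(hd p, p ! j) \<notin> E" unfolding hd .
      moreover have "hd p \<noteq> p ! j" using j hd dist p'(1) by (auto simp: nth_eq_iff_index_eq)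
      moreover have "last (take (j + 1) p) = p ! j" using j by (auto simp: take_Suc_conv_app_nth)
      ultimately have "good (take (j + 1) p)"
        using p' \<open>walk (take (j + 1) p)\<close> xj unfolding good_def
        by (auto dest: in_set_takeD simp del: take_Suc) 
      from least[OF this] j show False by auto
    qed
    moreover have "j = ?k - 2"
    proof (rule ccontr)
      assume "j \<noteq> ?k - 2"
      with j have "(p ! j, last p) \<notin> E" using adj_p[of j "?k - 1"] last by auto
      moreover have "p ! j \<noteq> last p" using j last dist p'(1) by (auto simp: nth_eq_iff_index_eq)
      moreover have "hd (drop j p) = p ! j" using j by (auto simp: hd_drop_conv_nth)
      ultimately have "good (drop j p)"
        using p' \<open>walk (drop j p)\<close> xj j unfolding good_def
        by (auto dest: in_set_dropD)
      from least[OF this] j show False by auto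
    qed
    ultimately have "?k = 3" "j = 1" using j by auto
    then have "diamond x (p ! 1) (p ! 0) (p ! 2)"
      using p' xj hd last succ[of 0] succ[of 1] sym_E unfolding diamond_def
      by (auto simp: numeral_2_eq_2)
    moreover have "p ! i \<in> W" if "i < 3" for i
      using p'(2) \<open>?k = 3\<close> that nth_mem[of i p] by (metis DiffE subsetD)
    ultimately show False using no_diamond x by force
  qed
  have "long_induced_cycle (x # p)"
    unfolding long_induced_cycle_def
  proof (intro conjI allI impI)
    show "distinct (x # p)" using dist p' by auto
    show "4 \<le> length (x # p)" using k3 by auto
    fix i j assume ij: "i < length (x # p)" "j < length (x # p)"
    have md: "(i + 1) mod length (x # p) = (if i = ?k then 0 else i + 1)" if "i \<le> ?k" for i
      using that by auto
    have x_adj: "(x, p ! m) \<in> E \<longleftrightarrow> m = 0 \<or> m = ?k - 1" if "m < ?k" for m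
      using inner[of m] that p' hd last by (metis One_nat_def Suc_pred length_greater_0_conv less_antisym neq0_conv)
    show "((x # p) ! i, (x # p) ! j) \<in> E \<longleftrightarrow>
      j = (i + 1) mod length (x # p) \<or> i = (j + 1) mod length (x # p)"
      using ij k3 md[of i] md[of j] adj_p[of "i - 1" "j - 1"] x_adj[of "i - 1"] x_adj[of "j - 1"]
        irrefl_E sym_E
      by (cases i; cases j) (auto split: if_splits)
  qed
  with no_cyc[of "x # p"] x p' show False by auto
qed

lemma separating_subset:
  assumes "separating W" "U \<subseteq> W"
  shows "separating U"
proof -
  have "component U x y \<subseteq> component W x y" for x y
    using rtrancl_mono[of "Restr E (U - {x})" "Restr E (W - {x})"] assms(2)
    unfolding component_def by blast
  then show ?thesis using assms unfolding separating_def by (meson subsetD)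
qed


section \<open>Components beyond a neighbour\<close>

lemma component_subset: "y \<in> W \<Longrightarrow> y \<noteq> x \<Longrightarrow> component W x y \<subseteq> W - {x}"
  unfolding component_def by (auto elim: rtranclE)

lemma component_refl: "y \<in> component W x y"
  unfolding component_def by simp

lemma component_step:
  "a \<in> component W x y \<Longrightarrow> a \<in> W - {x} \<Longrightarrow> (a, b) \<in> E \<Longrightarrow> b \<in> W - {x} \<Longrightarrow> b \<in> component W x y"
  unfolding component_def by (auto intro: rtrancl_into_rtrancl)

lemma component_trans:
  "b \<in> component W x a \<Longrightarrow> c \<in> component W x b \<Longrightarrow> c \<in> component W x a"
  unfolding component_def by auto

lemma component_commute: "b \<in> component W x a \<Longrightarrow> a \<in> component W x b"
proof -
  have "sym ((Restr E (W - {x}))\<^sup>*)" by (intro sym_rtrancl) (auto simp: sym_def intro: sym_E)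
  then show "b \<in> component W x a \<Longrightarrow> a \<in> component W x b"
    unfolding component_def by (auto dest: symD)
qed

text \<open>The component of \<open>y\<close> avoids both \<open>x\<close> and \<open>u\<close>, and
  \<open>x\<close> joins it through \<open>y\<close>; so it lies on the side of \<open>x\<close> as
  seen from \<open>u\<close>. This carries the containment claim through the induction on
  \<open>forced\<close>.\<close>

lemma component_nested:
  assumes "u \<notin> component W x y" "(x, y) \<in> E" "x \<in> W" "y \<in> W" "u \<noteq> x" "y \<noteq> x"
  shows "component W x y \<subseteq> component W u x"
proof
  fix w assume "w \<in> component W x y"
  then have "(y, w) \<in> (Restr E (W - {x}))\<^sup>*" unfolding component_def by simp
  then show "w \<in> component W u x"
  proof (induction rule: rtrancl_induct)
    case base
    have "y \<noteq> u" using assms(1) component_refl by auto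
    then show ?case using component_step[OF component_refl[of x W u], of y] assms by auto
  next
    case (step a b)
    have "a \<in> component W x y" "b \<in> component W x y"
      using step unfolding component_def by (auto intro: rtrancl_into_rtrancl)
    then have "a \<noteq> u" "b \<noteq> u" using assms(1) by auto
    then show ?case using component_step[OF step.IH, of b] step by auto
  qed
qed

lemma separatingD:
  "separating W \<Longrightarrow> x \<in> W \<Longrightarrow> y \<in> W \<Longrightarrow> z \<in> W \<Longrightarrow> (x, y) \<in> E \<Longrightarrow> (x, z) \<in> E \<Longrightarrow> y \<noteq> z \<Longrightarrow>
    (y, z) \<notin> E \<Longrightarrow> z \<notin> component W x y"
  unfolding separating_def by blast

text \<open>
  A piece of an obstruction with root \<open>u\<close>: \<open>insert u S\<close> is the tree and \<open>D\<close> are the triangles. In an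
  obstruction the tree degree and the number of attached triangles of a vertex add up to three; here
  the root has only \<open>r\<close> of these.
\<close>

definition cubic_part :: "'a \<Rightarrow> 'a set \<Rightarrow> 'a set set \<Rightarrow> nat \<Rightarrow> bool" where
  "cubic_part u S D r \<longleftrightarrow> finite S \<and> finite D \<and> u \<notin> S \<and>
     (\<forall>d\<in>D. card d = 3 \<and> d \<inter> insert u S = {} \<and> (\<forall>a\<in>d. \<forall>b\<in>d. a \<noteq> b \<longrightarrow> (a, b) \<in> E)) \<and>
     (\<forall>d\<in>D. \<forall>d'\<in>D. d \<noteq> d' \<longrightarrow> d \<inter> d' = {} \<and> (\<forall>a\<in>d. \<forall>b\<in>d'. (a, b) \<notin> E)) \<and>
     (\<forall>d\<in>D. \<exists>v\<in>insert u S. (\<forall>a\<in>d. (v, a) \<in> E) \<and> (\<forall>a\<in>d. \<forall>w\<in>insert u S - {v}. (w, a) \<notin> E)) \<and>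
     (\<forall>v\<in>S. (u, v) \<in> (Restr E (insert u S))\<^sup>*) \<and>
     (\<forall>a\<in>insert u S. \<forall>b\<in>insert u S. \<forall>c\<in>insert u S. \<not> ((a, b) \<in> E \<and> (b, c) \<in> E \<and> (a, c) \<in> E)) \<and>
     (\<forall>v\<in>S. card {w \<in> insert u S. (v, w) \<in> E} + card {d \<in> D. \<forall>a\<in>d. (v, a) \<in> E} = 3) \<and>
     card {w \<in> S. (u, w) \<in> E} + card {d \<in> D. \<forall>a\<in>d. (u, a) \<in> E} = r"

lemma cubic_partD:
  assumes "cubic_part u S D r"
  shows "finite S" "finite D" "u \<notin> S"
    "\<And>d. d \<in> D \<Longrightarrow> card d = 3" "\<And>d. d \<in> D \<Longrightarrow> d \<inter> insert u S = {}"
    "\<And>d a b. d \<in> D \<Longrightarrow> a \<in> d \<Longrightarrow> b \<in> d \<Longrightarrow> a \<noteq> b \<Longrightarrow> (a, b) \<in> E"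
    "\<And>d d'. d \<in> D \<Longrightarrow> d' \<in> D \<Longrightarrow> d \<noteq> d' \<Longrightarrow> d \<inter> d' = {}"
    "\<And>d d' a b. d \<in> D \<Longrightarrow> d' \<in> D \<Longrightarrow> d \<noteq> d' \<Longrightarrow> a \<in> d \<Longrightarrow> b \<in> d' \<Longrightarrow> (a, b) \<notin> E"
    "\<And>d. d \<in> D \<Longrightarrow> \<exists>v\<in>insert u S. (\<forall>a\<in>d. (v, a) \<in> E) \<and> (\<forall>a\<in>d. \<forall>w\<in>insert u S - {v}. (w, a) \<notin> E)"
    "\<And>v. v \<in> S \<Longrightarrow> (u, v) \<in> (Restr E (insert u S))\<^sup>*"
    "\<And>a b c. a \<in> insert u S \<Longrightarrow> b \<in> insert u S \<Longrightarrow> c \<in> insert u S \<Longrightarrow>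
      (a, b) \<in> E \<Longrightarrow> (b, c) \<in> E \<Longrightarrow> (a, c) \<in> E \<Longrightarrow> False"
    "\<And>v. v \<in> S \<Longrightarrow> card {w \<in> insert u S. (v, w) \<in> E} + card {d \<in> D. \<forall>a\<in>d. (v, a) \<in> E} = 3"
    "card {w \<in> S. (u, w) \<in> E} + card {d \<in> D. \<forall>a\<in>d. (u, a) \<in> E} = r"
    "\<And>d. d \<in> D \<Longrightarrow> d \<noteq> {}"
proof -
  note h = assms[unfolded cubic_part_def]
  note t1 = h[THEN conjunct2] note t2 = t1[THEN conjunct2] note t3 = t2[THEN conjunct2]
  note t4 = t3[THEN conjunct2] note t5 = t4[THEN conjunct2] note t6 = t5[THEN conjunct2]
  note t7 = t6[THEN conjunct2] note t8 = t7[THEN conjunct2] note t9 = t8[THEN conjunct2]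
  show "finite S" "finite D" "u \<notin> S"
    using h[THEN conjunct1] t1[THEN conjunct1] t2[THEN conjunct1] by blast+
  note d = bspec[OF t3[THEN conjunct1]]
  show "card d = 3" if "d \<in> D" for d using d[OF that] by (rule conjunct1)
  then show "d \<noteq> {}" if "d \<in> D" for d using that by fastforce
  show "d \<inter> insert u S = {}" if "d \<in> D" for d using d[OF that, THEN conjunct2] by (rule conjunct1)
  show "(a, b) \<in> E" if "d \<in> D" "a \<in> d" "b \<in> d" "a \<noteq> b" for d a b
    using d[OF that(1), THEN conjunct2, THEN conjunct2] that(2-4) by blast
  note dd = bspec[OF bspec[OF t4[THEN conjunct1]], THEN mp]
  show "d \<inter> d' = {}" if "d \<in> D" "d' \<in> D" "d \<noteq> d'" for d d'
    using dd[OF that, THEN conjunct1] .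
  show "(a, b) \<notin> E" if "d \<in> D" "d' \<in> D" "d \<noteq> d'" "a \<in> d" "b \<in> d'" for d d' a b
    using dd[OF that(1-3), THEN conjunct2] that(4,5) by blast
  show "\<exists>v\<in>insert u S. (\<forall>a\<in>d. (v, a) \<in> E) \<and> (\<forall>a\<in>d. \<forall>w\<in>insert u S - {v}. (w, a) \<notin> E)"
    if "d \<in> D" for d using bspec[OF t5[THEN conjunct1] that] .
  show "(u, v) \<in> (Restr E (insert u S))\<^sup>*" if "v \<in> S" for v using bspec[OF t6[THEN conjunct1] that] .
  show False if "a \<in> insert u S" "b \<in> insert u S" "c \<in> insert u S"
    "(a, b) \<in> E" "(b, c) \<in> E" "(a, c) \<in> E" for a b c
    using bspec[OF bspec[OF bspec[OF t7[THEN conjunct1] that(1)] that(2)] that(3)] that(4-6) by blast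
  show "card {w \<in> insert u S. (v, w) \<in> E} + card {d \<in> D. \<forall>a\<in>d. (v, a) \<in> E} = 3" if "v \<in> S" for v
    using bspec[OF t8[THEN conjunct1] that] .
  show "card {w \<in> S. (u, w) \<in> E} + card {d \<in> D. \<forall>a\<in>d. (u, a) \<in> E} = r"
    using t8[THEN conjunct2] .
qed

lemma cubic_partI:
  assumes "finite S" "finite D" "u \<notin> S"
    "\<And>d. d \<in> D \<Longrightarrow> card d = 3" "\<And>d. d \<in> D \<Longrightarrow> d \<inter> insert u S = {}"
    "\<And>d a b. d \<in> D \<Longrightarrow> a \<in> d \<Longrightarrow> b \<in> d \<Longrightarrow> a \<noteq> b \<Longrightarrow> (a, b) \<in> E"
    "\<And>d d'. d \<in> D \<Longrightarrow> d' \<in> D \<Longrightarrow> d \<noteq> d' \<Longrightarrow> d \<inter> d' = {}"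
    "\<And>d d' a b. d \<in> D \<Longrightarrow> d' \<in> D \<Longrightarrow> d \<noteq> d' \<Longrightarrow> a \<in> d \<Longrightarrow> b \<in> d' \<Longrightarrow> (a, b) \<notin> E"
    "\<And>d. d \<in> D \<Longrightarrow> \<exists>v\<in>insert u S. (\<forall>a\<in>d. (v, a) \<in> E) \<and> (\<forall>a\<in>d. \<forall>w\<in>insert u S - {v}. (w, a) \<notin> E)"
    "\<And>v. v \<in> S \<Longrightarrow> (u, v) \<in> (Restr E (insert u S))\<^sup>*"
    "\<And>a b c. a \<in> insert u S \<Longrightarrow> b \<in> insert u S \<Longrightarrow> c \<in> insert u S \<Longrightarrow>
      (a, b) \<in> E \<Longrightarrow> (b, c) \<in> E \<Longrightarrow> (a, c) \<in> E \<Longrightarrow> False"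
    "\<And>v. v \<in> S \<Longrightarrow> card {w \<in> insert u S. (v, w) \<in> E} + card {d \<in> D. \<forall>a\<in>d. (v, a) \<in> E} = 3"
    "card {w \<in> S. (u, w) \<in> E} + card {d \<in> D. \<forall>a\<in>d. (u, a) \<in> E} = r"
  shows "cubic_part u S D r"
  unfolding cubic_part_def
  by (intro conjI ballI impI; ((rule assms; assumption) |
    (rule notI, elim conjE, rule assms(11), assumption+)))

text \<open>The end of a branch of the unfolding: the root carries one triangle and there is no
  further tree vertex.\<close>

lemma cubic_part_clique:
  assumes "clique4 u x a b"
  shows "cubic_part u {} {{x, a, b}} 1"
proof -
  have ne: "u \<noteq> x" "u \<noteq> a" "u \<noteq> b" "x \<noteq> a" "x \<noteq> b" "a \<noteq> b"
    using assms irrefl_E unfolding clique4_def by blast+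
  have "{d \<in> {{x, a, b}}. \<forall>a\<in>d. (u, a) \<in> E} = {{x, a, b}}"
    using assms unfolding clique4_def by auto
  then show ?thesis
    unfolding cubic_part_def using assms ne sym_E irrefl_E unfolding clique4_def by auto
qed

text \<open>The old root \<open>x\<close> lacks one unit, and the edge to the new root
  \<open>u\<close> supplies it. As \<open>u\<close> sees nothing else of the piece, all other counts
  stay as they are.\<close>

lemma cubic_part_extend:
  assumes part: "cubic_part x S D 2" and u: "u \<notin> insert x S" "u \<notin> \<Union>D" "(u, x) \<in> E"
    and far: "\<And>w. w \<in> S \<union> \<Union>D \<Longrightarrow> (u, w) \<notin> E"
  shows "cubic_part u (insert x S) D 1"
proof (rule cubic_partI)
  note p = cubic_partD[OF part]
  show "finite (insert x S)" "finite D" "u \<notin> insert x S" using p u by auto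
  show "card d = 3" "d \<inter> insert u (insert x S) = {}" if "d \<in> D" for d
    using p(4,5)[OF that] u(2) that by auto
  show "(a, b) \<in> E" if "d \<in> D" "a \<in> d" "b \<in> d" "a \<noteq> b" for d a b using p(6) that .
  show "d \<inter> d' = {}" if "d \<in> D" "d' \<in> D" "d \<noteq> d'" for d d' using p(7) that .
  show "(a, b) \<notin> E" if "d \<in> D" "d' \<in> D" "d \<noteq> d'" "a \<in> d" "b \<in> d'" for d d' a b using p(8) that .
  show "\<exists>v\<in>insert u (insert x S). (\<forall>a\<in>d. (v, a) \<in> E) \<and>
      (\<forall>a\<in>d. \<forall>w\<in>insert u (insert x S) - {v}. (w, a) \<notin> E)" if d: "d \<in> D" for d
  proof -
    obtain v where v: "v \<in> insert x S" "\<forall>a\<in>d. (v, a) \<in> E"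
      "\<forall>a\<in>d. \<forall>w\<in>insert x S - {v}. (w, a) \<notin> E" using p(9)[OF d] by blast
    moreover have "\<forall>a\<in>d. (u, a) \<notin> E" using far d by blast
    ultimately show ?thesis by (intro bexI[of _ v]) auto
  qed
  have mono: "(Restr E (insert x S))\<^sup>* \<subseteq> (Restr E (insert u (insert x S)))\<^sup>*"
    by (intro rtrancl_mono) auto
  show "(u, v) \<in> (Restr E (insert u (insert x S)))\<^sup>*" if v: "v \<in> insert x S" for v
  proof -
    have "(x, v) \<in> (Restr E (insert x S))\<^sup>*" using p(10) v by (cases "v = x") auto
    then have "(x, v) \<in> (Restr E (insert u (insert x S)))\<^sup>*" using mono by blast
    moreover have "(u, x) \<in> Restr E (insert u (insert x S))" using u by auto
    ultimately show ?thesis by (rule converse_rtrancl_into_rtrancl[rotated])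
  qed
  show False if "a \<in> insert u (insert x S)" "b \<in> insert u (insert x S)" "c \<in> insert u (insert x S)"
    "(a, b) \<in> E" "(b, c) \<in> E" "(a, c) \<in> E" for a b c
  proof -
    have nu: "w = x" if "(u, w) \<in> E" "w \<in> insert u (insert x S)" for w
      using far[of w] irrefl_E[of u] that by auto
    have nu': "w = x" if "(w, u) \<in> E" "w \<in> insert u (insert x S)" for w
      using nu sym_E that by blast
    have "a \<noteq> u" using that nu[of b] nu[of c] irrefl_E by blast
    moreover have "b \<noteq> u" using that nu'[of a] nu[of c] irrefl_E by blast
    moreover have "c \<noteq> u" using that nu'[of a] nu'[of b] irrefl_E by blast
    ultimately show False using p(11)[of a b c] that by blast
  qed
  show "card {w \<in> insert u (insert x S). (v, w) \<in> E} + card {d \<in> D. \<forall>a\<in>d. (v, a) \<in> E} = 3"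
    if v: "v \<in> insert x S" for v
  proof (cases "v = x")
    case True
    have "{w \<in> insert u (insert x S). (x, w) \<in> E} = insert u {w \<in> S. (x, w) \<in> E}"
      using sym_E[OF u(3)] irrefl_E by auto
    then show ?thesis using True p(13) p(1) u by simp
  next
    case False
    then have vS: "v \<in> S" using v by auto
    have "{w \<in> insert u (insert x S). (v, w) \<in> E} = {w \<in> insert x S. (v, w) \<in> E}"
      using far[of v] vS sym_E[of v u] by auto
    then show ?thesis using p(12)[OF vS] by simp
  qed
  have 1: "{w \<in> insert x S. (u, w) \<in> E} = {x}" using far u by auto
  have 2: "{d \<in> D. \<forall>a\<in>d. (u, a) \<in> E} = {}" using far p(14) by blast
  show "card {w \<in> insert x S. (u, w) \<in> E} + card {d \<in> D. \<forall>a\<in>d. (u, a) \<in> E} = 1"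
    unfolding 1 2 by simp
qed

text \<open>Two pieces that share only the root and have no edges across keep all their inner
  counts, while the counts at the root add up.\<close>

lemma cubic_part_glue:
  assumes part1: "cubic_part u S1 D1 r1" and part2: "cubic_part u S2 D2 r2"
    and disj: "(S1 \<union> \<Union>D1) \<inter> (S2 \<union> \<Union>D2) = {}"
    and far: "\<And>a b. a \<in> S1 \<union> \<Union>D1 \<Longrightarrow> b \<in> S2 \<union> \<Union>D2 \<Longrightarrow> (a, b) \<notin> E"
  shows "cubic_part u (S1 \<union> S2) (D1 \<union> D2) (r1 + r2)"
proof (rule cubic_partI)
  note p = cubic_partD[OF part1] and q = cubic_partD[OF part2]
  have far': "(b, a) \<notin> E" if "a \<in> S1 \<union> \<Union>D1" "b \<in> S2 \<union> \<Union>D2" for a b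
    using far[OF that] sym_E by blast
  \<comment> \<open>A common triangle, being non-empty, would provide a common vertex.\<close>
  have dD: "D1 \<inter> D2 = {}"
  proof -
    have False if "d \<in> D1" "d \<in> D2" for d using p(14)[OF that(1)] disj that by blast
    then show ?thesis by blast
  qed
  have DD: "\<Union> D1 \<inter> \<Union> D2 = {}" "\<Union>D1 \<inter> insert u S2 = {}" "\<Union>D2 \<inter> insert u S1 = {}"
    using disj p(5) q(5) by blast+
  show "finite (S1 \<union> S2)" "finite (D1 \<union> D2)" "u \<notin> S1 \<union> S2" using p q by auto
  show "card d = 3" if "d \<in> D1 \<union> D2" for d using p(4) q(4) that by blast
  show "d \<inter> insert u (S1 \<union> S2) = {}" if "d \<in> D1 \<union> D2" for d
    using p(5)[of d] q(5)[of d] that DD by blast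
  show "(a, b) \<in> E" if "d \<in> D1 \<union> D2" "a \<in> d" "b \<in> d" "a \<noteq> b" for d a b using p(6) q(6) that by blast
  show "d \<inter> d' = {}" if dd: "d \<in> D1 \<union> D2" "d' \<in> D1 \<union> D2" "d \<noteq> d'" for d d'
  proof -
    consider "d \<in> D1" "d' \<in> D1" | "d \<in> D2" "d' \<in> D2" | "d \<in> D1" "d' \<in> D2" | "d \<in> D2" "d' \<in> D1"
      using dd(1,2) by blast
    then show ?thesis
    proof cases
      case 1 then show ?thesis using p(7)[of d d'] dd(3) by blast
    next
      case 2 then show ?thesis using q(7)[of d d'] dd(3) by blast
    next
      case 3 then show ?thesis using DD(1) by blast
    next
      case 4 then show ?thesis using DD(1) by blast
    qed
  qed
  show "(a, b) \<notin> E" if dd: "d \<in> D1 \<union> D2" "d' \<in> D1 \<union> D2" "d \<noteq> d'" "a \<in> d" "b \<in> d'" for d d' a b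
  proof -
    consider "d \<in> D1" "d' \<in> D1" | "d \<in> D2" "d' \<in> D2" | "d \<in> D1" "d' \<in> D2" | "d \<in> D2" "d' \<in> D1"
      using dd(1,2) by blast
    then show ?thesis
    proof cases
      case 1 then show ?thesis using p(8)[of d d'] dd(3-5) by blast
    next
      case 2 then show ?thesis using q(8)[of d d'] dd(3-5) by blast
    next
      case 3 then show ?thesis using far[of a b] dd(3-5) by blast
    next
      case 4 then show ?thesis using far'[of b a] dd(3-5) by blast
    qed
  qed
  show "\<exists>v\<in>insert u (S1 \<union> S2). (\<forall>a\<in>d. (v, a) \<in> E) \<and>
      (\<forall>a\<in>d. \<forall>w\<in>insert u (S1 \<union> S2) - {v}. (w, a) \<notin> E)" if "d \<in> D1 \<union> D2" for d
  proof (cases "d \<in> D1")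
    case True
    obtain v where "v \<in> insert u S1" "\<forall>a\<in>d. (v, a) \<in> E"
      "\<forall>a\<in>d. \<forall>w\<in>insert u S1 - {v}. (w, a) \<notin> E" using p(9)[OF True] by blast
    moreover have "\<forall>a\<in>d. \<forall>w\<in>S2. (w, a) \<notin> E" using True far' by blast
    ultimately show ?thesis by (intro bexI[of _ v]) auto
  next
    case False
    then have d2: "d \<in> D2" using that by blast
    obtain v where "v \<in> insert u S2" "\<forall>a\<in>d. (v, a) \<in> E"
      "\<forall>a\<in>d. \<forall>w\<in>insert u S2 - {v}. (w, a) \<notin> E" using q(9)[OF d2] by blast
    moreover have "\<forall>a\<in>d. \<forall>w\<in>S1. (w, a) \<notin> E" using d2 far by blast
    ultimately show ?thesis by (intro bexI[of _ v]) auto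
  qed
  have mono: "(Restr E (insert u S1))\<^sup>* \<subseteq> (Restr E (insert u (S1 \<union> S2)))\<^sup>*"
    "(Restr E (insert u S2))\<^sup>* \<subseteq> (Restr E (insert u (S1 \<union> S2)))\<^sup>*"
    by (rule rtrancl_mono, blast)+
  show "(u, v) \<in> (Restr E (insert u (S1 \<union> S2)))\<^sup>*" if "v \<in> S1 \<union> S2" for v
    using that p(10) q(10) mono by blast
  show False if t: "a \<in> insert u (S1 \<union> S2)" "b \<in> insert u (S1 \<union> S2)" "c \<in> insert u (S1 \<union> S2)"
    "(a, b) \<in> E" "(b, c) \<in> E" "(a, c) \<in> E" for a b c
  proof -
    have cross: "\<not> ((a' \<in> S1 \<and> b' \<in> S2) \<or> (a' \<in> S2 \<and> b' \<in> S1))" if "(a', b') \<in> E" for a' b'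
      using far far' that by blast
    have "(a \<in> insert u S1 \<and> b \<in> insert u S1 \<and> c \<in> insert u S1) \<or>
        (a \<in> insert u S2 \<and> b \<in> insert u S2 \<and> c \<in> insert u S2)"
      using cross[OF t(4)] cross[OF t(5)] cross[OF t(6)] t(1,2,3) by blast
    then show False using p(11)[of a b c] q(11)[of a b c] t by blast
  qed
  show "card {w \<in> insert u (S1 \<union> S2). (v, w) \<in> E} + card {d \<in> D1 \<union> D2. \<forall>a\<in>d. (v, a) \<in> E} = 3"
    if "v \<in> S1 \<union> S2" for v
  proof (cases "v \<in> S1")
    case True
    have "{w \<in> insert u (S1 \<union> S2). (v, w) \<in> E} = {w \<in> insert u S1. (v, w) \<in> E}"
      using far True by blast
    moreover have "{d \<in> D1 \<union> D2. \<forall>a\<in>d. (v, a) \<in> E} = {d \<in> D1. \<forall>a\<in>d. (v, a) \<in> E}"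
      using far True q(14) by blast
    ultimately show ?thesis using p(12)[OF True] by simp
  next
    case False
    then have v2: "v \<in> S2" using that by blast
    have "{w \<in> insert u (S1 \<union> S2). (v, w) \<in> E} = {w \<in> insert u S2. (v, w) \<in> E}"
      using far' v2 by blast
    moreover have "{d \<in> D1 \<union> D2. \<forall>a\<in>d. (v, a) \<in> E} = {d \<in> D2. \<forall>a\<in>d. (v, a) \<in> E}"
      using far' v2 p(14) by blast
    ultimately show ?thesis using q(12)[OF v2] by simp
  qed
  have "{w \<in> S1 \<union> S2. (u, w) \<in> E} = {w \<in> S1. (u, w) \<in> E} \<union> {w \<in> S2. (u, w) \<in> E}" by blast
  then have 1: "card {w \<in> S1 \<union> S2. (u, w) \<in> E} = card {w \<in> S1. (u, w) \<in> E} + card {w \<in> S2. (u, w) \<in> E}"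
    using p(1) q(1) disj by (subst card_Un_disjoint[symmetric]) auto
  have "{d \<in> D1 \<union> D2. \<forall>a\<in>d. (u, a) \<in> E} = {d \<in> D1. \<forall>a\<in>d. (u, a) \<in> E} \<union> {d \<in> D2. \<forall>a\<in>d. (u, a) \<in> E}"
    by blast
  then have 2: "card {d \<in> D1 \<union> D2. \<forall>a\<in>d. (u, a) \<in> E} =
      card {d \<in> D1. \<forall>a\<in>d. (u, a) \<in> E} + card {d \<in> D2. \<forall>a\<in>d. (u, a) \<in> E}"
    using p(2) q(2) dD by (subst card_Un_disjoint[symmetric]) auto
  show "card {w \<in> S1 \<union> S2. (u, w) \<in> E} + card {d \<in> D1 \<union> D2. \<forall>a\<in>d. (u, a) \<in> E} = r1 + r2"
    unfolding 1 2 using p(13) q(13) by simp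
qed

text \<open>An edge or a vertex common to both components would connect \<open>y\<close> with
  \<open>z\<close> without using \<open>x\<close>. Thus the single non-edge between \<open>y\<close>
  and \<open>z\<close> makes everything beyond \<open>y\<close> anticomplete to everything beyond
  \<open>z\<close>.\<close>

lemma components_apart:
  assumes sep: "separating W" and mem: "x \<in> W" "y \<in> W" "z \<in> W"
    and adj: "(x, y) \<in> E" "(x, z) \<in> E" "y \<noteq> z" "(y, z) \<notin> E"
    and a: "a \<in> component W x y" and b: "b \<in> component W x z"
  shows "a \<noteq> b" "(a, b) \<notin> E"
proof -
  have xyz: "y \<noteq> x" "z \<noteq> x" using adj irrefl_E by auto
  have aW: "a \<in> W - {x}" and bW: "b \<in> W - {x}"
    using component_subset[OF mem(2) xyz(1)] component_subset[OF mem(3) xyz(2)] a b by auto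
  have *: "z \<in> component W x b" using b by (rule component_commute)
  have no: "z \<notin> component W x y" using separatingD[OF sep mem adj(1,2,3,4)] .
  show "a \<noteq> b" using no component_trans[OF a] * by blast
  show "(a, b) \<notin> E" using component_step[OF a aW _ bW] component_trans[OF _ *] no by blast
qed

text \<open>A derivation is read as a rooted tree: the clique rule gives a triangle, and the
  branching rule makes \<open>x\<close> a tree vertex with two pieces beyond it and \<open>u\<close>
  as third neighbour. Confining the piece to \<open>component W u x\<close> keeps pieces apart when
  they are glued; repeating \<open>forced\<close> for the vertex set of the piece is what minimality
  is applied to later.\<close>

lemma cubic_part_of_forced:
  assumes sep: "separating W"
  shows "forced W u x \<Longrightarrow> \<exists>S D. cubic_part u S D 1 \<and> S \<union> \<Union>D \<subseteq> component W u x \<and>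
    forced (insert u (S \<union> \<Union>D)) u x"
proof (induction rule: forced.induct)
  case (clique u x a b)
  have ne: "u \<noteq> x" "u \<noteq> a" "u \<noteq> b" using clique(5) irrefl_E unfolding clique4_def by blast+
  have "a \<in> component W u x" "b \<in> component W u x"
    using component_step[OF component_refl[of x W u]] clique ne unfolding clique4_def by auto
  moreover have "forced (insert u ({} \<union> \<Union>{{x, a, b}})) u x"
    using clique(5) by (intro forced.clique[of _ _ _ a b]) auto
  ultimately show ?case using cubic_part_clique[OF clique(5)] component_refl
    by (intro exI[of _ "{}"] exI[of _ "{{x, a, b}}"]) auto
next
  case (branch u x y z)
  obtain S1 D1 where 1: "cubic_part x S1 D1 1" "S1 \<union> \<Union>D1 \<subseteq> component W x y"
    "forced (insert x (S1 \<union> \<Union>D1)) x y" using branch.IH(1) by blast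
  obtain S2 D2 where 2: "cubic_part x S2 D2 1" "S2 \<union> \<Union>D2 \<subseteq> component W x z"
    "forced (insert x (S2 \<union> \<Union>D2)) x z" using branch.IH(2) by blast
  have ne: "u \<noteq> y" "u \<noteq> z" "y \<noteq> z" "(u, y) \<notin> E" "(u, z) \<notin> E" "(y, z) \<notin> E"
    using branch(8) unfolding independent3_def by auto
  have nx: "u \<noteq> x" "y \<noteq> x" "z \<noteq> x" using branch irrefl_E by auto
  have xu: "(x, u) \<in> E" using branch(5) sym_E by blast
  note apart = components_apart[OF sep]
  let ?S = "S1 \<union> S2" and ?D = "D1 \<union> D2"
  let ?A = "?S \<union> \<Union>?D"
  have A: "?A \<subseteq> component W x y \<union> component W x z" using 1 2 by blast
  have "cubic_part x ?S ?D (1 + 1)"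
  proof (rule cubic_part_glue[OF 1(1) 2(1)])
    show "(S1 \<union> \<Union>D1) \<inter> (S2 \<union> \<Union>D2) = {}"
      using apart(1)[of x y z] branch ne 1(2) 2(2) by blast
    show "(a, b) \<notin> E" if "a \<in> S1 \<union> \<Union>D1" "b \<in> S2 \<union> \<Union>D2" for a b
      using apart(2)[of x y z a b] branch ne 1(2) 2(2) that by blast
  qed
  then have part: "cubic_part x ?S ?D 2" unfolding one_add_one .
  \<comment> \<open>Seen from \<open>x\<close>, the vertex \<open>u\<close> is a third neighbour,
    non-adjacent to \<open>y\<close>; so it is separated from everything beyond
    \<open>y\<close>.\<close>
  have u_y: "a \<noteq> u" "(a, u) \<notin> E" if "a \<in> component W x y" for a
    using apart[of x y u a u] branch ne xu component_refl[of u] that sym_E by blast+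
  have u_z: "a \<noteq> u" "(a, u) \<notin> E" if "a \<in> component W x z" for a
    using apart[of x z u a u] branch ne xu component_refl[of u] that sym_E by blast+
  have far: "a \<noteq> u" "(u, a) \<notin> E" if "a \<in> ?A" for a
    using u_y[of a] u_z[of a] A that sym_E[of u a] by blast+
  have "cubic_part u (insert x ?S) ?D 1"
    using far nx branch by (intro cubic_part_extend[OF part]) blast+
  \<comment> \<open>As \<open>u\<close> lies in neither of the components beyond \<open>y\<close>
    and \<open>z\<close>, both hang at \<open>x\<close> without passing \<open>u\<close>.\<close>
  moreover have "insert x ?S \<union> \<Union>?D \<subseteq> component W u x"
    using A component_nested[of u W x y] component_nested[of u W x z] u_y u_z branch nx
      component_refl[of x] by blast
  moreover have "forced (insert u (insert x ?S \<union> \<Union>?D)) u x"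
  proof -
    let ?U = "insert u (insert x ?S \<union> \<Union>?D)"
    have f: "forced ?U x y" "forced ?U x z"
      by (rule forced_mono[OF 1(3)], blast) (rule forced_mono[OF 2(3)], blast)
    have m: "y \<in> ?U" "z \<in> ?U" using forced_mem[OF f(1)] forced_mem[OF f(2)] by simp_all
    show ?thesis by (rule forced.branch[OF _ _ m branch(5-8) f]) simp_all
  qed
  ultimately show ?case by (intro exI conjI)
qed

text \<open>Three pieces with one unit each at the root are glued, so that the root has three units
  like every other tree vertex. The last conclusion makes the vertex set of the result an obstructed
  subset of \<open>W\<close>.\<close>

lemma cubic_part_of_overcommitted:
  assumes sep: "separating W" and u: "u \<in> W" "overcommitted W u"
  shows "\<exists>S D. cubic_part u S D 3 \<and> S \<union> \<Union>D \<subseteq> W \<and> overcommitted (insert u (S \<union> \<Union>D)) u"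
proof -
  obtain x y z where xyz: "x \<in> W" "y \<in> W" "z \<in> W" "(u, x) \<in> E" "(u, y) \<in> E" "(u, z) \<in> E"
    "independent3 x y z" "forced W u x" "forced W u y" "forced W u z"
    using u unfolding overcommitted_def by blast
  have ne: "x \<noteq> y" "x \<noteq> z" "y \<noteq> z" "(x, y) \<notin> E" "(x, z) \<notin> E" "(y, z) \<notin> E"
    using xyz(7) unfolding independent3_def by auto
  have nu: "x \<noteq> u" "y \<noteq> u" "z \<noteq> u" using xyz irrefl_E by auto
  note part = cubic_part_of_forced[OF sep]
  obtain S1 D1 where 1: "cubic_part u S1 D1 1" "S1 \<union> \<Union>D1 \<subseteq> component W u x"
    "forced (insert u (S1 \<union> \<Union>D1)) u x" using part[OF xyz(8)] by blast
  obtain S2 D2 where 2: "cubic_part u S2 D2 1" "S2 \<union> \<Union>D2 \<subseteq> component W u y"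
    "forced (insert u (S2 \<union> \<Union>D2)) u y" using part[OF xyz(9)] by blast
  obtain S3 D3 where 3: "cubic_part u S3 D3 1" "S3 \<union> \<Union>D3 \<subseteq> component W u z"
    "forced (insert u (S3 \<union> \<Union>D3)) u z" using part[OF xyz(10)] by blast
  note apart = components_apart[OF sep u(1)]
  have 12: "a \<noteq> b" "(a, b) \<notin> E" if "a \<in> S1 \<union> \<Union>D1" "b \<in> S2 \<union> \<Union>D2" for a b
    using apart[of x y a b] xyz ne that 1(2) 2(2) by blast+
  have 13: "a \<noteq> b" "(a, b) \<notin> E" if "a \<in> S1 \<union> \<Union>D1" "b \<in> S3 \<union> \<Union>D3" for a b
    using apart[of x z a b] xyz ne that 1(2) 3(2) by blast+
  have 23: "a \<noteq> b" "(a, b) \<notin> E" if "a \<in> S2 \<union> \<Union>D2" "b \<in> S3 \<union> \<Union>D3" for a b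
    using apart[of y z a b] xyz ne that 2(2) 3(2) by blast+
  have "cubic_part u (S1 \<union> S2) (D1 \<union> D2) (1 + 1)"
    by (rule cubic_part_glue[OF 1(1) 2(1)]) (use 12 in blast)+
  then have "cubic_part u (S1 \<union> S2 \<union> S3) (D1 \<union> D2 \<union> D3) (1 + 1 + 1)"
    by (rule cubic_part_glue[OF _ 3(1)]) (use 13 23 in blast)+
  moreover have "1 + 1 + 1 = (3::nat)" by simp
  ultimately have part3: "cubic_part u (S1 \<union> S2 \<union> S3) (D1 \<union> D2 \<union> D3) 3" by metis
  let ?A = "S1 \<union> S2 \<union> S3 \<union> \<Union>(D1 \<union> D2 \<union> D3)"
  have AW: "?A \<subseteq> W"
    using 1(2) 2(2) 3(2) component_subset[of x W u] component_subset[of y W u]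
      component_subset[of z W u] xyz nu by blast
  have "overcommitted (insert u ?A) u"
  proof -
    have f: "forced (insert u ?A) u x" "forced (insert u ?A) u y" "forced (insert u ?A) u z"
      by (rule forced_mono[OF 1(3)], blast) (rule forced_mono[OF 2(3)], blast,
        rule forced_mono[OF 3(3)], blast)
    have m: "x \<in> insert u ?A" "y \<in> insert u ?A" "z \<in> insert u ?A"
      using forced_mem[OF f(1)] forced_mem[OF f(2)] forced_mem[OF f(3)] by simp_all
    show ?thesis unfolding overcommitted_def
      by (rule bexI[OF _ m(1)], rule bexI[OF _ m(2)], rule bexI[OF _ m(3)])
        (intro conjI xyz f)
  qed
  with part3 AW show ?thesis by (intro exI conjI)
qed

end

section \<open>Induced copies and minimal obstructions\<close>

lemma adjacency_parcs:
  assumes "pair_graph G"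
  shows "adjacency (parcs G)"
proof -
  interpret pair_graph G by fact
  show ?thesis
  proof
    show "(v, u) \<in> parcs G" if "(u, v) \<in> parcs G" for u v using that by (rule arcs_symmetric)
    show "(u, u) \<notin> parcs G" for u using pair_no_loops[of "(u, u)"] by auto
  qed
qed

lemma induce_with_proj:
  "with_proj G \<restriction> W = with_proj \<lparr>pverts = W, parcs = Restr (parcs G) W\<rparr>"
  by (auto simp: induce_subgraph_def with_proj_def)

text \<open>Small graphs on \<open>{..<n}\<close> are matched by listing vertices in the order of
  their numbers, which reduces the isomorphism to a comparison of edges by index.\<close>

lemma induces_copy_nth:
  assumes G: "pair_graph G" and l: "distinct l" "set l \<subseteq> pverts G" "length l = n"
    and H: "pverts H = {..<n}" "parcs H \<subseteq> {..<n} \<times> {..<n}"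
    and adj: "\<And>i j. i < n \<Longrightarrow> j < n \<Longrightarrow> (l ! i, l ! j) \<in> parcs G \<longleftrightarrow> (i, j) \<in> parcs H"
  shows "induces_copy G (set l) H"
proof -
  interpret pair_graph G by fact
  \<comment> \<open>The isomorphism runs from the induced subgraph to \<open>H\<close>, hence the
    inverse of indexing.\<close>
  define f where "f = the_inv_into {..<n} ((!) l)"
  have inj: "inj_on ((!) l) {..<n}" using l by (auto simp: inj_on_def nth_eq_iff_index_eq)
  have img: "(!) l ` {..<n} = set l" using l by (auto simp: set_conv_nth)
  have f_nth: "f (l ! i) = i" if "i < n" for i
    unfolding f_def using inj that by (simp add: the_inv_into_f_f)
  have ex: "\<exists>i<n. a = l ! i" if "a \<in> set l" for a using that l by (auto simp: in_set_conv_nth)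
  define hom where "hom = \<lparr>iso_verts = f, iso_arcs = map_prod f f, iso_head = snd, iso_tail = fst\<rparr>"
  have inj_f: "inj_on f (set l)"
  proof (rule inj_onI)
    fix a b assume ab: "a \<in> set l" "b \<in> set l" "f a = f b"
    then obtain i j where "i < n" "a = l ! i" "j < n" "b = l ! j" using ex by blast
    then show "a = b" using f_nth ab(3) by simp
  qed
  have "pre_digraph.digraph_isomorphism (with_proj G \<restriction> set l) hom"
    unfolding pre_digraph.digraph_isomorphism_def
  proof (intro conjI ballI)
    show "wf_digraph (with_proj G \<restriction> set l)" by (rule wellformed_induce_subgraph)
    show "inj_on (iso_verts hom) (verts (with_proj G \<restriction> set l))"
      using inj_f by (simp add: hom_def)
    show "inj_on (iso_arcs hom) (arcs (with_proj G \<restriction> set l))"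
      using inj_f by (auto simp: hom_def inj_on_def)
  qed (auto simp: hom_def)
  moreover have "with_proj H = app_iso hom (with_proj G \<restriction> set l)"
  proof -
    have "f ` set l = {..<n}"
      unfolding img[symmetric] image_image using f_nth by simp
    moreover have "map_prod f f ` (Restr (parcs G) (set l)) = parcs H"
    proof (intro equalityI subsetI)
      fix x assume "x \<in> map_prod f f ` (Restr (parcs G) (set l))"
      then obtain a b where "x = (f a, f b)" "(a, b) \<in> parcs G" "a \<in> set l" "b \<in> set l" by auto
      then obtain i j where "i < n" "a = l ! i" "j < n" "b = l ! j" using ex by blast
      then show "x \<in> parcs H" using adj[of i j] f_nth \<open>(a, b) \<in> parcs G\<close> \<open>x = (f a, f b)\<close> by simp
    next
      fix x assume "x \<in> parcs H"
      then obtain i j where x: "x = (i, j)" and ij: "(i, j) \<in> parcs H" by (cases x) auto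
      then have "i < n" "j < n" using H by auto
      then have "(l ! i, l ! j) \<in> Restr (parcs G) (set l)" using adj ij l by auto
      moreover have "(i, j) = map_prod f f (l ! i, l ! j)" using f_nth \<open>i < n\<close> \<open>j < n\<close> by simp
      ultimately show "x \<in> map_prod f f ` (Restr (parcs G) (set l))"
        unfolding x by (rule rev_image_eqI)
    qed
    ultimately show ?thesis
      unfolding induce_with_proj by (simp add: app_iso_def hom_def with_proj_def H)
  qed
  ultimately show ?thesis unfolding induces_copy_def digraph_iso_def using l by blast
qed

text \<open>Both \<open>G\<close> and the members of \<open>family_T\<close> have natural numbers as
  vertices. So a tree with triangles found in \<open>G\<close> is itself a member, and the identity
  is the isomorphism.\<close>

lemma induces_copy_induced:
  assumes G: "pair_graph G" and W: "W \<subseteq> pverts G"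
  shows "induces_copy G W \<lparr>pverts = W, parcs = Restr (parcs G) W\<rparr>"
proof -
  interpret pair_graph G by fact
  have wf: "wf_digraph (with_proj G \<restriction> W)" by (rule wellformed_induce_subgraph)
  let ?hom = "\<lparr>iso_verts = id, iso_arcs = id, iso_head = snd, iso_tail = fst\<rparr>"
  have "pre_digraph.digraph_isomorphism (with_proj G \<restriction> W) ?hom"
    unfolding pre_digraph.digraph_isomorphism_def using wf by simp
  moreover have "with_proj G \<restriction> W = app_iso ?hom (with_proj G \<restriction> W)"
    unfolding induce_with_proj by (simp add: app_iso_def with_proj_def)
  ultimately have "digraph_iso (with_proj G \<restriction> W) (with_proj G \<restriction> W)"
    unfolding digraph_iso_def by blast
  then show ?thesis
    unfolding induces_copy_def using W by (simp only: induce_with_proj simp_thms)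
qed

lemma pair_graph_induced:
  assumes G: "pair_graph G" and W: "W \<subseteq> pverts G"
  shows "pair_graph \<lparr>pverts = W, parcs = Restr (parcs G) W\<rparr>"
proof -
  interpret pair_graph G by fact
  show ?thesis
  proof
    show "finite (pverts \<lparr>pverts = W, parcs = Restr (parcs G) W\<rparr>)"
      using W pair_finite_verts by (auto intro: finite_subset)
    show "finite (parcs \<lparr>pverts = W, parcs = Restr (parcs G) W\<rparr>)"
      using pair_finite_arcs by auto
    show "symmetric (with_proj \<lparr>pverts = W, parcs = Restr (parcs G) W\<rparr>)"
      by (auto simp: symmetric_def sym_def intro: arcs_symmetric)
  qed (auto dest: no_loops')
qed

lemma chordal_no_long_induced_cycle:
  assumes G: "pair_graph G" and ch: "chordal G" and p: "set p \<subseteq> pverts G"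
  shows "\<not> adjacency.long_induced_cycle (parcs G) p"
proof
  interpret adjacency "parcs G" using adjacency_parcs[OF G] .
  assume c: "long_induced_cycle p"
  have "induces_copy G (set p) (cycle_graph (length p))"
    by (rule induces_copy_nth[OF G _ p refl])
      (use c in \<open>auto simp: cycle_graph_def long_induced_cycle_def\<close>)
  then show False using ch c unfolding chordal_def long_induced_cycle_def by blast
qed

context adjacency begin

text \<open>For consecutive vertices \<open>a\<close>, \<open>b\<close>, \<open>c\<close> of a
  cycle, the rest of the cycle connects \<open>c\<close> with \<open>a\<close> while avoiding
  \<open>b\<close>. By separation \<open>a\<close> and \<open>c\<close> are adjacent, which gives a
  forbidden triangle.\<close>

lemma undirected_tree_induced:
  assumes T: "u \<in> T" "\<And>v. v \<in> T \<Longrightarrow> (u, v) \<in> (Restr E T)\<^sup>*"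
    and no_triangle: "\<And>a b c. a \<in> T \<Longrightarrow> b \<in> T \<Longrightarrow> c \<in> T \<Longrightarrow> (a, b) \<in> E \<Longrightarrow> (b, c) \<in> E \<Longrightarrow> (a, c) \<notin> E"
    and sep: "separating T"
  shows "undirected_tree (with_proj \<lparr>pverts = T, parcs = Restr E T\<rparr>)"
  unfolding undirected_tree_def
proof (intro conjI notI)
  let ?K = "with_proj \<lparr>pverts = T, parcs = Restr E T\<rparr>"
  have sym: "(v, u) \<in> (Restr E T)\<^sup>*" if "(u, v) \<in> (Restr E T)\<^sup>*" for u v
  proof -
    have "sym ((Restr E T)\<^sup>*)" by (intro sym_rtrancl) (auto simp: sym_def intro: sym_E)
    then show ?thesis using that by (auto dest: symD)
  qed
  have on: "(a, b) \<in> rtrancl_on T (Restr E T)" if "(a, b) \<in> (Restr E T)\<^sup>*" "a \<in> T" for a b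
    using that by (induction rule: rtrancl_induct) (auto intro: rtrancl_on_into_rtrancl_on)
  have mk: "mk_symmetric ?K = \<lparr>pverts = T, parcs = Restr E T\<rparr>"
    unfolding mk_symmetric_def using sym_E by auto
  show "Digraph_Component.connected ?K"
    unfolding connected_def mk
  proof (rule strongly_connectedI)
    show "verts ?K \<noteq> {}" using T by auto
    fix a b assume "a \<in> verts ?K" "b \<in> verts ?K"
    then have "(a, u) \<in> (Restr E T)\<^sup>*" "(u, b) \<in> (Restr E T)\<^sup>*" using T sym[of u a] by auto
    then have "(a, b) \<in> (Restr E T)\<^sup>*" by (rule rtrancl_trans)
    then show "a \<rightarrow>\<^sup>*\<^bsub>?K\<^esub> b" unfolding reachable_def using on \<open>a \<in> verts ?K\<close> by simp
  qed
  assume "\<exists>p. pre_digraph.cycle ?K p \<and> 3 \<le> length p"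
  then obtain p where p: "pre_digraph.cycle ?K p" "3 \<le> length p" by blast
  then obtain w where w: "set p \<subseteq> Restr E T" "pcas w p w" "distinct (tl (pawalk_verts w p))"
    unfolding pre_digraph.cycle_def pre_digraph.awalk_def
    by (auto simp: cas_with_proj_eq awalk_verts_with_proj_eq)
  obtain e1 e2 e3 q where "p = e1 # e2 # e3 # q"
    using p(2) by (auto simp: numeral_3_eq_3 Suc_le_length_iff)
  then obtain a b c rest where pe: "p = (a, b) # (b, c) # rest" "rest \<noteq> []" "a = w"
    using w(2) by (cases e1; cases e2) auto
  have last_mem: "z \<in> set (pawalk_verts y r)" if "pcas y r z" for y r z
    using that by (induction r arbitrary: y) auto
  have hd_mem: "y \<in> set (pawalk_verts y r)" if "pcas y r z" for y z :: 'a and r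
    using that by (cases r) auto
  have bc: "b \<notin> set (pawalk_verts c rest)" "distinct (pawalk_verts c rest)" "pcas c rest a"
    using w pe by auto
  \<comment> \<open>The walk \<open>rest\<close> is non-empty because the cycle has at least three
    arcs. It ends in \<open>a\<close>, after its first vertex \<open>c\<close>, and \<open>c\<close>
    does not recur.\<close>
  have "a \<noteq> c"
  proof -
    obtain e r where r: "rest = e # r" using pe(2) by (cases rest) auto
    then have "fst e = c" "c \<notin> set (pawalk_verts (snd e) r)" "a \<in> set (pawalk_verts (snd e) r)"
      using bc last_mem[of "snd e" r a] by auto
    then show ?thesis by auto
  qed
  have walk: "(y, z) \<in> (Restr E (T - {b}))\<^sup>*"
    if "pcas y r z" "set r \<subseteq> Restr E T" "b \<notin> set (pawalk_verts y r)" for y r z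
    using that
  proof (induction r arbitrary: y)
    case (Cons e r)
    have "(y, snd e) \<in> Restr E (T - {b})" using Cons.prems hd_mem[of "snd e" r z] by (cases e) auto
    moreover have "(snd e, z) \<in> (Restr E (T - {b}))\<^sup>*" using Cons by auto
    ultimately show ?case by (rule converse_rtrancl_into_rtrancl)
  qed simp
  have "a \<in> component T b c"
    unfolding component_def using walk[OF bc(3) _ bc(1)] w(1) pe by auto
  moreover have E: "(a, b) \<in> E" "(b, c) \<in> E" "a \<in> T" "b \<in> T" "c \<in> T" using w(1) pe by auto
  ultimately show False
    using separatingD[OF sep, of b c a] no_triangle[of a b c] \<open>a \<noteq> c\<close> sym_E[of c a] sym_E[of a b]
    by blast
qed

text \<open>Tree degree plus number of triangles equal to three is exactly the prescription two
  triangles for a leaf, one for degree two, none for degree three. With \<open>r = 3\<close> the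
  root obeys the same law. A non-empty \<open>S\<close> makes the tree nontrivial.\<close>

lemma tree_with_triangles_of_cubic_part:
  assumes part: "cubic_part u S D 3" and W: "W = insert u (S \<union> \<Union>D)"
    and sep: "separating W" and ne: "S \<noteq> {}"
    and H: "H = \<lparr>pverts = W, parcs = Restr E W\<rparr>" "pair_graph H"
  shows "tree_with_triangles H (insert u S) D"
proof -
  note p = cubic_partD[OF part]
  let ?T = "insert u S"
  define tri where "tri v = card {d \<in> D. \<forall>a\<in>d. (v, a) \<in> E}" for v
  have T: "?T \<subseteq> W" "W - ?T = \<Union>D" using W p(5) by blast+
  have DW: "d \<subseteq> W" if "d \<in> D" for d using that W by blast
  have Hind: "with_proj H \<restriction> U = with_proj \<lparr>pverts = U, parcs = Restr E U\<rparr>" if "U \<subseteq> W" for U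
    using that by (auto simp: induce_subgraph_def with_proj_def H)
  have deg: "out_degree (with_proj H \<restriction> ?T) v = card {w \<in> ?T. (v, w) \<in> E}" if "v \<in> ?T" for v
  proof -
    have "out_arcs (with_proj H \<restriction> ?T) v = Pair v ` {w \<in> ?T. (v, w) \<in> E}"
      unfolding out_arcs_def Hind[OF T(1)] using that by auto
    then show ?thesis unfolding out_degree_def by (simp add: card_image inj_on_def)
  qed
  have total: "card {w \<in> ?T. (v, w) \<in> E} + tri v = 3" if "v \<in> ?T" for v
  proof (cases "v = u")
    case True
    have "{w \<in> ?T. (u, w) \<in> E} = {w \<in> S. (u, w) \<in> E}" using irrefl_E by auto
    then show ?thesis using True p(13) unfolding tri_def by simp
  next
    case False then show ?thesis using p(12) that unfolding tri_def by blast
  qed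
  have compl: "{d \<in> D. complete_to H {v} d} = {d \<in> D. \<forall>a\<in>d. (v, a) \<in> E}" if "v \<in> ?T" for v
    unfolding complete_to_def H using that T DW by auto
  show ?thesis
    unfolding tree_with_triangles_def Let_def
  proof (intro conjI ballI impI)
    show "pair_graph H" by fact
    show "?T \<subseteq> pverts H" using T H by simp
    have "card S > 0" "card ?T = Suc (card S)" using ne p(1,3) by (simp_all add: card_gt_0_iff)
    then show "2 \<le> card ?T" by linarith
    show "undirected_tree (with_proj H \<restriction> ?T)"
      unfolding Hind[OF T(1)]
      using p(10,11) by (intro undirected_tree_induced[of u] separating_subset[OF sep T(1)]) auto
    show "out_degree (with_proj H \<restriction> ?T) v \<le> 3" if "v \<in> ?T" for v using deg total that by force
    show "partition_on (pverts H - ?T) D"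
      using p(7) p(14) T by (intro partition_onI) (auto simp: H disjnt_def)
    show "K\<^bsub>3\<^esub> (with_proj H \<restriction> d)" if d: "d \<in> D" for d
    proof -
      have "pair_graph \<lparr>pverts = d, parcs = Restr (parcs H) d\<rparr>"
        using DW[OF d] by (intro pair_graph_induced H(2)) (simp add: H)
      then have "graph (with_proj H \<restriction> d)"
        unfolding induce_with_proj by (rule pair_graph.pair_graphD_graph)
      then show ?thesis
        unfolding complete_digraph_def Hind[OF DW[OF d]]
        using p(4)[OF d] p(6)[OF d] irrefl_E by auto
    qed
    show "anticomplete_to H d d'" if "d \<in> D" "d' \<in> D" "d \<noteq> d'" for d d'
      unfolding anticomplete_to_def H using p(8)[OF that] by auto
    show "\<exists>v\<in>?T. complete_to H d {v} \<and> anticomplete_to H d (?T - {v})" if d: "d \<in> D" for d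
    proof -
      obtain v where v: "v \<in> ?T" "\<forall>a\<in>d. (v, a) \<in> E" "\<forall>a\<in>d. \<forall>w\<in>?T - {v}. (w, a) \<notin> E"
        using p(9)[OF d] by blast
      have "complete_to H d {v}" unfolding complete_to_def H using v T DW[OF d] sym_E by auto
      moreover have "anticomplete_to H d (?T - {v})"
      proof -
        have "(a, w) \<notin> E" if "a \<in> d" "w \<in> ?T - {v}" for a w
          using v(3) that sym_E[of a w] by blast
        then show ?thesis unfolding anticomplete_to_def H by simp
      qed
      ultimately show ?thesis using v(1) by blast
    qed
    show "card {d \<in> D. complete_to H {v} d} = 2" if "v \<in> ?T" "out_degree (with_proj H \<restriction> ?T) v = 1" for v
      using that deg total[of v] unfolding compl[OF that(1)] tri_def by simp
    show "card {d \<in> D. complete_to H {v} d} = 1" if "v \<in> ?T" "out_degree (with_proj H \<restriction> ?T) v = 2" for v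
      using that deg total[of v] unfolding compl[OF that(1)] tri_def by simp
    show "anticomplete_to H {v} (pverts H - ?T)"
      if v: "v \<in> ?T" "out_degree (with_proj H \<restriction> ?T) v = 3" for v
    proof -
      \<comment> \<open>This only excludes triangles complete to \<open>v\<close>. But each triangle
        is complete to one tree vertex and anticomplete to all others, so no edge to a triangle
        remains.\<close>
      have "tri v = 0" using v deg total[of v] by simp
      then have "{d \<in> D. \<forall>a\<in>d. (v, a) \<in> E} = {}" using p(2) unfolding tri_def by simp
      then have "(v, a) \<notin> E" if "d \<in> D" "a \<in> d" for d a
        using p(9)[OF that(1)] that v(1) by blast
      then show ?thesis unfolding anticomplete_to_def using T by (auto simp: H)
    qed
  qed
qed

end

text \<open>Without further tree vertices all three units at the root are triangles, and each of
  them forms a copy of \<open>complete_graph 4\<close> with the root.\<close>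

lemma H0_copy_of_cubic_part:
  assumes G: "pair_graph G" and W: "W = insert u (\<Union>D)" "W \<subseteq> pverts G"
    and part: "adjacency.cubic_part (parcs G) u {} D 3"
  shows "induces_copy G W H0"
proof -
  interpret adjacency "parcs G" using adjacency_parcs[OF G] .
  note p = cubic_partD[OF part]
  have full: "(u, a) \<in> parcs G" if "d \<in> D" "a \<in> d" for d a using p(9)[OF that(1)] that by auto
  then have "{d \<in> D. \<forall>a\<in>d. (u, a) \<in> parcs G} = D" by blast
  then have "card D = 3" using p(13) by simp
  then obtain d1 d2 d3 where D: "D = {d1, d2, d3}" "d1 \<noteq> d2" "d1 \<noteq> d3" "d2 \<noteq> d3"
    by (auto simp: card_3_iff)
  obtain a1 a2 a3 where 1: "d1 = {a1, a2, a3}" "a1 \<noteq> a2" "a1 \<noteq> a3" "a2 \<noteq> a3"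
    using p(4)[of d1] D by (auto simp: card_3_iff)
  obtain b1 b2 b3 where 2: "d2 = {b1, b2, b3}" "b1 \<noteq> b2" "b1 \<noteq> b3" "b2 \<noteq> b3"
    using p(4)[of d2] D by (auto simp: card_3_iff)
  obtain c1 c2 c3 where 3: "d3 = {c1, c2, c3}" "c1 \<noteq> c2" "c1 \<noteq> c3" "c2 \<noteq> c3"
    using p(4)[of d3] D by (auto simp: card_3_iff)
  have dis: "d1 \<inter> d2 = {}" "d1 \<inter> d3 = {}" "d2 \<inter> d3 = {}" "u \<notin> d1" "u \<notin> d2" "u \<notin> d3"
    using p(7)[of d1 d2] p(7)[of d1 d3] p(7)[of d2 d3] p(5) D by auto
  \<comment> \<open>The order follows the numbering of \<open>H0\<close>: the shared vertex is 0,
    and the triangles are 123, 456 and 789.\<close>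
  let ?l = "[u, a1, a2, a3, b1, b2, b3, c1, c2, c3]"
  have dl: "distinct ?l" using dis 1(2-) 2(2-) 3(2-) unfolding 1(1) 2(1) 3(1) by simp blast
  have adj: "(x, y) \<in> parcs G \<longleftrightarrow> x \<noteq> y \<and> (\<exists>d\<in>D. x \<in> insert u d \<and> y \<in> insert u d)"
    if mem: "x \<in> W" "y \<in> W" for x y
  proof
    assume xy: "(x, y) \<in> parcs G"
    then have "x \<noteq> y" using irrefl_E by auto
    moreover have "\<exists>d\<in>D. x \<in> insert u d \<and> y \<in> insert u d"
    proof (cases "x = u \<or> y = u")
      case True
      then show ?thesis using mem W(1) D(1) by blast
    next
      case False
      then obtain d d' where d: "d \<in> D" "x \<in> d" "d' \<in> D" "y \<in> d'" using mem W(1) by blast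
      then have "d = d'" using p(8)[of d d' x y] xy by blast
      then show ?thesis using d by blast
    qed
    ultimately show "x \<noteq> y \<and> (\<exists>d\<in>D. x \<in> insert u d \<and> y \<in> insert u d)" by blast
  next
    assume "x \<noteq> y \<and> (\<exists>d\<in>D. x \<in> insert u d \<and> y \<in> insert u d)"
    then obtain d where d: "d \<in> D" "x \<in> insert u d" "y \<in> insert u d" "x \<noteq> y" by blast
    show "(x, y) \<in> parcs G"
    proof (cases "x = u \<or> y = u")
      case True
      then show ?thesis using d full[OF d(1)] sym_E[of u x] by blast
    next
      case False
      then show ?thesis using d p(6)[OF d(1), of x y] by blast
    qed
  qed
  have nth_image: "?l ! i \<in> (!) ?l ` A \<longleftrightarrow> i \<in> A" if "i < 10" "A \<subseteq> {..<10}" for i A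
  proof
    assume "?l ! i \<in> (!) ?l ` A"
    then obtain k where k: "k \<in> A" "?l ! i = ?l ! k" by blast
    then have "k < 10" using that by blast
    then show "i \<in> A" using k nth_eq_iff_index_eq[OF dl, of i k] that(1) by simp
  qed simp
  have img: "insert u d1 = (!) ?l ` {0,1,2,3}" "insert u d2 = (!) ?l ` {0,4,5,6}"
    "insert u d3 = (!) ?l ` {0,7,8,9}"
    unfolding 1(1) 2(1) 3(1) by simp_all
  have idx: "?l ! i \<in> insert u d1 \<longleftrightarrow> i \<in> {0,1,2,3}" "?l ! i \<in> insert u d2 \<longleftrightarrow> i \<in> {0,4,5,6}"
    "?l ! i \<in> insert u d3 \<longleftrightarrow> i \<in> {0,7,8,9}" if "i < 10" for i
    unfolding img by (rule nth_image[OF that], simp)+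
  have lW: "set ?l = W" unfolding W(1) D(1) 1(1) 2(1) 3(1) by auto
  have "induces_copy G (set ?l) H0"
  proof (rule induces_copy_nth[OF G dl, of 10])
    show "set ?l \<subseteq> pverts G" using lW W by simp
    show "length ?l = 10" by simp
    show "pverts H0 = {..<10}" "parcs H0 \<subseteq> {..<10} \<times> {..<10}" by (auto simp: H0_def)
    fix i j :: nat assume ij: "i < 10" "j < 10"
    have mem: "?l ! i \<in> W" "?l ! j \<in> W" using ij lW nth_mem[of i ?l] nth_mem[of j ?l] by auto
    have "?l ! i \<noteq> ?l ! j \<longleftrightarrow> i \<noteq> j" using nth_eq_iff_index_eq[OF dl, of i j] ij by simp
    then show "(?l ! i, ?l ! j) \<in> parcs G \<longleftrightarrow> (i, j) \<in> parcs H0"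
      unfolding adj[OF mem] D(1) H0_def bex_simps pair_pre_digraph.simps mem_Collect_eq split_conv
        idx[OF ij(1)] idx[OF ij(2)]
      by (simp only: bex_simps)
  qed
  then show ?thesis using lW by simp
qed

text \<open>By monotonicity an obstructed subset of \<open>W\<close> is all of \<open>W\<close>. So
  it is enough to find an obstructed subset whose induced subgraph is known completely: a diamond,
  five pairwise adjacent vertices, or an unfolded piece.\<close>

lemma minimal_obstruction:
  assumes G: "pair_graph G" and ch: "chordal G" and W: "W \<subseteq> pverts G"
    and obs: "adjacency.obstructed (parcs G) W"
    and minimal: "\<And>v. v \<in> W \<Longrightarrow> \<not> adjacency.obstructed (parcs G) (W - {v})"
  shows "\<exists>H \<in> family_T \<union> {complete_graph 5, K4_minus}. induces_copy (G :: nat pair_pre_digraph) W H"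
proof -
  interpret adjacency "parcs G" using adjacency_parcs[OF G] .
  have all: "U = W" if U: "U \<subseteq> W" "obstructed U" for U
  proof (rule ccontr)
    assume "U \<noteq> W"
    then obtain v where "v \<in> W" "U \<subseteq> W - {v}" using U(1) by blast
    then show False using minimal obstructed_mono[OF U(2)] by blast
  qed
  \<comment> \<open>Absence of diamonds is recorded in the last case, because the separation
    property rests on it.\<close>
  consider (diamond) a b c d where "a \<in> W" "b \<in> W" "c \<in> W" "d \<in> W" "diamond a b c d"
    | (K5) a b c d e where "a \<in> W" "b \<in> W" "c \<in> W" "d \<in> W" "e \<in> W" "clique4 a b c d"
      "(a, e) \<in> parcs G" "(b, e) \<in> parcs G" "(c, e) \<in> parcs G" "(d, e) \<in> parcs G"
    | (over) u where "u \<in> W" "overcommitted W u"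
      "\<And>a b c d. a \<in> W \<Longrightarrow> b \<in> W \<Longrightarrow> c \<in> W \<Longrightarrow> d \<in> W \<Longrightarrow> \<not> diamond a b c d"
  proof (cases "\<exists>a\<in>W. \<exists>b\<in>W. \<exists>c\<in>W. \<exists>d\<in>W. diamond a b c d")
    case True
    then show thesis using that(1) by (elim bexE)
  next
    case no_diamond: False
    with obs consider "\<exists>u\<in>W. overcommitted W u"
      | "\<exists>a\<in>W. \<exists>b\<in>W. \<exists>c\<in>W. \<exists>d\<in>W. \<exists>e\<in>W. clique4 a b c d \<and>
          (a, e) \<in> parcs G \<and> (b, e) \<in> parcs G \<and> (c, e) \<in> parcs G \<and> (d, e) \<in> parcs G"
      unfolding obstructed_def by argo
    then show thesis
    proof cases
      case 1
      then obtain u where u: "u \<in> W" "overcommitted W u" by (elim bexE)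
      show thesis by (rule that(3)[OF u]) (use no_diamond in blast)
    next
      case 2
      then show thesis by (elim bexE conjE) (rule that(2))
    qed
  qed
  then show ?thesis
  proof cases
    case diamond
    have "set [a, b, c, d] \<subseteq> W" using diamond by simp
    moreover have "obstructed (set [a, b, c, d])" unfolding obstructed_def using diamond(5) by auto
    ultimately have Weq: "set [a, b, c, d] = W" by (rule all)
    have ne: "a \<noteq> b" "a \<noteq> c" "a \<noteq> d" "b \<noteq> c" "b \<noteq> d" "c \<noteq> d"
      using diamond(5) irrefl_E unfolding diamond_def by blast+
    have E: "(a, b) \<in> parcs G" "(a, c) \<in> parcs G" "(a, d) \<in> parcs G" "(b, c) \<in> parcs G"
      "(b, d) \<in> parcs G" and dc: "(c, d) \<notin> parcs G" "(d, c) \<notin> parcs G"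
      using diamond(5) sym_E[of d c] unfolding diamond_def by blast+
    have "induces_copy G (set [a, b, c, d]) K4_minus"
    proof (rule induces_copy_nth[OF G, of _ 4])
      show "set [a, b, c, d] \<subseteq> pverts G" using Weq W by simp
      fix i j :: nat assume "i < 4" "j < 4"
      then have "i \<in> {0,1,2,3}" "j \<in> {0,1,2,3}" by auto
      then show "([a, b, c, d] ! i, [a, b, c, d] ! j) \<in> parcs G \<longleftrightarrow> (i, j) \<in> parcs K4_minus"
        using E E[THEN sym_E] dc irrefl_E ne
        by (elim insertE emptyE) (simp_all add: K4_minus_def complete_graph_def)
    qed (use ne in \<open>auto simp: K4_minus_def complete_graph_def\<close>)
    then show ?thesis using Weq by auto
  next
    case K5
    have "set [a, b, c, d, e] \<subseteq> W" using K5 by simp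
    moreover have "obstructed (set [a, b, c, d, e])" unfolding obstructed_def using K5(6-10) by auto
    ultimately have Weq: "set [a, b, c, d, e] = W" by (rule all)
    have ne: "distinct [a, b, c, d, e]"
      using K5(6-10) irrefl_E unfolding clique4_def distinct.simps set_simps insert_iff empty_iff by metis
    have E: "(a, b) \<in> parcs G" "(a, c) \<in> parcs G" "(a, d) \<in> parcs G" "(b, c) \<in> parcs G"
      "(b, d) \<in> parcs G" "(c, d) \<in> parcs G"
      "(a, e) \<in> parcs G" "(b, e) \<in> parcs G" "(c, e) \<in> parcs G" "(d, e) \<in> parcs G"
      using K5(6-10) unfolding clique4_def by blast+
    have "induces_copy G (set [a, b, c, d, e]) (complete_graph 5)"
    proof (rule induces_copy_nth[OF G ne, of 5])
      show "set [a, b, c, d, e] \<subseteq> pverts G" using Weq W by simp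
      fix i j :: nat assume "i < 5" "j < 5"
      then have "i \<in> {0,1,2,3,4}" "j \<in> {0,1,2,3,4}" by auto
      then show "([a, b, c, d, e] ! i, [a, b, c, d, e] ! j) \<in> parcs G \<longleftrightarrow> (i, j) \<in> parcs (complete_graph 5)"
        using E E[THEN sym_E] irrefl_E by (elim insertE emptyE) (simp_all add: complete_graph_def)
    qed (auto simp: complete_graph_def)
    then show ?thesis using Weq by auto
  next
    case over
    have "set p \<subseteq> W \<Longrightarrow> \<not> long_induced_cycle p" for p
      using chordal_no_long_induced_cycle[OF G ch] W by blast
    then have sep: "separating W" using over(3) by (rule separating_if_no_induced_cycle)
    obtain S D where SD: "cubic_part u S D 3" "S \<union> \<Union>D \<subseteq> W" "overcommitted (insert u (S \<union> \<Union>D)) u"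
      using cubic_part_of_overcommitted[OF sep over(1,2)] by blast
    have "insert u (S \<union> \<Union>D) \<subseteq> W" using SD over by simp
    moreover have "obstructed (insert u (S \<union> \<Union>D))" unfolding obstructed_def using SD(3) by blast
    ultimately have Weq: "insert u (S \<union> \<Union>D) = W" by (rule all)
    show ?thesis
    proof (cases "S = {}")
      case True
      then have "induces_copy G W H0"
        using SD(1) Weq W by (intro H0_copy_of_cubic_part[OF G, of W u D]) simp_all
      then show ?thesis unfolding family_T_def by blast
    next
      case False
      let ?H = "\<lparr>pverts = W, parcs = Restr (parcs G) W\<rparr>"
      have "tree_with_triangles ?H (insert u S) D"
        using tree_with_triangles_of_cubic_part[OF SD(1) Weq[symmetric] sep False refl]
          pair_graph_induced[OF G W] by blast
      then have "?H \<in> family_T" unfolding family_T_def by blast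
      then show ?thesis using induces_copy_induced[OF G W] by blast
    qed
  qed
qed

section \<open>Contacts of grid paths\<close>

fun x_min :: "grid_path \<Rightarrow> int" where
  "x_min (Horizontal y a b) = a" | "x_min (Vertical x a b) = x"
fun x_max :: "grid_path \<Rightarrow> int" where
  "x_max (Horizontal y a b) = b" | "x_max (Vertical x a b) = x"
fun y_min :: "grid_path \<Rightarrow> int" where
  "y_min (Horizontal y a b) = y" | "y_min (Vertical x a b) = a"
fun y_max :: "grid_path \<Rightarrow> int" where
  "y_max (Horizontal y a b) = y" | "y_max (Vertical x a b) = b"

text \<open>A path without bends fills its bounding box, which turns contacts into comparisons of
  intervals in both coordinates.\<close>

lemma path_points_box: "path_points p = {x_min p..x_max p} \<times> {y_min p..y_max p}"
  by (cases p) auto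

lemma mem_path_points [simp]:
  "(i, j) \<in> path_points (Horizontal y a b) \<longleftrightarrow> j = y \<and> a \<le> i \<and> i \<le> b"
  "(i, j) \<in> path_points (Vertical x a b) \<longleftrightarrow> i = x \<and> a \<le> j \<and> j \<le> b"
  by auto

lemma mem_path_interior [simp]:
  "(i, j) \<in> path_interior (Horizontal y a b) \<longleftrightarrow> j = y \<and> a < i \<and> i < b"
  "(i, j) \<in> path_interior (Vertical x a b) \<longleftrightarrow> i = x \<and> a < j \<and> j < b"
  by auto

declare path_points.simps [simp del] path_interior.simps [simp del]

fun path_ends :: "grid_path \<Rightarrow> grid_point set" where
  "path_ends (Horizontal y a b) = {(a, y), (b, y)}"
| "path_ends (Vertical x a b) = {(x, a), (x, b)}"

lemma path_points_eq: "valid_grid_path p \<Longrightarrow> path_points p = path_interior p \<union> path_ends p"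
  by (cases p) auto

lemma finite_path_ends [simp]: "finite (path_ends p)"
  by (cases p) auto

lemma card_path_ends: "valid_grid_path p \<Longrightarrow> card (path_ends p) = 2"
  by (cases p) auto

definition noncrossing :: "grid_path \<Rightarrow> grid_path \<Rightarrow> bool" where
  "noncrossing p q \<longleftrightarrow> path_edges p \<inter> path_edges q = {} \<and> path_interior p \<inter> path_interior q = {}"

definition touching :: "grid_path \<Rightarrow> grid_path \<Rightarrow> bool" where
  "touching p q \<longleftrightarrow> path_points p \<inter> path_points q \<noteq> {}"

lemma noncrossing_commute: "noncrossing p q \<longleftrightarrow> noncrossing q p"
  unfolding noncrossing_def by blast

lemma touching_commute: "touching p q \<longleftrightarrow> touching q p"
  unfolding touching_def by blast

text \<open>The Helly property of intervals, used in each coordinate: the largest lower bound does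
  not exceed any upper bound.\<close>

lemma common_point_helly:
  assumes A: "finite A" "A \<noteq> {}" and touch: "\<And>p q. p \<in> A \<Longrightarrow> q \<in> A \<Longrightarrow> touching p q"
  shows "\<exists>e. \<forall>p\<in>A. e \<in> path_points p"
proof -
  let ?x = "Max (x_min ` A)" and ?y = "Max (y_min ` A)"
  have le: "x_min q \<le> x_max p \<and> y_min q \<le> y_max p" if "p \<in> A" "q \<in> A" for p q
    using touch[OF that] unfolding touching_def path_points_box by auto
  have "(?x, ?y) \<in> path_points p" if p: "p \<in> A" for p
  proof -
    have "?x \<in> x_min ` A" "?y \<in> y_min ` A" using A by auto
    then have "?x \<le> x_max p" "?y \<le> y_max p" using le[OF p] by auto
    moreover have "x_min p \<le> ?x" "y_min p \<le> ?y" using A p by auto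
    ultimately show ?thesis unfolding path_points_box by simp
  qed
  then show ?thesis by blast
qed

lemma common_edge:
  assumes "e \<in> path_points p" "e \<in> path_points q" "e' \<in> path_points p" "e' \<in> path_points q" "e \<noteq> e'"
  shows "path_edges p \<inter> path_edges q \<noteq> {}"
proof -
  obtain i j i' j' where e: "e = (i, j)" "e' = (i', j')" by (cases e; cases e')
  show ?thesis
  proof (cases p; cases q)
    fix y a b y' a' b'
    assume pq: "p = Horizontal y a b" "q = Horizontal y' a' b'"
    \<comment> \<open>The unit edge that starts at the smaller of the two common points and leads
      towards the other.\<close>
    then have "{(min i i', y), (min i i' + 1, y)} \<in> path_edges p \<inter> path_edges q"
      using assms e by auto
    then show ?thesis by blast
  next
    fix x a b x' a' b'
    assume pq: "p = Vertical x a b" "q = Vertical x' a' b'"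
    then have "{(x, min j j'), (x, min j j' + 1)} \<in> path_edges p \<inter> path_edges q"
      using assms e by auto
    then show ?thesis by blast
  qed (use assms e in auto)
qed

lemma common_point_unique:
  assumes "noncrossing p q" "e \<in> path_points p" "e \<in> path_points q" "e' \<in> path_points p" "e' \<in> path_points q"
  shows "e = e'"
  using common_edge[OF assms(2-5)] assms(1) unfolding noncrossing_def by blast

text \<open>The grid edges of \<open>p\<close> at \<open>e\<close>, each named by its other end
  point. Paths without a common edge have disjoint sets of directions.\<close>

definition directions :: "grid_path \<Rightarrow> grid_point \<Rightarrow> grid_point set" where
  "directions p e = {e'. {e, e'} \<in> path_edges p}"

lemma mem_directions:
  "(i', j') \<in> directions (Horizontal y a b) (i, j) \<longleftrightarrow>
     j = y \<and> j' = y \<and> (a \<le> i \<and> i < b \<and> i' = i + 1 \<or> a \<le> i' \<and> i' < b \<and> i = i' + 1)"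
  "(i', j') \<in> directions (Vertical x a b) (i, j) \<longleftrightarrow>
     i = x \<and> i' = x \<and> (a \<le> j \<and> j < b \<and> j' = j + 1 \<or> a \<le> j' \<and> j' < b \<and> j = j' + 1)"
  by (auto simp: directions_def doubleton_eq_iff)

lemma directions_subset:
  "directions p (x, y) \<subseteq> {(x + 1, y), (x - 1, y), (x, y + 1), (x, y - 1)}"
  by (cases p) (auto simp: mem_directions)

lemma finite_directions: "finite (directions p e)"
  using finite_subset[OF directions_subset] by (cases e) auto

lemma directions_disjoint: "noncrossing p q \<Longrightarrow> directions p e \<inter> directions q e = {}"
  unfolding noncrossing_def directions_def by blast

lemma directions_nonempty:
  assumes "valid_grid_path p" "e \<in> path_points p"
  shows "1 \<le> card (directions p e)"
proof -
  obtain i j where e: "e = (i, j)" by (cases e)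
  have "directions p e \<noteq> {}"
  proof (cases p)
    case (Horizontal y a b)
    then have "(if i < b then (i + 1, j) else (i - 1, j)) \<in> directions p e"
      using assms e by (auto simp: mem_directions)
    then show ?thesis by blast
  next
    case (Vertical x a b)
    then have "(if j < b then (i, j + 1) else (i, j - 1)) \<in> directions p e"
      using assms e by (auto simp: mem_directions)
    then show ?thesis by blast
  qed
  then show ?thesis using finite_directions[of p e] by (simp add: card_gt_0_iff Suc_le_eq)
qed

lemma directions_interior:
  assumes "e \<in> path_interior p"
  shows "2 \<le> card (directions p e)"
proof -
  obtain i j where e: "e = (i, j)" by (cases e)
  have "\<exists>d d'. d \<noteq> d' \<and> {d, d'} \<subseteq> directions p e"
  proof (cases p)
    case (Horizontal y a b)
    then have "{(i + 1, j), (i - 1, j)} \<subseteq> directions p e"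
      using assms e by (auto simp: mem_directions)
    then show ?thesis by (intro exI[of _ "(i + 1, j)"] exI[of _ "(i - 1, j)"]) auto
  next
    case (Vertical x a b)
    then have "{(i, j + 1), (i, j - 1)} \<subseteq> directions p e"
      using assms e by (auto simp: mem_directions)
    then show ?thesis by (intro exI[of _ "(i, j + 1)"] exI[of _ "(i, j - 1)"]) auto
  qed
  then obtain d d' where "d \<noteq> d'" "{d, d'} \<subseteq> directions p e" by blast
  then show ?thesis using card_mono[OF finite_directions, of "{d, d'}" p e] by simp
qed

text \<open>Only four grid edges meet at \<open>e\<close>. A path through the point takes at least
  two of them and a path ending there at least one, so one count serves both for five pairwise
  touching paths and for the end condition in a clique of four.\<close>

lemma sum_card_directions:
  assumes "finite I" and "\<And>i j. i \<in> I \<Longrightarrow> j \<in> I \<Longrightarrow> i \<noteq> j \<Longrightarrow> noncrossing (P i) (P j)"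
  shows "(\<Sum>i\<in>I. card (directions (P i) e)) \<le> 4"
proof -
  obtain x y where e: "e = (x, y)" by (cases e)
  have "(\<Sum>i\<in>I. card (directions (P i) e)) = card (\<Union>i\<in>I. directions (P i) e)"
    using assms finite_directions directions_disjoint
    by (intro card_UN_disjoint[symmetric]) auto
  also have "\<dots> \<le> card {(x + 1, y), (x - 1, y), (x, y + 1), (x, y - 1)}"
    using directions_subset unfolding e by (intro card_mono) blast+
  also have "\<dots> \<le> 4" by (simp add: card_insert_if)
  finally show ?thesis .
qed

text \<open>The local fact \<open>end_of_forced\<close> gives \<open>forced\<close> its geometric
  meaning by induction. The three alternatives of \<open>obstructed\<close> then contradict, in this
  order, the two ends of a path, the uniqueness of a contact point, and the four directions at a
  grid point.\<close>

lemma contact_rep_not_obstructed: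
  assumes G: "pair_graph G" and rep: "contact_B0_VPG_rep G P"
  shows "\<not> adjacency.obstructed (parcs G) (pverts G)"
proof -
  interpret adjacency "parcs G" using adjacency_parcs[OF G] .
  have valid: "valid_grid_path (P v)" if "v \<in> pverts G" for v
    using rep that unfolding contact_B0_VPG_rep_def by blast
  have nc: "noncrossing (P u) (P v)" if "u \<in> pverts G" "v \<in> pverts G" "u \<noteq> v" for u v
    using rep that unfolding contact_B0_VPG_rep_def noncrossing_def by blast
  have adj: "(u, v) \<in> parcs G \<longleftrightarrow> touching (P u) (P v)" if "u \<in> pverts G" "v \<in> pverts G" "u \<noteq> v" for u v
    using rep that unfolding contact_B0_VPG_rep_def touching_def by blast
  have refl: "touching (P v) (P v)" if "v \<in> pverts G" for v
    using valid[OF that] unfolding touching_def path_points_box by (cases "P v") auto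
  have clique_point: "\<exists>e. \<forall>v\<in>K. e \<in> path_points (P v)"
    if K: "finite K" "K \<noteq> {}" "K \<subseteq> pverts G" "\<And>u v. u \<in> K \<Longrightarrow> v \<in> K \<Longrightarrow> u \<noteq> v \<Longrightarrow> (u, v) \<in> parcs G" for K
  proof -
    have "touching p q" if pq: "p \<in> P ` K" "q \<in> P ` K" for p q
    proof -
      obtain u v where "u \<in> K" "v \<in> K" "p = P u" "q = P v" using pq by blast
      then show ?thesis using K(3) K(4)[of u v] adj[of u v] refl[of u] by (cases "u = v") blast+
    qed
    then have "\<exists>e. \<forall>p\<in>P ` K. e \<in> path_points p"
      using K(1,2) by (intro common_point_helly) simp_all
    then show ?thesis by simp
  qed
  have end_of_forced: "e \<in> path_ends (P u)"
    if "forced (pverts G) u x" "e \<in> path_points (P u)" "e \<in> path_points (P x)" for u x e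
    using that
  proof (induction arbitrary: e rule: forced.induct)
    case (clique u x a b)
    have ne: "u \<noteq> x" "u \<noteq> a" "u \<noteq> b" "x \<noteq> a" "x \<noteq> b" "a \<noteq> b"
      using clique(5) irrefl_E unfolding clique4_def by blast+
    let ?K = "{u, x, a, b}"
    have E0: "(u, x) \<in> parcs G" "(u, a) \<in> parcs G" "(u, b) \<in> parcs G" "(x, a) \<in> parcs G"
      "(x, b) \<in> parcs G" "(a, b) \<in> parcs G" using clique(5) unfolding clique4_def by simp_all
    have E: "(v, w) \<in> parcs G" if "v \<in> ?K" "w \<in> ?K" "v \<noteq> w" for v w
      using that E0 E0[THEN sym_E] by (elim insertE emptyE) simp_all
    obtain e' where e': "\<And>v. v \<in> ?K \<Longrightarrow> e' \<in> path_points (P v)"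
      using clique_point[of ?K] clique(1-4) E by auto
    \<comment> \<open>The common point of the clique is the given contact, because \<open>u\<close>
      and \<open>x\<close> meet only once.\<close>
    have "e' = e"
      using common_point_unique[OF nc[OF clique(1,2) ne(1)]] e'[of u] e'[of x] clique(6,7) by blast
    then have on: "1 \<le> card (directions (P v) e)" if "v \<in> ?K" for v
      using directions_nonempty[OF valid] e'[OF that] that clique(1-4) by blast
    have "(\<Sum>v\<in>?K. card (directions (P v) e)) \<le> 4"
      using clique(1-4) nc by (intro sum_card_directions) blast+
    \<comment> \<open>The three other members leave at most one of the four directions.\<close>
    then have "card (directions (P u) e) \<le> 1" using on[of x] on[of a] on[of b] ne by simp
    then have "e \<notin> path_interior (P u)" using directions_interior by fastforce
    then show ?case using clique(6) path_points_eq[OF valid[OF clique(1)]] by blast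
  next
    case (branch u x y z)
    have ne: "u \<noteq> x" "u \<noteq> y" "u \<noteq> z" "y \<noteq> z" "x \<noteq> y" "x \<noteq> z"
      using branch(5-8) irrefl_E unfolding independent3_def by blast+
    obtain ey where ey: "ey \<in> path_points (P x)" "ey \<in> path_points (P y)"
      using adj[of x y] branch ne unfolding touching_def by blast
    obtain ez where ez: "ez \<in> path_points (P x)" "ez \<in> path_points (P z)"
      using adj[of x z] branch ne unfolding touching_def by blast
    have ends: "ey \<in> path_ends (P x)" "ez \<in> path_ends (P x)"
      using branch.IH(1)[OF ey] branch.IH(2)[OF ez] .
    have nt: "\<not> touching (P u) (P y)" "\<not> touching (P u) (P z)" "\<not> touching (P y) (P z)"
      using adj[of u y] adj[of u z] adj[of y z] branch(1-4,8) ne unfolding independent3_def by blast+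
    have "e \<noteq> ey" "e \<noteq> ez" "ey \<noteq> ez" using nt ey ez branch.prems unfolding touching_def by blast+
    \<comment> \<open>The points \<open>ey\<close> and \<open>ez\<close> exhaust the two ends of
      \<open>x\<close>. So \<open>e\<close> is an inner point of \<open>x\<close>, and
      \<open>u\<close> cannot pass through it too.\<close>
    then have "card {e, ey, ez} = 3" by simp
    then have "e \<notin> path_ends (P x)"
      using card_mono[OF finite_path_ends, of "{e, ey, ez}" "P x"] card_path_ends[OF valid[OF branch(2)]] ends
      by auto
    then have "e \<in> path_interior (P x)"
      using branch.prems path_points_eq[OF valid[OF branch(2)]] by blast
    then have "e \<notin> path_interior (P u)" using nc[OF branch(1,2) ne(1)] unfolding noncrossing_def by blast
    then show ?case using branch.prems path_points_eq[OF valid[OF branch(1)]] by blast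
  qed
  show ?thesis
  proof
    assume "obstructed (pverts G)"
    then consider "\<exists>u\<in>pverts G. overcommitted (pverts G) u"
      | "\<exists>a\<in>pverts G. \<exists>b\<in>pverts G. \<exists>c\<in>pverts G. \<exists>d\<in>pverts G. diamond a b c d"
      | "\<exists>a\<in>pverts G. \<exists>b\<in>pverts G. \<exists>c\<in>pverts G. \<exists>d\<in>pverts G. \<exists>e\<in>pverts G. clique4 a b c d \<and>
          (a, e) \<in> parcs G \<and> (b, e) \<in> parcs G \<and> (c, e) \<in> parcs G \<and> (d, e) \<in> parcs G"
      unfolding obstructed_def by argo
    then show False
    proof cases
      case 1
      then obtain u x y z where u: "u \<in> pverts G" and xyz: "x \<in> pverts G" "y \<in> pverts G" "z \<in> pverts G"
        "(u, x) \<in> parcs G" "(u, y) \<in> parcs G" "(u, z) \<in> parcs G" "independent3 x y z"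
        and f: "forced (pverts G) u x" "forced (pverts G) u y" "forced (pverts G) u z"
        unfolding overcommitted_def by (elim bexE conjE)
      have ne: "u \<noteq> x" "u \<noteq> y" "u \<noteq> z" "x \<noteq> y" "x \<noteq> z" "y \<noteq> z"
        using xyz irrefl_E unfolding independent3_def by blast+
      obtain ex where ex: "ex \<in> path_points (P u)" "ex \<in> path_points (P x)"
        using adj[OF u xyz(1) ne(1)] xyz(4) unfolding touching_def by blast
      obtain ey where ey: "ey \<in> path_points (P u)" "ey \<in> path_points (P y)"
        using adj[OF u xyz(2) ne(2)] xyz(5) unfolding touching_def by blast
      obtain ez where ez: "ez \<in> path_points (P u)" "ez \<in> path_points (P z)"
        using adj[OF u xyz(3) ne(3)] xyz(6) unfolding touching_def by blast
      have nt: "\<not> touching (P x) (P y)" "\<not> touching (P x) (P z)" "\<not> touching (P y) (P z)"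
        using adj[of x y] adj[of x z] adj[of y z] xyz ne unfolding independent3_def by blast+
      have "ex \<noteq> ey" "ex \<noteq> ez" "ey \<noteq> ez" using nt ex ey ez unfolding touching_def by blast+
      then have "card {ex, ey, ez} = 3" by simp
      moreover have "{ex, ey, ez} \<subseteq> path_ends (P u)"
        using end_of_forced[OF f(1) ex] end_of_forced[OF f(2) ey] end_of_forced[OF f(3) ez] by simp
      ultimately show False
        using card_mono[OF finite_path_ends, of "{ex, ey, ez}" "P u"] card_path_ends[OF valid[OF u]] by simp
    next
      case 2
      then obtain a b c d where m: "a \<in> pverts G" "b \<in> pverts G" "c \<in> pverts G" "d \<in> pverts G"
        and dia: "diamond a b c d" by (elim bexE)
      have ne: "a \<noteq> b" "a \<noteq> c" "a \<noteq> d" "b \<noteq> c" "b \<noteq> d" "c \<noteq> d" and E: "(a, b) \<in> parcs G"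
        "(a, c) \<in> parcs G" "(a, d) \<in> parcs G" "(b, c) \<in> parcs G" "(b, d) \<in> parcs G" "(c, d) \<notin> parcs G"
        using dia irrefl_E unfolding diamond_def by blast+
      obtain e where e: "\<And>v. v \<in> {a, b, c} \<Longrightarrow> e \<in> path_points (P v)"
        using clique_point[of "{a, b, c}"] m E E(1-5)[THEN sym_E] by auto
      obtain e' where e': "\<And>v. v \<in> {a, b, d} \<Longrightarrow> e' \<in> path_points (P v)"
        using clique_point[of "{a, b, d}"] m E E(1-5)[THEN sym_E] by auto
      have "e = e'" using common_point_unique[OF nc[OF m(1,2) ne(1)]] e e' by blast
      then have "touching (P c) (P d)" using e[of c] e'[of d] unfolding touching_def by blast
      then show False using adj[OF m(3,4) ne(6)] E(6) by blast
    next
      case 3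
      then obtain a b c d e where m: "a \<in> pverts G" "b \<in> pverts G" "c \<in> pverts G" "d \<in> pverts G" "e \<in> pverts G"
        and K: "clique4 a b c d" "(a, e) \<in> parcs G" "(b, e) \<in> parcs G" "(c, e) \<in> parcs G" "(d, e) \<in> parcs G"
        by (elim bexE conjE)
      let ?K = "{a, b, c, d, e}"
      have E0: "(a, b) \<in> parcs G" "(a, c) \<in> parcs G" "(a, d) \<in> parcs G" "(b, c) \<in> parcs G"
        "(b, d) \<in> parcs G" "(c, d) \<in> parcs G" using K(1) unfolding clique4_def by simp_all
      have E: "(v, w) \<in> parcs G" if "v \<in> ?K" "w \<in> ?K" "v \<noteq> w" for v w
        using that E0 E0[THEN sym_E] K(2-) K(2-)[THEN sym_E] by (elim insertE emptyE) simp_all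
      have "distinct [a, b, c, d, e]"
        using K irrefl_E unfolding clique4_def distinct.simps set_simps insert_iff empty_iff by metis
      then have card: "card ?K = 5" by simp
      have KG: "?K \<subseteq> pverts G" using m by simp
      obtain q where q: "\<And>v. v \<in> ?K \<Longrightarrow> q \<in> path_points (P v)"
        using clique_point[of ?K] KG E by auto
      have "card ?K \<le> (\<Sum>v\<in>?K. card (directions (P v) q))"
        using directions_nonempty[OF valid q] KG sum_mono[of ?K "\<lambda>_. 1" "\<lambda>v. card (directions (P v) q)"]
        by auto
      moreover have "(\<Sum>v\<in>?K. card (directions (P v) q)) \<le> 4"
        using KG nc by (intro sum_card_directions) blast+
      ultimately show False using card by linarith
    qed
  qed
qed

section \<open>Attaching paths to a representation\<close>

context adjacency begin

definition represents :: "'a set \<Rightarrow> ('a \<Rightarrow> grid_path) \<Rightarrow> bool" where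
  "represents W P \<longleftrightarrow> (\<forall>v\<in>W. valid_grid_path (P v)) \<and>
     (\<forall>u\<in>W. \<forall>v\<in>W. u \<noteq> v \<longrightarrow> noncrossing (P u) (P v) \<and> ((u, v) \<in> E \<longleftrightarrow> touching (P u) (P v)))"

definition free_ends :: "'a set \<Rightarrow> ('a \<Rightarrow> grid_path) \<Rightarrow> 'a \<Rightarrow> grid_point set" where
  "free_ends W P v = {e \<in> path_ends (P v). \<forall>w\<in>W. w \<noteq> v \<longrightarrow> e \<notin> path_points (P w)}"

lemma representsD:
  assumes "represents W P"
  shows "v \<in> W \<Longrightarrow> valid_grid_path (P v)"
    "u \<in> W \<Longrightarrow> v \<in> W \<Longrightarrow> u \<noteq> v \<Longrightarrow> noncrossing (P u) (P v)"
    "u \<in> W \<Longrightarrow> v \<in> W \<Longrightarrow> u \<noteq> v \<Longrightarrow> (u, v) \<in> E \<longleftrightarrow> touching (P u) (P v)"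
  using assms unfolding represents_def by blast+

lemma finite_free_ends: "finite (free_ends W P v)"
  unfolding free_ends_def using finite_path_ends by (rule rev_finite_subset) blast

text \<open>Meant for symmetries of the grid. Scaling is not an instance, since it does not map grid
  edges to grid edges.\<close>

lemma represents_transform:
  assumes inj: "inj \<tau>"
    and \<sigma>: "\<And>p. valid_grid_path p \<Longrightarrow> valid_grid_path (\<sigma> p)"
      "\<And>p. path_points (\<sigma> p) = \<tau> ` path_points p"
      "\<And>p. path_interior (\<sigma> p) = \<tau> ` path_interior p"
      "\<And>p. path_edges (\<sigma> p) = (`) \<tau> ` path_edges p"
      "\<And>p. path_ends (\<sigma> p) = \<tau> ` path_ends p"
    and rep: "represents W P"
  shows "represents W (\<sigma> \<circ> P)" "card (free_ends W (\<sigma> \<circ> P) v) = card (free_ends W P v)"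
    "free_ends W (\<sigma> \<circ> P) v = \<tau> ` free_ends W P v"
proof -
  have inj2: "inj ((`) \<tau>)" using inj by (simp add: inj_image_eq_iff inj_on_def)
  have "noncrossing (\<sigma> p) (\<sigma> q) = noncrossing p q" for p q
    unfolding noncrossing_def \<sigma> image_Int[OF inj, symmetric] image_Int[OF inj2, symmetric] by simp
  moreover have "touching (\<sigma> p) (\<sigma> q) = touching p q" for p q
    unfolding touching_def \<sigma> image_Int[OF inj, symmetric] by simp
  ultimately show "represents W (\<sigma> \<circ> P)" using rep \<sigma>(1) unfolding represents_def by simp
  show *: "free_ends W (\<sigma> \<circ> P) v = \<tau> ` free_ends W P v"
  proof -
    have "{e \<in> \<tau> ` A. R e} = \<tau> ` {e \<in> A. R (\<tau> e)}" for A R by blast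
    then show ?thesis
      unfolding free_ends_def comp_def \<sigma> using inj by (simp add: inj_image_mem_iff)
  qed
  show "card (free_ends W (\<sigma> \<circ> P) v) = card (free_ends W P v)"
    unfolding * using inj by (simp add: card_image inj_on_subset)
qed

section \<open>Symmetries and scaling of the grid\<close>

fun transpose_path :: "grid_path \<Rightarrow> grid_path" where
  "transpose_path (Horizontal y a b) = Vertical y a b"
| "transpose_path (Vertical x a b) = Horizontal x a b"

text \<open>The half turn. Negation reverses the order, so the two ends change places. Together with
  transposition it brings any end of any path to the right end of a horizontal one.\<close>

fun rotate_path :: "grid_path \<Rightarrow> grid_path" where
  "rotate_path (Horizontal y a b) = Horizontal (- y) (- b) (- a)"
| "rotate_path (Vertical x a b) = Vertical (- x) (- b) (- a)"

fun scale_path :: "grid_path \<Rightarrow> grid_path" where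
  "scale_path (Horizontal y a b) = Horizontal (3 * y) (3 * a) (3 * b)"
| "scale_path (Vertical x a b) = Vertical (3 * x) (3 * a) (3 * b)"

lemma path_edges_image:
  "path_edges (Horizontal y a b) = (\<lambda>i. {(i, y), (i + 1, y)}) ` {a..<b}"
  "path_edges (Vertical x a b) = (\<lambda>i. {(x, i), (x, i + 1)}) ` {a..<b}"
  by auto

lemma represents_transpose:
  assumes "represents W P"
  shows "represents W (transpose_path \<circ> P)"
    "card (free_ends W (transpose_path \<circ> P) v) = card (free_ends W P v)"
    "free_ends W (transpose_path \<circ> P) v = prod.swap ` free_ends W P v"
proof -
  have 1: "path_points (transpose_path p) = prod.swap ` path_points p" for p by (cases p) force+
  have 2: "path_interior (transpose_path p) = prod.swap ` path_interior p" for p by (cases p) force+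
  have 3: "path_edges (transpose_path p) = (`) prod.swap ` path_edges p" for p
    by (cases p) (simp_all add: path_edges_image image_image del: path_edges.simps)
  have 4: "path_ends (transpose_path p) = prod.swap ` path_ends p" for p by (cases p) auto
  have 5: "valid_grid_path (transpose_path p)" if "valid_grid_path p" for p using that by (cases p) auto
  show "represents W (transpose_path \<circ> P)"
    "card (free_ends W (transpose_path \<circ> P) v) = card (free_ends W P v)"
    "free_ends W (transpose_path \<circ> P) v = prod.swap ` free_ends W P v"
    using represents_transform[OF inj_swap[of UNIV] 5 1 2 3 4 assms] by auto
qed

lemma represents_rotate:
  assumes "represents W P"
  shows "represents W (rotate_path \<circ> P)"
    "card (free_ends W (rotate_path \<circ> P) v) = card (free_ends W P v)"
    "free_ends W (rotate_path \<circ> P) v = map_prod uminus uminus ` free_ends W P v"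
proof -
  let ?t = "map_prod uminus uminus :: grid_point \<Rightarrow> grid_point"
  have mem: "e \<in> ?t ` A \<longleftrightarrow> (- fst e, - snd e) \<in> A" for e A by (cases e) force
  have 1: "path_points (rotate_path p) = ?t ` path_points p" for p by (cases p) (auto simp: mem)
  have 2: "path_interior (rotate_path p) = ?t ` path_interior p" for p by (cases p) (auto simp: mem)
  have 3: "path_edges (rotate_path p) = (`) ?t ` path_edges p" for p
  proof -
    \<comment> \<open>An edge is named by its lower end: the edge from \<open>i\<close> to
      \<open>i + 1\<close> becomes the one from \<open>- i - 1\<close> to
      \<open>- i\<close>.\<close>
    have "{- b..<- a} = (\<lambda>i. - i - 1) ` {a..<b}" for a b :: int
    proof (intro equalityI subsetI)
      fix i assume "i \<in> {- b..<- a}"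
      then show "i \<in> (\<lambda>i. - i - 1) ` {a..<b}" by (intro image_eqI[of _ _ "- i - 1"]) auto
    qed auto
    then show ?thesis
      by (cases p) (simp_all add: path_edges_image image_image insert_commute del: path_edges.simps)
  qed
  have 4: "path_ends (rotate_path p) = ?t ` path_ends p" for p by (cases p) auto
  have 5: "valid_grid_path (rotate_path p)" if "valid_grid_path p" for p using that by (cases p) auto
  have inj: "inj ?t" by (auto intro!: injI)
  show "represents W (rotate_path \<circ> P)"
    "card (free_ends W (rotate_path \<circ> P) v) = card (free_ends W P v)"
    "free_ends W (rotate_path \<circ> P) v = map_prod uminus uminus ` free_ends W P v"
    using represents_transform[OF inj 5 1 2 3 4 assms] by auto
qed

lemma touching_simps:
  "touching p q \<longleftrightarrow> max (x_min p) (x_min q) \<le> min (x_max p) (x_max q) \<and>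
     max (y_min p) (y_min q) \<le> min (y_max p) (y_max q)"
  unfolding touching_def path_points_box Times_Int_Times by auto

lemma noncrossing_simps:
  "a < b \<Longrightarrow> a' < b' \<Longrightarrow>
    noncrossing (Horizontal y a b) (Horizontal y' a' b') \<longleftrightarrow> y \<noteq> y' \<or> b \<le> a' \<or> b' \<le> a"
  "a < b \<Longrightarrow> a' < b' \<Longrightarrow>
    noncrossing (Vertical x a b) (Vertical x' a' b') \<longleftrightarrow> x \<noteq> x' \<or> b \<le> a' \<or> b' \<le> a"
  "noncrossing (Horizontal y a b) (Vertical x c d) \<longleftrightarrow> \<not> (a < x \<and> x < b \<and> c < y \<and> y < d)"
  "noncrossing (Vertical x c d) (Horizontal y a b) \<longleftrightarrow> \<not> (a < x \<and> x < b \<and> c < y \<and> y < d)"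
proof -
  show "noncrossing (Horizontal y a b) (Horizontal y' a' b') \<longleftrightarrow> y \<noteq> y' \<or> b \<le> a' \<or> b' \<le> a"
    if ab: "a < b" "a' < b'"
  proof
    assume nc: "noncrossing (Horizontal y a b) (Horizontal y' a' b')"
    show "y \<noteq> y' \<or> b \<le> a' \<or> b' \<le> a"
    proof (rule ccontr)
      assume "\<not> ?thesis"
      then have no: "y = y'" "a' < b" "a < b'" by auto
      \<comment> \<open>The larger of the two left ends; the overlap contains the unit edge starting
        there.\<close>
      define m where "m = max a a'"
      have "a \<le> m" "a' \<le> m" "m + 1 \<le> b" "m + 1 \<le> b'" unfolding m_def using no ab by auto
      with no(1) show False
        using common_point_unique[OF nc, of "(m, y)" "(m + 1, y)"] by simp
    qed
  next
    assume "y \<noteq> y' \<or> b \<le> a' \<or> b' \<le> a"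
    then show "noncrossing (Horizontal y a b) (Horizontal y' a' b')"
      unfolding noncrossing_def by (intro conjI equals0I) (auto simp: doubleton_eq_iff)
  qed
  show "noncrossing (Vertical x a b) (Vertical x' a' b') \<longleftrightarrow> x \<noteq> x' \<or> b \<le> a' \<or> b' \<le> a"
    if ab: "a < b" "a' < b'"
  proof
    assume nc: "noncrossing (Vertical x a b) (Vertical x' a' b')"
    show "x \<noteq> x' \<or> b \<le> a' \<or> b' \<le> a"
    proof (rule ccontr)
      assume "\<not> ?thesis"
      then have no: "x = x'" "a' < b" "a < b'" by auto
      define m where "m = max a a'"
      have "a \<le> m" "a' \<le> m" "m + 1 \<le> b" "m + 1 \<le> b'" unfolding m_def using no ab by auto
      with no(1) show False
        using common_point_unique[OF nc, of "(x, m)" "(x, m + 1)"] by simp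
    qed
  next
    assume "x \<noteq> x' \<or> b \<le> a' \<or> b' \<le> a"
    then show "noncrossing (Vertical x a b) (Vertical x' a' b')"
      unfolding noncrossing_def by (intro conjI equals0I) (auto simp: doubleton_eq_iff)
  qed
  show "noncrossing (Horizontal y a b) (Vertical x c d) \<longleftrightarrow> \<not> (a < x \<and> x < b \<and> c < y \<and> y < d)"
  proof -
    have "path_edges (Horizontal y a b) \<inter> path_edges (Vertical x c d) = {}"
      by (rule equals0I) (auto simp: doubleton_eq_iff)
    moreover have "e \<in> path_interior (Horizontal y a b) \<inter> path_interior (Vertical x c d) \<longleftrightarrow>
        e = (x, y) \<and> a < x \<and> x < b \<and> c < y \<and> y < d" for e
      by (cases e) auto
    ultimately show ?thesis unfolding noncrossing_def by blast
  qed
  then show "noncrossing (Vertical x c d) (Horizontal y a b) \<longleftrightarrow> \<not> (a < x \<and> x < b \<and> c < y \<and> y < d)"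
    unfolding noncrossing_commute[of "Vertical x c d"] .
qed

lemma mem_scale_path:
  "(3 * i, 3 * j) \<in> path_points (scale_path p) \<longleftrightarrow> (i, j) \<in> path_points p"
  by (cases p) auto

text \<open>Scaling by 3 makes room next to any point of a path without creating contacts.\<close>

lemma represents_scale:
  assumes rep: "represents W P"
  shows "represents W (scale_path \<circ> P)"
    "card (free_ends W (scale_path \<circ> P) v) = card (free_ends W P v)"
    "free_ends W (scale_path \<circ> P) v = map_prod ((*) 3) ((*) 3) ` free_ends W P v"
proof -
  have valid: "valid_grid_path (scale_path p) = valid_grid_path p" for p by (cases p) auto
  have "noncrossing (scale_path p) (scale_path q) = noncrossing p q"
    if "valid_grid_path p" "valid_grid_path q" for p q
    using that by (cases p; cases q) (auto simp: noncrossing_simps)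
  moreover have "touching (scale_path p) (scale_path q) = touching p q" for p q
    unfolding touching_simps by (cases p; cases q) auto
  ultimately show "represents W (scale_path \<circ> P)" using rep valid unfolding represents_def by simp
  let ?t = "map_prod ((*) 3) ((*) 3) :: grid_point \<Rightarrow> grid_point"
  have ends: "path_ends (scale_path p) = ?t ` path_ends p" for p by (cases p) auto
  have mem: "?t e \<in> path_points (scale_path p) \<longleftrightarrow> e \<in> path_points p" for e p
    using mem_scale_path by (cases e) simp
  show *: "free_ends W (scale_path \<circ> P) v = ?t ` free_ends W P v"
    unfolding free_ends_def comp_def ends using mem by auto
  show "card (free_ends W (scale_path \<circ> P) v) = card (free_ends W P v)"
    unfolding * by (intro card_image inj_onI) auto
qed

text \<open>All new paths run through one point \<open>e\<close>, meet each other and the old paths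
  nowhere else, and \<open>p\<close> is the only old path at \<open>e\<close>. So adjacency is
  decided at \<open>e\<close>, crossings have to be excluded only at \<open>e\<close>, and
  \<open>e\<close> is the only free end that can be lost.\<close>

lemma represents_attach:
  assumes rep: "represents W P" and p: "p \<in> W" and C: "C \<inter> W = {}"
    and Q: "\<And>c. c \<in> C \<Longrightarrow> valid_grid_path (Q c)" "\<And>c. c \<in> C \<Longrightarrow> e \<in> path_points (Q c)"
    and meet: "\<And>c w. c \<in> C \<Longrightarrow> w \<in> W \<Longrightarrow> path_points (Q c) \<inter> path_points (P w) \<subseteq> {e}"
      "\<And>c d. c \<in> C \<Longrightarrow> d \<in> C \<Longrightarrow> c \<noteq> d \<Longrightarrow> path_points (Q c) \<inter> path_points (Q d) \<subseteq> {e}"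
    and inner: "\<And>c. c \<in> C \<Longrightarrow> e \<in> path_interior (P p) \<Longrightarrow> e \<notin> path_interior (Q c)"
      "\<And>c d. c \<in> C \<Longrightarrow> d \<in> C \<Longrightarrow> c \<noteq> d \<Longrightarrow> e \<in> path_interior (Q c) \<Longrightarrow> e \<notin> path_interior (Q d)"
    and e: "\<And>w. w \<in> W \<Longrightarrow> e \<in> path_points (P w) \<longleftrightarrow> w = p"
    and clique: "\<And>c d. c \<in> C \<Longrightarrow> d \<in> C \<Longrightarrow> c \<noteq> d \<Longrightarrow> (c, d) \<in> E"
    and adj: "\<And>c w. c \<in> C \<Longrightarrow> w \<in> W \<Longrightarrow> (c, w) \<in> E \<longleftrightarrow> w = p"
  defines "R \<equiv> \<lambda>v. if v \<in> C then Q v else P v"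
  shows "represents (W \<union> C) R"
    "\<And>w. w \<in> W \<Longrightarrow> free_ends W P w - {e} \<subseteq> free_ends (W \<union> C) R w"
    "\<And>c. c \<in> C \<Longrightarrow> path_ends (Q c) - {e} \<subseteq> free_ends (W \<union> C) R c"
proof -
  have RW: "R w = P w" if "w \<in> W" for w using that C unfolding R_def by auto
  have RC: "R c = Q c" if "c \<in> C" for c using that unfolding R_def by simp
  have nc: "noncrossing q r"
    if "path_points q \<inter> path_points r \<subseteq> {e}" "e \<in> path_interior q \<Longrightarrow> e \<notin> path_interior r"
      "valid_grid_path q" "valid_grid_path r" for q r
  proof -
    have "\<exists>f f'. f \<noteq> f' \<and> {f, f'} \<subseteq> path_points q \<inter> path_points r"
      if a: "a \<in> path_edges q" "a \<in> path_edges r" for a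
    proof -
      have two: "\<exists>f f'. f \<noteq> f' \<and> a = {f, f'} \<and> a \<subseteq> path_points s" if "a \<in> path_edges s" for s
      proof (cases s)
        case (Horizontal y l h)
        then obtain i where "a = {(i, y), (i + 1, y)}" "l \<le> i" "i < h" using \<open>a \<in> path_edges s\<close> by auto
        then show ?thesis using Horizontal by (intro exI[of _ "(i, y)"] exI[of _ "(i + 1, y)"]) auto
      next
        case (Vertical x l h)
        then obtain i where "a = {(x, i), (x, i + 1)}" "l \<le> i" "i < h" using \<open>a \<in> path_edges s\<close> by auto
        then show ?thesis using Vertical by (intro exI[of _ "(x, i)"] exI[of _ "(x, i + 1)"]) auto
      qed
      from two[OF a(1)] obtain f f' where "f \<noteq> f'" "a = {f, f'}" "a \<subseteq> path_points q" by (elim exE conjE)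
      moreover have "a \<subseteq> path_points r" using two[OF a(2)] by (elim exE conjE)
      ultimately show ?thesis by (intro exI[of _ f] exI[of _ f']) simp
    qed
    then have "path_edges q \<inter> path_edges r = {}"
      using that(1)
    proof (intro equals0I)
      fix a assume "a \<in> path_edges q \<inter> path_edges r"
      then obtain f f' where "f \<noteq> f'" "{f, f'} \<subseteq> path_points q \<inter> path_points r"
        using \<open>\<And>a. a \<in> path_edges q \<Longrightarrow> a \<in> path_edges r \<Longrightarrow>
          \<exists>f f'. f \<noteq> f' \<and> {f, f'} \<subseteq> path_points q \<inter> path_points r\<close> by (elim IntE) metis
      then have "{f, f'} \<subseteq> {e}" using that(1) by (rule_tac subset_trans)
      then show False using \<open>f \<noteq> f'\<close> by simp
    qed
    moreover have "path_interior q \<subseteq> path_points q" "path_interior r \<subseteq> path_points r"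
      using that(3,4) path_points_eq by blast+
    ultimately show ?thesis unfolding noncrossing_def using that(1,2) by blast
  qed
  have CW: "noncrossing (Q c) (P w) \<and> ((c, w) \<in> E \<longleftrightarrow> touching (Q c) (P w))"
    if "c \<in> C" "w \<in> W" for c w
  proof
    have "e \<notin> path_interior (P w)" if "e \<in> path_interior (Q c)"
    proof (cases "w = p")
      case True then show ?thesis using inner(1)[OF \<open>c \<in> C\<close>] that by blast
    next
      case False
      then show ?thesis using e[OF \<open>w \<in> W\<close>] path_points_eq[OF representsD(1)[OF rep \<open>w \<in> W\<close>]] by blast
    qed
    then show "noncrossing (Q c) (P w)"
      using nc[OF meet(1)[OF that]] Q(1)[OF that(1)] representsD(1)[OF rep that(2)] by blast
    show "(c, w) \<in> E \<longleftrightarrow> touching (Q c) (P w)"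
      unfolding adj[OF that] touching_def
      using e[OF that(2)] Q(2)[OF that(1)] meet(1)[OF that] by blast
  qed
  have CC: "noncrossing (Q c) (Q d) \<and> ((c, d) \<in> E \<longleftrightarrow> touching (Q c) (Q d))"
    if cd: "c \<in> C" "d \<in> C" "c \<noteq> d" for c d
    using nc[OF meet(2)[OF cd] inner(2)[OF cd] Q(1)[OF cd(1)] Q(1)[OF cd(2)]] clique[OF cd]
      Q(2)[OF cd(1)] Q(2)[OF cd(2)] unfolding touching_def by blast
  have WC: "noncrossing (P w) (Q c) \<and> ((w, c) \<in> E \<longleftrightarrow> touching (P w) (Q c))"
    if "c \<in> C" "w \<in> W" for c w
    using CW[OF that] noncrossing_commute touching_commute sym_E by blast
  show "represents (W \<union> C) R"
    unfolding represents_def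
  proof (intro conjI ballI impI)
    show "valid_grid_path (R v)" if "v \<in> W \<union> C" for v
      using that representsD(1)[OF rep] Q(1) RW RC by (metis Un_iff)
    fix u v assume uv: "u \<in> W \<union> C" "v \<in> W \<union> C" "u \<noteq> v"
    have "noncrossing (R u) (R v) \<and> ((u, v) \<in> E \<longleftrightarrow> touching (R u) (R v))"
    proof (cases "u \<in> C"; cases "v \<in> C")
      assume "u \<notin> C" "v \<notin> C"
      then have "u \<in> W" "v \<in> W" using uv by auto
      then show ?thesis using representsD(2,3)[OF rep, of u v] uv(3) RW by simp
    next
      assume "u \<notin> C" "v \<in> C"
      then have "u \<in> W" "v \<in> C" using uv by auto
      then show ?thesis using WC RW RC by simp
    next
      assume "u \<in> C" "v \<notin> C"
      then have "u \<in> C" "v \<in> W" using uv by auto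
      then show ?thesis using CW RW RC by simp
    next
      assume "u \<in> C" "v \<in> C"
      then show ?thesis using CC uv(3) RC by simp
    qed
    then show "noncrossing (R u) (R v)" "(u, v) \<in> E \<longleftrightarrow> touching (R u) (R v)" by blast+
  qed
  show "free_ends W P w - {e} \<subseteq> free_ends (W \<union> C) R w" if w: "w \<in> W" for w
  proof
    fix f assume f: "f \<in> free_ends W P w - {e}"
    then have "f \<in> path_ends (P w)" unfolding free_ends_def by blast
    then have fw: "f \<in> path_points (P w)" using path_points_eq[OF representsD(1)[OF rep w]] by blast
    have "f \<notin> path_points (Q c)" if "c \<in> C" for c using meet(1)[OF that w] fw f by blast
    moreover have "w \<notin> C" using w C by blast
    ultimately show "f \<in> free_ends (W \<union> C) R w"
      using f w unfolding free_ends_def R_def by auto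
  qed
  show "path_ends (Q c) - {e} \<subseteq> free_ends (W \<union> C) R c" if c: "c \<in> C" for c
  proof
    fix f assume f: "f \<in> path_ends (Q c) - {e}"
    then have fc: "f \<in> path_points (Q c)" using path_points_eq[OF Q(1)[OF c]] by blast
    have "f \<notin> path_points (P w)" if "w \<in> W" for w using meet(1)[OF c that] fc f by blast
    moreover have "f \<notin> path_points (Q d)" if "d \<in> C" "d \<noteq> c" for d
      using meet(2)[OF c that(1)] that(2) fc f by blast
    ultimately show "f \<in> free_ends (W \<union> C) R c"
      using f c unfolding free_ends_def R_def by auto
  qed
qed


section \<open>Placing a block at an inner point, at an end, or far away\<close>

lemma finite_card_inj:
  assumes "finite A" "card A \<le> n"
  shows "\<exists>f :: 'a \<Rightarrow> nat. inj_on f A \<and> (\<forall>a\<in>A. f a < n)"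
  using card_le_inj[of A "{..<n}"] assms by (auto simp: image_subset_iff)

text \<open>A path through a point uses two of its four directions, so two new paths can end there,
  one from each side. Each keeps its other end free, and no old end is spent.\<close>

lemma attach_inner:
  assumes rep: "represents W P" and p: "p \<in> W" and C: "C \<inter> W = {}" "finite C" "card C \<le> 2"
    and clique: "\<And>c d. c \<in> C \<Longrightarrow> d \<in> C \<Longrightarrow> c \<noteq> d \<Longrightarrow> (c, d) \<in> E"
    and adj: "\<And>c w. c \<in> C \<Longrightarrow> w \<in> W \<Longrightarrow> (c, w) \<in> E \<longleftrightarrow> w = p"
  shows "\<exists>R. represents (W \<union> C) R \<and>
    (\<forall>w\<in>W. card (free_ends W P w) \<le> card (free_ends (W \<union> C) R w)) \<and>
    (\<forall>c\<in>C. 1 \<le> card (free_ends (W \<union> C) R c))"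
proof -
  obtain P1 y a b where P1: "represents W P1" "\<And>w. card (free_ends W P1 w) = card (free_ends W P w)"
    "P1 p = Horizontal y a b"
  proof (cases "P p")
    case (Horizontal y a b)
    then show ?thesis using that[of P] rep by simp
  next
    case (Vertical x a b)
    then show ?thesis using that[of "transpose_path \<circ> P"] represents_transpose[OF rep] by simp
  qed
  have ab: "a < b" using representsD(1)[OF P1(1) p] P1(3) by simp
  define P2 where "P2 = scale_path \<circ> P1"
  note scale = represents_scale[OF P1(1), folded P2_def]
  \<comment> \<open>Next to the left end of the scaled path. The first coordinate is not divisible
    by three, so no vertical path gets there, and a second horizontal one would overlap
    \<open>p\<close>.\<close>
  define e :: grid_point where "e = (3 * a + 1, 3 * y)"
  obtain f :: "'a \<Rightarrow> nat" where f: "inj_on f C" "\<And>c. c \<in> C \<Longrightarrow> f c < 2"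
    using finite_card_inj[OF C(2,3)] by blast
  define Q where "Q c = (if f c = 0 then Vertical (3 * a + 1) (3 * y) (3 * y + 1)
    else Vertical (3 * a + 1) (3 * y - 1) (3 * y))" for c
  define R where "R v = (if v \<in> C then Q v else P2 v)" for v
  have e_iff: "e \<in> path_points (P2 w) \<longleftrightarrow> w = p" if w: "w \<in> W" for w
  proof
    assume mem: "e \<in> path_points (P2 w)"
    show "w = p"
    proof (rule ccontr)
      assume "w \<noteq> p"
      then have nc: "noncrossing (P1 p) (P1 w)" using representsD(2)[OF P1(1) p w] by blast
      show False
      proof (cases "P1 w")
        case (Horizontal y' a' b')
        then have "a' < b'" using representsD(1)[OF P1(1) w] by simp
        then show False using nc mem ab unfolding P1(3) Horizontal
          by (auto simp: P2_def e_def Horizontal noncrossing_simps)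
      next
        case (Vertical x' a' b')
        then show False using mem by (auto simp: P2_def e_def) presburger
      qed
    qed
  qed (use ab in \<open>simp add: P2_def e_def P1(3)\<close>)
  have meet: "path_points (Q c) \<inter> path_points (P2 w) \<subseteq> {e}" for c w
  proof
    fix q assume q: "q \<in> path_points (Q c) \<inter> path_points (P2 w)"
    obtain i j where ij: "q = (i, j)" by (cases q)
    then have ij': "i = 3 * a + 1" "j = 3 * y \<or> j = 3 * y + 1 \<or> j = 3 * y - 1"
      using q unfolding Q_def by (auto split: if_splits)
    have "j = 3 * y"
    proof (cases "P1 w")
      case (Horizontal y' a' b')
      then have "j = 3 * y'" using q ij by (simp add: P2_def)
      then show ?thesis using ij'(2) by presburger
    next
      case (Vertical x' a' b')
      then have "3 * a + 1 = 3 * x'" using q ij ij' by (simp add: P2_def)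
      then show ?thesis by presburger
    qed
    then show "q \<in> {e}" using ij ij' unfolding e_def by simp
  qed
  have meet2: "path_points (Q c) \<inter> path_points (Q d) \<subseteq> {e}" if "c \<in> C" "d \<in> C" "c \<noteq> d" for c d
  proof -
    have "f c \<noteq> f d" using f(1) that by (auto dest: inj_onD)
    then have "f c = 0 \<and> f d \<noteq> 0 \<or> f c \<noteq> 0 \<and> f d = 0" using f(2)[OF that(1)] f(2)[OF that(2)] by linarith
    then show ?thesis unfolding Q_def e_def by auto
  qed
  note attach = represents_attach[OF scale(1) p C(1), of Q e, folded R_def]
  have Qv: "valid_grid_path (Q c)" "e \<in> path_points (Q c)" "e \<notin> path_interior (Q c)" "e \<in> path_ends (Q c)" for c
    unfolding Q_def e_def by simp_all
  have R1: "represents (W \<union> C) R"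
    "\<And>w. w \<in> W \<Longrightarrow> free_ends W P2 w - {e} \<subseteq> free_ends (W \<union> C) R w"
    "\<And>c. c \<in> C \<Longrightarrow> path_ends (Q c) - {e} \<subseteq> free_ends (W \<union> C) R c"
    using attach[OF Qv(1) Qv(2) meet meet2 Qv(3) Qv(3) e_iff clique adj] by simp_all
  have "card (free_ends W P w) \<le> card (free_ends (W \<union> C) R w)" if w: "w \<in> W" for w
  proof -
    \<comment> \<open>The coordinates of a scaled free end are divisible by three, which fails for
      \<open>e\<close>.\<close>
    have "e \<notin> free_ends W P2 w" unfolding scale(3) e_def by auto presburger
    then have "free_ends W P2 w \<subseteq> free_ends (W \<union> C) R w" using R1(2)[OF w] by blast
    from card_mono[OF finite_free_ends this] show ?thesis using scale(2) P1(2) by simp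
  qed
  moreover have "1 \<le> card (free_ends (W \<union> C) R c)" if c: "c \<in> C" for c
    using card_mono[OF finite_free_ends R1(3)[OF c]] card_path_ends[OF Qv(1), of c] Qv(4)[of c]
    by simp
  ultimately show ?thesis using R1(1) by blast
qed

text \<open>At its end \<open>p\<close> uses one of the four directions. A member of
  \<open>X\<close> passes through and uses two while keeping both ends free; the others use one
  each. Hence the bound \<open>card C + card X \<le> 3\<close>.\<close>

lemma attach_end:
  assumes rep: "represents W P" and p: "p \<in> W" "free_ends W P p \<noteq> {}"
    and C: "C \<inter> W = {}" "finite C" "X \<subseteq> C" "card X \<le> 1" "card C + card X \<le> 3"
    and clique: "\<And>c d. c \<in> C \<Longrightarrow> d \<in> C \<Longrightarrow> c \<noteq> d \<Longrightarrow> (c, d) \<in> E"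
    and adj: "\<And>c w. c \<in> C \<Longrightarrow> w \<in> W \<Longrightarrow> (c, w) \<in> E \<longleftrightarrow> w = p"
  shows "\<exists>R. represents (W \<union> C) R \<and>
    (\<forall>w\<in>W - {p}. card (free_ends W P w) \<le> card (free_ends (W \<union> C) R w)) \<and>
    card (free_ends W P p) \<le> Suc (card (free_ends (W \<union> C) R p)) \<and>
    (\<forall>c\<in>C. 1 \<le> card (free_ends (W \<union> C) R c)) \<and>
    (\<forall>c\<in>X. 2 \<le> card (free_ends (W \<union> C) R c))"
proof -
  obtain P0 y0 a0 b0 where P0: "represents W P0" "\<And>w. card (free_ends W P0 w) = card (free_ends W P w)"
    "P0 p = Horizontal y0 a0 b0"
  proof (cases "P p")
    case (Horizontal y a b)
    then show ?thesis using that[of P] rep by simp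
  next
    case (Vertical x a b)
    then show ?thesis using that[of "transpose_path \<circ> P"] represents_transpose[OF rep] by simp
  qed
  have "free_ends W P0 p \<noteq> {}" using P0(2)[of p] p(2) finite_free_ends
    by (metis card.empty card_0_eq)
  then have "(a0, y0) \<in> free_ends W P0 p \<or> (b0, y0) \<in> free_ends W P0 p"
    unfolding free_ends_def P0(3) by auto
  then obtain P1 y a x where P1: "represents W P1" "\<And>w. card (free_ends W P1 w) = card (free_ends W P w)"
    "P1 p = Horizontal y a x" and free: "(x, y) \<in> free_ends W P1 p"
  proof
    assume "(a0, y0) \<in> free_ends W P0 p"
    \<comment> \<open>The half turn moves the free end from the left to the right.\<close>
    then have "(- a0, - y0) \<in> free_ends W (rotate_path \<circ> P0) p"
      unfolding represents_rotate(3)[OF P0(1)] by force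
    then show ?thesis
      using that[of "rotate_path \<circ> P0" "- y0" "- b0" "- a0"] represents_rotate[OF P0(1)] P0 by simp
  next
    assume "(b0, y0) \<in> free_ends W P0 p"
    then show ?thesis using that[of P0] P0 by simp
  qed
  define P2 where "P2 = scale_path \<circ> P1"
  note scale = represents_scale[OF P1(1), folded P2_def]
  define e :: grid_point where "e = (3 * x, 3 * y)"
  have ax: "a < x" using representsD(1)[OF P1(1) p(1)] P1(3) by simp
  have on_p: "(x, y) \<in> path_points (P1 w) \<longleftrightarrow> w = p" if "w \<in> W" for w
    using free that ax unfolding free_ends_def by (auto simp: P1(3))
  have e_iff: "e \<in> path_points (P2 w) \<longleftrightarrow> w = p" if "w \<in> W" for w
    using on_p[OF that] mem_scale_path[of x y "P1 w"] unfolding e_def P2_def by simp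
  \<comment> \<open>A path passing through vertically leaves one place, to the right of
    \<open>e\<close>; otherwise there are three places.\<close>
  have card_CX: "card (C - X) \<le> 3 - 2 * card X"
    using C card_Diff_subset[of X C] finite_subset[of X C] by simp
  obtain f :: "'a \<Rightarrow> nat" where f: "inj_on f (C - X)" "\<And>c. c \<in> C - X \<Longrightarrow> f c < 3 - 2 * card X"
    using finite_card_inj[OF _ card_CX] C(2) by blast
  \<comment> \<open>The places are numbered such that 0 is the one to the right, which remains
    available next to a vertical path through \<open>e\<close>.\<close>
  define Q where "Q c = (if c \<in> X then Vertical (3 * x) (3 * y - 1) (3 * y + 1)
    else if f c = 0 then Horizontal (3 * y) (3 * x) (3 * x + 1)
    else if f c = 1 then Vertical (3 * x) (3 * y) (3 * y + 1)
    else Vertical (3 * x) (3 * y - 1) (3 * y))" for c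
  define R where "R v = (if v \<in> C then Q v else P2 v)" for v
  have meet: "path_points (Q c) \<inter> path_points (P2 w) \<subseteq> {e}" if w: "w \<in> W" for c w
  proof
    fix q assume q: "q \<in> path_points (Q c) \<inter> path_points (P2 w)"
    obtain i j where ij: "q = (i, j)" by (cases q)
    then have "i = 3 * x \<and> (j = 3 * y \<or> j = 3 * y + 1 \<or> j = 3 * y - 1) \<or> i = 3 * x + 1 \<and> j = 3 * y"
      using q unfolding Q_def by (auto split: if_splits)
    \<comment> \<open>In these directions, a grid point next to \<open>e\<close> lies on a scaled
      path only if \<open>e\<close> does too. The only path at \<open>e\<close> is \<open>p\<close>,
      which is horizontal and ends there from the left.\<close>
    then consider "q = e" | "i = 3 * x" "j = 3 * y + 1 \<or> j = 3 * y - 1" | "i = 3 * x + 1" "j = 3 * y"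
      using ij unfolding e_def by blast
    then show "q \<in> {e}"
    proof cases
      case 2
      have False
      proof (cases "P1 w")
        case (Horizontal y' a' b')
        then have "j = 3 * y'" using q ij by (simp add: P2_def)
        then show False using 2 by presburger
      next
        case (Vertical x' a' b')
        then have "3 * x = 3 * x'" "3 * a' \<le> j" "j \<le> 3 * b'" using q ij 2 by (simp_all add: P2_def)
        then have "x = x'" "a' \<le> y" "y \<le> b'" using 2(2) by presburger+
        then have "w = p" using on_p[OF w] Vertical by simp
        then show False using P1(3) Vertical by simp
      qed
      then show ?thesis ..
    next
      case 3
      have False
      proof (cases "P1 w")
        case (Horizontal y' a' b')
        then have "y = y'" "3 * a' \<le> 3 * x + 1" "3 * x + 1 \<le> 3 * b'" using q ij 3 by (simp_all add: P2_def)
        then have "y = y'" "a' \<le> x" "x < b'" by presburger+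
        then have "w = p" using on_p[OF w] Horizontal by simp
        then show False using P1(3) Horizontal \<open>x < b'\<close> by simp
      next
        case (Vertical x' a' b')
        then have "3 * x + 1 = 3 * x'" using q ij 3 by (simp add: P2_def)
        then show False by presburger
      qed
      then show ?thesis ..
    qed simp
  qed
  have X1: "c = d" if "c \<in> X" "d \<in> X" for c d
    using that C(4) card_le_Suc0_iff_eq[OF finite_subset[OF C(3,2)]] by auto
  have X2: "f c = 0" if "c \<in> C - X" "X \<noteq> {}" for c
  proof -
    have "card X \<noteq> 0" using that(2) finite_subset[OF C(3,2)] by simp
    then show ?thesis using f(2)[OF that(1)] C(4) by linarith
  qed
  have meet2: "path_points (Q c) \<inter> path_points (Q d) \<subseteq> {e}" if cd: "c \<in> C" "d \<in> C" "c \<noteq> d" for c d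
  proof -
    consider "c \<in> X" "d \<notin> X" | "c \<notin> X" "d \<in> X" | "c \<notin> X" "d \<notin> X" using X1 cd by blast
    then show ?thesis
    proof cases
      case 1
      then have "f d = 0" using X2[of d] cd by blast
      then show ?thesis using 1 unfolding Q_def e_def by auto
    next
      case 2
      then have "f c = 0" using X2[of c] cd by blast
      then show ?thesis using 2 unfolding Q_def e_def by auto
    next
      case 3
      then have "f c \<noteq> f d" using f(1) cd by (auto dest: inj_onD)
      moreover have "f c < 3" "f d < 3" using f(2)[of c] f(2)[of d] cd 3 by simp_all
      ultimately show ?thesis using 3 unfolding Q_def e_def by auto
    qed
  qed
  have Qv: "valid_grid_path (Q c)" "e \<in> path_points (Q c)" for c
    unfolding Q_def e_def by simp_all
  have Qi: "e \<in> path_interior (Q c) \<longleftrightarrow> c \<in> X" for c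
    unfolding Q_def e_def by simp
  have inner2: "e \<notin> path_interior (Q d)" if "c \<in> C" "d \<in> C" "c \<noteq> d" "e \<in> path_interior (Q c)" for c d
    using that X1 unfolding Qi by blast
  have inner1: "e \<notin> path_interior (Q c)" if "c \<in> C" "e \<in> path_interior (P2 p)" for c
    using that(2) unfolding P2_def e_def by (simp add: P1(3))
  note attach = represents_attach[OF scale(1) p(1) C(1), of Q e, folded R_def]
  have R1: "represents (W \<union> C) R"
    "\<And>w. w \<in> W \<Longrightarrow> free_ends W P2 w - {e} \<subseteq> free_ends (W \<union> C) R w"
    "\<And>c. c \<in> C \<Longrightarrow> path_ends (Q c) - {e} \<subseteq> free_ends (W \<union> C) R c"
    using attach[OF Qv(1) Qv(2) meet meet2 inner1 inner2 e_iff clique adj] by simp_all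
  have "card (free_ends W P w) \<le> card (free_ends (W \<union> C) R w)" if w: "w \<in> W - {p}" for w
  proof -
    have "e \<in> path_points (P2 p)" using e_iff[OF p(1)] by simp
    then have "e \<notin> free_ends W P2 w" using p(1) w unfolding free_ends_def by auto
    then have "free_ends W P2 w \<subseteq> free_ends (W \<union> C) R w" using R1(2)[of w] w by blast
    from card_mono[OF finite_free_ends this] show ?thesis using scale(2) P1(2) by simp
  qed
  moreover have "card (free_ends W P p) \<le> Suc (card (free_ends (W \<union> C) R p))"
  proof -
    have "card (free_ends W P2 p) \<le> Suc (card (free_ends W P2 p - {e}))"
      using diff_card_le_card_Diff[of "{e}" "free_ends W P2 p"] by simp
    moreover have "card (free_ends W P2 p - {e}) \<le> card (free_ends (W \<union> C) R p)"
      by (rule card_mono[OF finite_free_ends R1(2)[OF p(1)]])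
    ultimately show ?thesis using scale(2) P1(2) by simp
  qed
  moreover have "1 \<le> card (free_ends (W \<union> C) R c)" if c: "c \<in> C" for c
  proof -
    have "card (path_ends (Q c)) \<le> Suc (card (path_ends (Q c) - {e}))"
      using diff_card_le_card_Diff[of "{e}" "path_ends (Q c)"] by simp
    then show ?thesis
      using card_mono[OF finite_free_ends R1(3)[OF c]] card_path_ends[OF Qv(1), of c] by linarith
  qed
  moreover have "2 \<le> card (free_ends (W \<union> C) R c)" if c: "c \<in> X" for c
  proof -
    have "e \<notin> path_ends (Q c)" using c unfolding Q_def e_def by simp
    then show ?thesis
      using card_mono[OF finite_free_ends R1(3)[of c]] card_path_ends[OF Qv(1), of c] c C(3) by auto
  qed
  ultimately show ?thesis using R1(1) by blast
qed

text \<open>Starts a new component above everything drawn so far, with both ends free.\<close>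

lemma attach_far:
  assumes rep: "represents W P" and W: "finite W" "v \<notin> W" and adj: "\<And>w. w \<in> W \<Longrightarrow> (v, w) \<notin> E"
  shows "\<exists>R. represents (insert v W) R \<and> 2 \<le> card (free_ends (insert v W) R v)"
proof -
  \<comment> \<open>The element 0 keeps the maximum defined when \<open>W\<close> is empty.\<close>
  define m where "m = Max (insert 0 ((\<lambda>w. y_max (P w)) ` W)) + 1"
  have m: "y_max (P w) < m" if "w \<in> W" for w
  proof -
    have "y_max (P w) \<le> Max (insert 0 ((\<lambda>w. y_max (P w)) ` W))" using W(1) that by (intro Max_ge) auto
    then show ?thesis unfolding m_def by simp
  qed
  define q where "q = Horizontal m 0 1"
  define R where "R = P(v := q)"
  have disj: "path_points q \<inter> path_points (P w) = {}" if "w \<in> W" for w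
    unfolding q_def path_points_box using m[OF that] by auto
  have nc: "noncrossing q (P w)" if w: "w \<in> W" for w
    using m[OF w] representsD(1)[OF rep w] unfolding q_def
    by (cases "P w") (auto simp: noncrossing_simps)
  have touch: "\<not> touching q (P w)" if "w \<in> W" for w using disj[OF that] unfolding touching_def by simp
  have RW: "R w = P w" if "w \<in> W" for w using that W(2) unfolding R_def by auto
  have Rv: "R v = q" unfolding R_def by simp
  have "represents (insert v W) R"
    unfolding represents_def
  proof (intro conjI ballI impI)
    show "valid_grid_path (R w)" if "w \<in> insert v W" for w
      using that representsD(1)[OF rep] RW Rv by (auto simp: q_def)
    fix u w assume uw: "u \<in> insert v W" "w \<in> insert v W" "u \<noteq> w"
    have "noncrossing (R u) (R w) \<and> ((u, w) \<in> E \<longleftrightarrow> touching (R u) (R w))"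
    proof (cases "u = v")
      case True
      then have "w \<in> W" using uw by auto
      then show ?thesis using True nc touch adj RW Rv by simp
    next
      case False
      then have u: "u \<in> W" using uw by auto
      show ?thesis
      proof (cases "w = v")
        case True
        then show ?thesis using u nc[OF u] touch[OF u] adj[OF u] sym_E[of u v] RW[OF u] Rv
            noncrossing_commute[of q] touching_commute[of q] by auto
      next
        case False
        then have w: "w \<in> W" using uw by auto
        then show ?thesis using representsD(2,3)[OF rep u w] uw(3) RW[OF u] RW[OF w] by simp
      qed
    qed
    then show "noncrossing (R u) (R w)" "(u, w) \<in> E \<longleftrightarrow> touching (R u) (R w)" by blast+
  qed
  moreover have "path_ends q \<subseteq> free_ends (insert v W) R v"
  proof
    fix f assume f: "f \<in> path_ends q"
    then have "f \<in> path_points q" unfolding q_def by auto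
    then have "f \<notin> path_points (R w)" if "w \<in> insert v W" "w \<noteq> v" for w
      using disj[of w] RW[of w] that by auto
    then show "f \<in> free_ends (insert v W) R v" using f unfolding free_ends_def Rv by blast
  qed
  then have "2 \<le> card (free_ends (insert v W) R v)"
    using card_mono[OF finite_free_ends, of "path_ends q"] by (simp add: q_def numeral_2_eq_2)
  ultimately show ?thesis by blast
qed

end

section \<open>Representing unobstructed graphs\<close>

context adjacency begin

definition independent :: "'a set \<Rightarrow> bool" where
  "independent X \<longleftrightarrow> (\<forall>x\<in>X. \<forall>y\<in>X. x \<noteq> y \<longrightarrow> (x, y) \<notin> E)"

text \<open>
  The last clause reserves a free end of \<open>w\<close> for every pending block that \<open>w\<close> has to end at: pairwise
  non-adjacent neighbours lie in different blocks.
\<close>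

definition partial_rep :: "'a set \<Rightarrow> 'a set \<Rightarrow> ('a \<Rightarrow> grid_path) \<Rightarrow> bool" where
  "partial_rep U W P \<longleftrightarrow> W \<subseteq> U \<and> represents W P \<and>
     (\<forall>a\<in>W. \<forall>b\<in>W. (a, b) \<in> (Restr E U)\<^sup>* \<longrightarrow> (a, b) \<in> (Restr E W)\<^sup>*) \<and>
     (\<forall>a\<in>W. \<forall>b\<in>W. \<forall>d\<in>U. (a, b) \<in> E \<and> (a, d) \<in> E \<and> (b, d) \<in> E \<longrightarrow> d \<in> W) \<and>
     (\<forall>w\<in>W. \<forall>X \<subseteq> {x \<in> U - W. (w, x) \<in> E \<and> forced U w x}. independent X \<longrightarrow>
        card X \<le> card (free_ends W P w))"

lemma partial_repD:
  assumes "partial_rep U W P"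
  shows "W \<subseteq> U" "represents W P"
    "a \<in> W \<Longrightarrow> b \<in> W \<Longrightarrow> (a, b) \<in> (Restr E U)\<^sup>* \<Longrightarrow> (a, b) \<in> (Restr E W)\<^sup>*"
    "a \<in> W \<Longrightarrow> b \<in> W \<Longrightarrow> d \<in> U \<Longrightarrow> (a, b) \<in> E \<Longrightarrow> (a, d) \<in> E \<Longrightarrow> (b, d) \<in> E \<Longrightarrow> d \<in> W"
    "w \<in> W \<Longrightarrow> X \<subseteq> {x \<in> U - W. (w, x) \<in> E \<and> forced U w x} \<Longrightarrow> independent X \<Longrightarrow>
      card X \<le> card (free_ends W P w)"
proof -
  note h = assms[unfolded partial_rep_def]
  show "W \<subseteq> U" "represents W P" using h by simp_all
  show "a \<in> W \<Longrightarrow> b \<in> W \<Longrightarrow> (a, b) \<in> (Restr E U)\<^sup>* \<Longrightarrow> (a, b) \<in> (Restr E W)\<^sup>*"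
    using h[THEN conjunct2, THEN conjunct2, THEN conjunct1] by simp
  show "a \<in> W \<Longrightarrow> b \<in> W \<Longrightarrow> d \<in> U \<Longrightarrow> (a, b) \<in> E \<Longrightarrow> (a, d) \<in> E \<Longrightarrow> (b, d) \<in> E \<Longrightarrow> d \<in> W"
    using h[THEN conjunct2, THEN conjunct2, THEN conjunct2, THEN conjunct1] by blast
  show "w \<in> W \<Longrightarrow> X \<subseteq> {x \<in> U - W. (w, x) \<in> E \<and> forced U w x} \<Longrightarrow> independent X \<Longrightarrow>
      card X \<le> card (free_ends W P w)"
    using h[THEN conjunct2, THEN conjunct2, THEN conjunct2, THEN conjunct2] by simp
qed

lemma unobstructedD:
  assumes "\<not> obstructed U"
  shows "u \<in> U \<Longrightarrow> \<not> overcommitted U u"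
    "a \<in> U \<Longrightarrow> b \<in> U \<Longrightarrow> c \<in> U \<Longrightarrow> d \<in> U \<Longrightarrow> \<not> diamond a b c d"
    "a \<in> U \<Longrightarrow> b \<in> U \<Longrightarrow> c \<in> U \<Longrightarrow> d \<in> U \<Longrightarrow> e \<in> U \<Longrightarrow> clique4 a b c d \<Longrightarrow>
      (a, e) \<in> E \<Longrightarrow> (b, e) \<in> E \<Longrightarrow> (c, e) \<in> E \<Longrightarrow> (d, e) \<notin> E"
proof -
  note h = assms[unfolded obstructed_def de_Morgan_disj]
  show "u \<in> U \<Longrightarrow> \<not> overcommitted U u" using h[THEN conjunct1] by simp
  show "a \<in> U \<Longrightarrow> b \<in> U \<Longrightarrow> c \<in> U \<Longrightarrow> d \<in> U \<Longrightarrow> \<not> diamond a b c d"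
    using h[THEN conjunct2, THEN conjunct1] by simp
  show "a \<in> U \<Longrightarrow> b \<in> U \<Longrightarrow> c \<in> U \<Longrightarrow> d \<in> U \<Longrightarrow> e \<in> U \<Longrightarrow> clique4 a b c d \<Longrightarrow>
      (a, e) \<in> E \<Longrightarrow> (b, e) \<in> E \<Longrightarrow> (c, e) \<in> E \<Longrightarrow> (d, e) \<notin> E"
    using h[THEN conjunct2, THEN conjunct2] by simp
qed

lemma not_card_le_1:
  assumes "\<not> card X \<le> 1"
  obtains x y where "x \<in> X" "y \<in> X" "x \<noteq> y"
proof -
  have "finite X" using assms by (cases "finite X") auto
  then show ?thesis using assms that card_le_Suc0_iff_eq[of X] by auto
qed

lemma not_card_le_2:
  assumes "\<not> card X \<le> 2"
  obtains x y z where "x \<in> X" "y \<in> X" "z \<in> X" "x \<noteq> y" "x \<noteq> z" "y \<noteq> z"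
proof -
  have "3 \<le> card X" using assms by simp
  then obtain T where "T \<subseteq> X" "card T = 3" by (meson obtain_subset_with_card_n)
  then show ?thesis using that by (auto simp: card_3_iff)
qed

text \<open>Without edges leaving it, \<open>W\<close> is closed under reachability in
  \<open>U\<close>, so \<open>v\<close> may be drawn apart. Two free ends suffice, since three
  pairwise non-adjacent forced neighbours would overcommit \<open>v\<close>.\<close>

lemma extend_partial_rep_far:
  assumes U: "finite U" "\<not> obstructed U"
    and part: "partial_rep U W P" and v: "v \<in> U - W"
    and closed: "\<And>w x. w \<in> W \<Longrightarrow> x \<in> U - W \<Longrightarrow> (w, x) \<notin> E"
  shows "\<exists>R. partial_rep U (insert v W) R"
proof -
  note p = partial_repD[OF part]
  have fin: "finite W" using U(1) p(1) finite_subset by blast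
  have vw: "(v, w) \<notin> E" if "w \<in> W" for w using closed[OF that v] sym_E by blast
  obtain R where R: "represents (insert v W) R" "2 \<le> card (free_ends (insert v W) R v)"
    using attach_far[OF p(2) fin _ vw] v by blast
  have stay: "b \<in> W" if "(a, b) \<in> (Restr E U)\<^sup>*" "a \<in> W" for a b
    using that by (induction rule: rtrancl_induct) (use closed in auto)
  have stay': "a \<in> W" if "(a, b) \<in> (Restr E U)\<^sup>*" "b \<in> W" for a b
    using that by (induction rule: converse_rtrancl_induct) (use closed sym_E in blast)+
  have mono: "(Restr E W)\<^sup>* \<subseteq> (Restr E (insert v W))\<^sup>*" by (rule rtrancl_mono) blast
  have "partial_rep U (insert v W) R"
    unfolding partial_rep_def
  proof (intro conjI ballI allI impI)
    show "insert v W \<subseteq> U" using p(1) v by blast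
    show "represents (insert v W) R" by fact
    show "(a, b) \<in> (Restr E (insert v W))\<^sup>*"
      if ab: "a \<in> insert v W" "b \<in> insert v W" "(a, b) \<in> (Restr E U)\<^sup>*" for a b
    proof (cases "a = b")
      case False
      then have "a \<in> W \<and> b \<in> W" using ab stay[OF ab(3)] stay'[OF ab(3)] v by blast
      then show ?thesis using p(3)[of a b] ab(3) mono by blast
    qed simp
    show "d \<in> insert v W"
      if abd: "a \<in> insert v W" "b \<in> insert v W" "d \<in> U" "(a, b) \<in> E \<and> (a, d) \<in> E \<and> (b, d) \<in> E" for a b d
    proof -
      have "a \<noteq> v" "b \<noteq> v" using abd vw[of a] vw[of b] sym_E[of a v] irrefl_E by auto
      then show ?thesis using p(4)[of a b d] abd by blast
    qed
    show "card X \<le> card (free_ends (insert v W) R w)"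
      if w: "w \<in> insert v W" and X: "X \<subseteq> {x \<in> U - insert v W. (w, x) \<in> E \<and> forced U w x}" "independent X"
      for w X
    proof (cases "w = v")
      case True
      have "card X \<le> 2"
      proof (rule ccontr)
        assume "\<not> card X \<le> 2"
        then obtain x y z where xyz: "x \<in> X" "y \<in> X" "z \<in> X" "x \<noteq> y" "x \<noteq> z" "y \<noteq> z"
          by (rule not_card_le_2)
        have "independent3 x y z" using X(2) xyz unfolding independent_def independent3_def by simp
        moreover have "x \<in> U \<and> (v, x) \<in> E \<and> forced U v x" "y \<in> U \<and> (v, y) \<in> E \<and> forced U v y"
          "z \<in> U \<and> (v, z) \<in> E \<and> forced U v z" using X(1) xyz True by auto
        ultimately have "overcommitted U v" unfolding overcommitted_def by blast
        then show False using unobstructedD(1)[OF U(2)] v by blast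
      qed
      then show ?thesis using R(2) True by simp
    next
      case False
      then have "X = {}" using closed[of w] X(1) w by blast
      then show ?thesis by simp
    qed
  qed
  then show ?thesis by blast
qed


text \<open>The block of \<open>p\<close> and \<open>c\<close> is drawn in one step, because its
  members share a point. The work lies in showing that \<open>p\<close> is its only link to
  \<open>W\<close>, and that enough free ends remain for the obligations of its members.\<close>

lemma extend_partial_rep_block:
  assumes U: "finite U" "\<not> obstructed U" "separating U"
    and part: "partial_rep U W P" and pc: "p \<in> W" "c \<in> U - W" "(p, c) \<in> E"
  shows "\<exists>C R. C \<noteq> {} \<and> C \<inter> W = {} \<and> partial_rep U (W \<union> C) R"
proof -
  note part = partial_repD[OF part]
  note unobs = unobstructedD[OF U(2)]
  \<comment> \<open>The block containing \<open>p\<close> and \<open>c\<close>, without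
    \<open>p\<close>. In the absence of diamonds the common neighbours of \<open>p\<close> and
    \<open>c\<close> form a clique that no further common neighbour of two of its members can
    extend.\<close>
  define C where "C = {x \<in> U. (p, x) \<in> E \<and> (x = c \<or> (c, x) \<in> E)}"
  have cC: "c \<in> C" using pc unfolding C_def by blast
  have CU: "x \<in> U" "(p, x) \<in> E" if "x \<in> C" for x using that unfolding C_def by auto
  have pU: "p \<in> U" using part(1) pc(1) by blast
  have CW: "C \<inter> W = {}"
  proof -
    have False if x: "x \<in> C" "x \<in> W" for x
    proof -
      have "x \<noteq> c" using x(2) pc(2) by blast
      then have "(x, c) \<in> E" using x(1) sym_E unfolding C_def by blast
      then have "c \<in> W" using part(4)[OF pc(1) x(2), of c] CU[OF x(1)] pc by blast
      then show False using pc(2) by blast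
    qed
    then show ?thesis by blast
  qed
  have clique: "(x, y) \<in> E" if "x \<in> C" "y \<in> C" "x \<noteq> y" for x y
  proof (rule ccontr)
    assume no: "(x, y) \<notin> E"
    then have "x \<noteq> c" "y \<noteq> c" using that sym_E[of c x] unfolding C_def by auto
    then have "diamond p c x y" using that no pc unfolding C_def diamond_def by auto
    then show False using unobs(2) pU pc(2) CU[OF that(1)] CU[OF that(2)] by blast
  qed
  have block: "x \<in> C" if d: "d \<in> C" and x: "x \<in> U" "x \<noteq> d" "(p, x) \<in> E" "(d, x) \<in> E" for d x
  proof (rule ccontr)
    assume "x \<notin> C"
    then have nx: "x \<noteq> c" "(c, x) \<notin> E" using x unfolding C_def by auto
    then have "d \<noteq> c" using x by blast
    then have "(d, c) \<in> E" using clique[OF d cC] by blast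
    then have "diamond p d c x" using nx x CU[OF d] pc unfolding diamond_def by auto
    then show False using unobs(2) pU CU(1)[OF d] pc(2) x(1) by blast
  qed
  have out_p: "(p, x) \<notin> E" if "d \<in> C" "x \<in> U" "x \<notin> C" "(d, x) \<in> E" for d x
    using block[of d x] that by auto
  have out_C: "(d', x) \<notin> E" if d: "d \<in> C" "d' \<in> C" "d \<noteq> d'" and x: "x \<in> U" "x \<notin> C" "x \<noteq> p" "(d, x) \<in> E" for d d' x
  proof
    assume dx: "(d', x) \<in> E"
    have "diamond d d' p x"
      using clique[OF d] CU[OF d(1)] CU[OF d(2)] x dx out_p[OF d(1) x(1,2,4)] sym_E[of p d] sym_E[of p d']
      unfolding diamond_def by auto
    then show False using unobs(2) CU(1)[OF d(1)] CU(1)[OF d(2)] pU x(1) by blast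
  qed
  \<comment> \<open>A second neighbour \<open>w\<close> of \<open>d\<close> in \<open>W\<close>
    would be connected with \<open>p\<close> inside \<open>W\<close>, hence without
    \<open>d\<close>; but \<open>d\<close> separates its non-adjacent neighbours \<open>p\<close>
    and \<open>w\<close>. If they are adjacent, closure of \<open>W\<close> under triangles puts
    \<open>d\<close> into \<open>W\<close>.\<close>
  have adj: "(d, w) \<in> E \<longleftrightarrow> w = p" if d: "d \<in> C" and w: "w \<in> W" for d w
  proof
    assume dw: "(d, w) \<in> E"
    show "w = p"
    proof (rule ccontr)
      assume "w \<noteq> p"
      have dW: "d \<notin> W" using d CW by blast
      have wU: "w \<in> U" using part(1) w by blast
      have dp: "(d, p) \<in> E" using CU(2)[OF d] by (rule sym_E)
      have "(p, w) \<notin> E"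
      proof
        assume "(p, w) \<in> E"
        then have "d \<in> W" using part(4)[OF pc(1) w CU(1)[OF d]] CU(2)[OF d] sym_E[OF dw] by blast
        then show False using dW by blast
      qed
      then have "w \<notin> component U d p"
        using separatingD[OF U(3) CU(1)[OF d] pU wU dp dw] \<open>w \<noteq> p\<close> by blast
      moreover have "(p, w) \<in> (Restr E U)\<^sup>*"
      proof (rule rtrancl_into_rtrancl)
        show "(p, d) \<in> (Restr E U)\<^sup>*" using CU[OF d] pU by (intro r_into_rtrancl) blast
        show "(d, w) \<in> Restr E U" using CU[OF d] dw wU by blast
      qed
      then have "(p, w) \<in> (Restr E W)\<^sup>*" using part(3)[OF pc(1) w] by blast
      then have "w \<in> component U d p"
        using rtrancl_mono[of "Restr E W" "Restr E (U - {d})"] part(1) dW unfolding component_def by blast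
      ultimately show False by blast
    qed
  next
    assume "w = p"
    then show "(d, w) \<in> E" using sym_E[OF CU(2)[OF d]] by blast
  qed
  have fin: "finite C" unfolding C_def using U(1) by simp
  \<comment> \<open>Four members together with \<open>p\<close> would be pairwise adjacent.\<close>
  have card3: "card C \<le> 3"
  proof (rule ccontr)
    assume "\<not> card C \<le> 3"
    then have "4 \<le> card C" by simp
    then obtain T where T: "T \<subseteq> C" "card T = 4" "finite T" by (meson obtain_subset_with_card_n)
    obtain l where l: "set l = T" "distinct l" using finite_distinct_list[OF T(3)] by blast
    then have "length l = Suc (Suc (Suc (Suc 0)))" using T(2) distinct_card[of l] by simp
    then obtain d1 d2 d3 d4 where "l = [d1, d2, d3, d4]" by (auto simp: length_Suc_conv)
    then have ds: "{d1, d2, d3, d4} \<subseteq> C"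
      "d1 \<noteq> d2" "d1 \<noteq> d3" "d1 \<noteq> d4" "d2 \<noteq> d3" "d2 \<noteq> d4" "d3 \<noteq> d4"
      using l T(1) by auto
    then have "clique4 d1 d2 d3 d4" unfolding clique4_def using clique by auto
    moreover have "(d, p) \<in> E" if "d \<in> {d1, d2, d3, d4}" for d using adj[of d p] pc ds(1) that by auto
    ultimately show False using unobs(3)[of d1 d2 d3 d4 p] CU(1) ds(1) pU by auto
  qed
  have forced_clique: "forced U x y"
    if C3: "card C = 3" and xy: "x \<in> insert p C" "y \<in> insert p C" "x \<noteq> y" for x y
  proof -
    have "p \<notin> C" using pc(1) CW by blast
    then have "card (insert p C) = 4" using C3 fin by simp
    then have "card (insert p C - {x, y}) = 2" using xy by (subst card_Diff_subset) auto
    then obtain a b where ab: "insert p C - {x, y} = {a, b}" "a \<noteq> b" by (auto simp: card_2_iff)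
    have E: "(a, b) \<in> E" if "a \<in> insert p C" "b \<in> insert p C" "a \<noteq> b" for a b
      using that clique[of a b] CU(2) adj[OF _ pc(1)] by auto
    have "a \<in> insert p C" "b \<in> insert p C" "a \<noteq> x" "a \<noteq> y" "b \<noteq> x" "b \<noteq> y" using ab(1) by blast+
    then have "clique4 x y a b" unfolding clique4_def using E xy ab(2) by simp
    moreover have "insert p C \<subseteq> U" using CU(1) pU by blast
    ultimately show ?thesis
      using \<open>a \<in> insert p C\<close> \<open>b \<in> insert p C\<close> xy by (intro forced.clique[of _ _ _ a b]) blast+
  qed
  define pend where "pend d = {x \<in> U - (W \<union> C). (d, x) \<in> E \<and> forced U d x}" for d
  have pendD: "x \<in> U" "x \<notin> W" "x \<notin> C" "(d, x) \<in> E" "forced U d x" "x \<noteq> p" if "x \<in> pend d" for x d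
    using that pc(1) unfolding pend_def by auto
  have pend_p: "(x, p) \<notin> E \<and> (p, x) \<notin> E" if "d \<in> C" "x \<in> pend d" for d x
    using out_p[OF that(1) pendD(1,3,4)[OF that(2)]] sym_E by blast
  \<comment> \<open>Two pending blocks use up both ends of \<open>d\<close>, so \<open>d\<close> has
    no end left for \<open>p\<close>, and the branching rule applies.\<close>
  have forced_p: "forced U p d"
    if d: "d \<in> C" and xy: "x \<in> pend d" "y \<in> pend d" "x \<noteq> y" "(x, y) \<notin> E" for d x y
  proof (rule forced.branch[OF pU CU(1)[OF d] pendD(1)[OF xy(1)] pendD(1)[OF xy(2)] CU(2)[OF d]
        pendD(4)[OF xy(1)] pendD(4)[OF xy(2)] _ pendD(5)[OF xy(1)] pendD(5)[OF xy(2)]])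
    show "independent3 p x y"
      using pend_p[OF d xy(1)] pend_p[OF d xy(2)] xy pendD(6)[OF xy(1)] pendD(6)[OF xy(2)]
      unfolding independent3_def by auto
  qed
  have card_pend2: "card X \<le> 2" if d: "d \<in> C" and X: "X \<subseteq> pend d" "independent X" for d X
  proof (rule ccontr)
    assume "\<not> card X \<le> 2"
    then obtain x y z where xyz: "x \<in> X" "y \<in> X" "z \<in> X" "x \<noteq> y" "x \<noteq> z" "y \<noteq> z" by (rule not_card_le_2)
    have "independent3 x y z" using X(2) xyz unfolding independent_def independent3_def by simp
    then have "overcommitted U d"
      using pendD[of _ d] X(1) xyz unfolding overcommitted_def by (meson subsetD)
    then show False using unobs(1) CU(1)[OF d] by blast
  qed
  text \<open>
    If no member of the block forces its contact with \<open>p\<close>, then they all end at an inner point of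
    \<open>p\<close>. Otherwise \<open>p\<close> ends at the block, and a member that forces this may pass through.
  \<close>
  have "\<exists>R. represents (W \<union> C) R \<and>
    (\<forall>w\<in>W. \<forall>X\<subseteq>pend w. independent X \<longrightarrow> card X \<le> card (free_ends (W \<union> C) R w)) \<and>
    (\<forall>d\<in>C. \<forall>X\<subseteq>pend d. independent X \<longrightarrow> card X \<le> card (free_ends (W \<union> C) R d))"
  proof (cases "\<exists>t\<in>C. forced U p t")
    case False
    \<comment> \<open>A block of four would force \<open>p\<close> to end there, so at most two
      places at an inner point are needed.\<close>
    have "card C \<noteq> 3" using forced_clique[of p c] False cC pc by auto
    then have "card C \<le> 2" using card3 by linarith
    from attach_inner[OF part(2) pc(1) CW fin this clique adj]
    obtain R where R: "represents (W \<union> C) R"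
      "\<And>w. w \<in> W \<Longrightarrow> card (free_ends W P w) \<le> card (free_ends (W \<union> C) R w)"
      "\<And>d. d \<in> C \<Longrightarrow> 1 \<le> card (free_ends (W \<union> C) R d)" by auto
    have "card X \<le> card (free_ends (W \<union> C) R w)" if "w \<in> W" "X \<subseteq> pend w" "independent X" for w X
    proof -
      have "X \<subseteq> {x \<in> U - W. (w, x) \<in> E \<and> forced U w x}" using that(2) unfolding pend_def by blast
      then show ?thesis using part(5)[OF that(1) _ that(3)] R(2)[OF that(1)] by fastforce
    qed
    moreover have "card X \<le> card (free_ends (W \<union> C) R d)" if d: "d \<in> C" "X \<subseteq> pend d" "independent X" for d X
    proof -
      \<comment> \<open>A second pending block at \<open>d\<close> would force \<open>p\<close> to
        end at \<open>d\<close>, contrary to the case assumption. So one free end per member is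
        enough.\<close>
      have "card X \<le> 1"
      proof (rule ccontr)
        assume "\<not> card X \<le> 1"
        then obtain x y where xy: "x \<in> X" "y \<in> X" "x \<noteq> y" by (rule not_card_le_1)
        then have "(x, y) \<notin> E" using d(3) unfolding independent_def by simp
        then show False using forced_p[OF d(1), of x y] xy d False by blast
      qed
      then show ?thesis using R(3)[OF d(1)] by linarith
    qed
    ultimately show ?thesis using R(1) by blast
  next
    case True
    then obtain t where t: "t \<in> C" "forced U p t" by blast
    \<comment> \<open>With three members all four directions at the end of \<open>p\<close> are
      taken by ends. With fewer there is room for \<open>t\<close> to pass through and keep two free
      ends.\<close>
    define T where "T = (if card C = 3 then {} else {t})"
    have T: "T \<subseteq> C" "card T \<le> 1" "card C + card T \<le> 3" using t card3 unfolding T_def by auto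
    have "{t} \<subseteq> {x \<in> U - W. (p, x) \<in> E \<and> forced U p x}" using t CU[OF t(1)] CW by blast
    then have "card {t} \<le> card (free_ends W P p)"
      by (rule part(5)[OF pc(1)]) (simp add: independent_def)
    then have "free_ends W P p \<noteq> {}" by auto
    from attach_end[OF part(2) pc(1) this CW fin T clique adj]
    obtain R where R: "represents (W \<union> C) R"
      "\<And>w. w \<in> W - {p} \<Longrightarrow> card (free_ends W P w) \<le> card (free_ends (W \<union> C) R w)"
      "card (free_ends W P p) \<le> Suc (card (free_ends (W \<union> C) R p))"
      "\<And>d. d \<in> C \<Longrightarrow> 1 \<le> card (free_ends (W \<union> C) R d)"
      "\<And>d. d \<in> T \<Longrightarrow> 2 \<le> card (free_ends (W \<union> C) R d)" by auto
    have "card X \<le> card (free_ends (W \<union> C) R w)" if w: "w \<in> W" "X \<subseteq> pend w" "independent X" for w X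
    proof (cases "w = p")
      case False
      have "X \<subseteq> {x \<in> U - W. (w, x) \<in> E \<and> forced U w x}" using w(2) unfolding pend_def by blast
      then show ?thesis using part(5)[OF w(1) _ w(3)] R(2)[of w] w(1) False by fastforce
    next
      case True
      have Xp: "x \<in> pend p" if "x \<in> X" for x using that w(2) True by blast
      have tX: "(t, x) \<notin> E" "(x, t) \<notin> E" "x \<noteq> t" if "x \<in> X" for x
      proof -
        have x: "x \<in> U" "x \<notin> C" "(p, x) \<in> E" using pendD[OF Xp[OF that]] by blast+
        then show "x \<noteq> t" using t(1) by blast
        show "(t, x) \<notin> E" using out_p[OF t(1) x(1,2)] x(3) by blast
        then show "(x, t) \<notin> E" using sym_E by blast
      qed
      \<comment> \<open>The end of \<open>p\<close> spent on this block was already reserved: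
        \<open>t\<close> enlarges the pending set \<open>X\<close>, and the old clause bounds the
        enlarged set.\<close>
      have "independent (insert t X)"
        using w(3) tX unfolding independent_def by blast
      moreover have "insert t X \<subseteq> {x \<in> U - W. (p, x) \<in> E \<and> forced U p x}"
        using w(2) True t CU[OF t(1)] CW unfolding pend_def by blast
      ultimately have "card (insert t X) \<le> card (free_ends W P p)" using part(5)[OF pc(1)] by blast
      moreover have "finite X" using finite_subset[OF _ U(1), of X] pendD(1) Xp by blast
      then have "card (insert t X) = Suc (card X)" using tX(3) by (intro card_insert_disjoint) blast+
      ultimately show ?thesis using R(3) unfolding True by linarith
    qed
    moreover have "card X \<le> card (free_ends (W \<union> C) R d)" if d: "d \<in> C" "X \<subseteq> pend d" "independent X" for d X
    proof (cases "d \<in> T")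
      case True
      then show ?thesis using R(5)[OF True] card_pend2[OF d] by linarith
    next
      case dT: False
      have "card X \<le> 1"
      proof (rule ccontr)
        assume "\<not> card X \<le> 1"
        then obtain x y where xy: "x \<in> X" "y \<in> X" "x \<noteq> y" by (rule not_card_le_1)
        have nxy: "(x, y) \<notin> E" using d(3) xy unfolding independent_def by simp
        have px: "x \<in> pend d" and py: "y \<in> pend d" using xy d(2) by blast+
        show False
        proof (cases "card C = 3")
          case True
          \<comment> \<open>In a block of four, \<open>d\<close> spends one end at \<open>p\<close>;
            two pending blocks would then be one too many.\<close>
          have "forced U d p" using forced_clique[OF True, of d p] d(1) pc(1) CW by blast
          moreover have "independent3 p x y"
            using pend_p[OF d(1) px] pend_p[OF d(1) py] xy nxy pendD(6)[OF px] pendD(6)[OF py]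
            unfolding independent3_def by auto
          ultimately have "overcommitted U d"
            unfolding overcommitted_def using pendD[OF px] pendD[OF py] pU adj[OF d(1) pc(1)] by blast
          then show False using unobs(1) CU(1)[OF d(1)] by blast
        next
          case C2: False
          then have "d \<noteq> t" using dT unfolding T_def by simp
          have td: "(t, d) \<in> E" using clique[OF t(1) d(1)] \<open>d \<noteq> t\<close> by blast
          have txy: "(t, x) \<notin> E" "(t, y) \<notin> E" "t \<noteq> x" "t \<noteq> y"
            using out_C[OF d(1) t(1) \<open>d \<noteq> t\<close>] pendD[OF px] pendD[OF py] t(1) by blast+
          \<comment> \<open>Here \<open>d\<close> is a member other than \<open>t\<close>. Its two
            pending blocks would leave it no end for this block, so \<open>t\<close> has to end at
            \<open>d\<close>; the reason for \<open>forced U p t\<close> then overcommits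
            \<open>t\<close>.\<close>
          have "forced U t d"
          proof (rule forced.branch[OF CU(1)[OF t(1)] CU(1)[OF d(1)] pendD(1)[OF px] pendD(1)[OF py] td
                pendD(4)[OF px] pendD(4)[OF py] _ pendD(5)[OF px] pendD(5)[OF py]])
            show "independent3 t x y" using txy xy nxy unfolding independent3_def by blast
          qed
          from t(2) have "overcommitted U t"
          proof cases
            \<comment> \<open>The clique rule would put two more vertices besides \<open>t\<close>
              into \<open>C\<close>, which has fewer than three members.\<close>
            case (clique a b)
            have K: "(t, a) \<in> E" "(t, b) \<in> E" "(p, a) \<in> E" "(p, b) \<in> E" "a \<noteq> b" "t \<noteq> a" "t \<noteq> b"
              using clique(5) irrefl_E unfolding clique4_def by blast+
            then have "{t, a, b} \<subseteq> C" using block[OF t(1)] clique t(1) by blast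
            then have "card {t, a, b} \<le> card C" by (rule card_mono[OF fin])
            then show ?thesis using C2 card3 K by simp
          next
            \<comment> \<open>Both ends of \<open>t\<close> are spent on \<open>y'\<close> and
              \<open>z'\<close>, and \<open>d\<close> would be the third.\<close>
            case (branch y' z')
            have ind: "(p, y') \<notin> E" "(p, z') \<notin> E" "p \<noteq> y'" "p \<noteq> z'" "y' \<noteq> z'" "(y', z') \<notin> E"
              using branch(8) unfolding independent3_def by blast+
            have out: "v \<notin> C \<and> v \<noteq> d \<and> (d, v) \<notin> E" if "v = y' \<or> v = z'" for v
            proof -
              have v: "v \<in> U" "(t, v) \<in> E" "(p, v) \<notin> E" "v \<noteq> p" using that branch ind by blast+
              have "v \<notin> C" using CU(2) v(3) by blast
              then show ?thesis using out_C[OF t(1) d(1)] \<open>d \<noteq> t\<close> v d(1) by blast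
            qed
            have "independent3 d y' z'" using out ind unfolding independent3_def by blast
            then show ?thesis
              unfolding overcommitted_def using branch td \<open>forced U t d\<close> CU(1)[OF d(1)] by blast
          qed
          then show False using unobs(1) CU(1)[OF t(1)] by blast
        qed
      qed
      then show ?thesis using R(4)[OF d(1)] by linarith
    qed
    ultimately show ?thesis using R(1) by blast
  qed
  then obtain R where R: "represents (W \<union> C) R"
    "\<And>w X. w \<in> W \<union> C \<Longrightarrow> X \<subseteq> pend w \<Longrightarrow> independent X \<Longrightarrow> card X \<le> card (free_ends (W \<union> C) R w)"
    by (metis UnE)
  have WU: "W \<union> C \<subseteq> U" using part(1) CU(1) by blast
  \<comment> \<open>Sends members of \<open>C\<close> to their attachment vertex, so that
    connections can be traced inside \<open>W\<close>.\<close>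
  define r where "r a = (if a \<in> W then a else p)" for a
  have r: "r a \<in> W" "(a, r a) \<in> (Restr E (W \<union> C))\<^sup>*" "(r a, a) \<in> (Restr E (W \<union> C))\<^sup>*" if "a \<in> W \<union> C" for a
  proof -
    show "r a \<in> W" using pc(1) unfolding r_def by simp
    have "(a, p) \<in> Restr E (W \<union> C)" "(p, a) \<in> Restr E (W \<union> C)" if "a \<notin> W"
      using that \<open>a \<in> W \<union> C\<close> CU(2)[of a] adj[of a p] pc(1) by blast+
    then show "(a, r a) \<in> (Restr E (W \<union> C))\<^sup>*" "(r a, a) \<in> (Restr E (W \<union> C))\<^sup>*"
      unfolding r_def by (auto intro: r_into_rtrancl)
  qed
  have monoU: "(Restr E (W \<union> C))\<^sup>* \<subseteq> (Restr E U)\<^sup>*" using WU by (intro rtrancl_mono) blast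
  have monoW: "(Restr E W)\<^sup>* \<subseteq> (Restr E (W \<union> C))\<^sup>*" by (intro rtrancl_mono) blast
  have "partial_rep U (W \<union> C) R"
    unfolding partial_rep_def
  proof (intro conjI ballI allI impI)
    show "W \<union> C \<subseteq> U" "represents (W \<union> C) R" by fact+
    show "(a, b) \<in> (Restr E (W \<union> C))\<^sup>*"
      if ab: "a \<in> W \<union> C" "b \<in> W \<union> C" "(a, b) \<in> (Restr E U)\<^sup>*" for a b
    proof -
      have "(r a, r b) \<in> (Restr E U)\<^sup>*"
        using rtrancl_trans[OF rtrancl_trans[OF subsetD[OF monoU r(3)[OF ab(1)]] ab(3)]
            subsetD[OF monoU r(2)[OF ab(2)]]] .
      then have "(r a, r b) \<in> (Restr E (W \<union> C))\<^sup>*"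
        using part(3)[OF r(1)[OF ab(1)] r(1)[OF ab(2)]] monoW by blast
      then show ?thesis
        using rtrancl_trans[OF rtrancl_trans[OF r(2)[OF ab(1)]] r(3)[OF ab(2)]] by blast
    qed
    show "d \<in> W \<union> C"
      if abd: "a \<in> W \<union> C" "b \<in> W \<union> C" "d \<in> U" "(a, b) \<in> E \<and> (a, d) \<in> E \<and> (b, d) \<in> E" for a b d
    proof (rule ccontr)
      assume d: "d \<notin> W \<union> C"
      then have dp: "d \<noteq> p" using pc(1) by blast
      have "a \<noteq> b" using abd irrefl_E by blast
      have mixed: False if x: "x \<in> W" "y \<in> C" "(x, y) \<in> E" "(x, d) \<in> E" "(y, d) \<in> E" for x y
      proof -
        have "x = p" using adj[OF x(2,1)] sym_E[OF x(3)] by blast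
        then show False using out_p[OF x(2) abd(3) _ x(5)] d x(4) by blast
      qed
      consider "a \<in> W" "b \<in> W" | "a \<in> W" "b \<in> C" | "a \<in> C" "b \<in> W" | "a \<in> C" "b \<in> C" using abd by blast
      then show False
      proof cases
        case 1 then show False using part(4)[of a b d] abd d by blast
      next
        case 2 then show False using mixed[of a b] abd by blast
      next
        case 3 then show False using mixed[of b a] abd sym_E[of a b] by blast
      next
        case 4
        then show False using out_C[of a b d] abd \<open>a \<noteq> b\<close> d dp by blast
      qed
    qed
    show "card X \<le> card (free_ends (W \<union> C) R w)"
      if "w \<in> W \<union> C" "X \<subseteq> {x \<in> U - (W \<union> C). (w, x) \<in> E \<and> forced U w x}" "independent X" for w X
      using R(2)[OF that(1) _ that(3)] that(2) unfolding pend_def by blast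
  qed
  then show ?thesis using cC CW by blast
qed

lemma unobstructed_represents:
  assumes U: "finite U" "\<not> obstructed U" "separating U"
  shows "\<exists>P. represents U P"
proof -
  have "\<exists>P. partial_rep U {} P" unfolding partial_rep_def represents_def by simp
  have "\<exists>P. represents U P" if "partial_rep U W P" for W P
    using that
  proof (induction "card (U - W)" arbitrary: W P rule: less_induct)
    case less
    have WU: "W \<subseteq> U" using partial_repD(1)[OF less.prems] .
    have smaller: "card (U - (W \<union> C)) < card (U - W)" if "C \<noteq> {}" "C \<inter> W = {}" "C \<subseteq> U" for C
      using that U(1) by (intro psubset_card_mono) auto
    show ?case
    proof (cases "W = U")
      case True
      then show ?thesis using partial_repD(2)[OF less.prems] by blast
    next
      case False
      then obtain v where v: "v \<in> U - W" using WU by blast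
      have "\<exists>C R. C \<noteq> {} \<and> C \<inter> W = {} \<and> partial_rep U (W \<union> C) R"
      proof (cases "\<exists>p\<in>W. \<exists>c\<in>U - W. (p, c) \<in> E")
        case True
        then show ?thesis using extend_partial_rep_block[OF U less.prems] by blast
      next
        case False
        then obtain R where "partial_rep U (insert v W) R"
          using extend_partial_rep_far[OF U(1,2) less.prems v] by blast
        moreover have "insert v W = W \<union> {v}" by simp
        ultimately have "partial_rep U (W \<union> {v}) R" by metis
        then show ?thesis using v by (intro exI[of _ "{v}"] exI[of _ R]) simp
      qed
      then obtain C R where C: "C \<noteq> {}" "C \<inter> W = {}" "partial_rep U (W \<union> C) R" by blast
      have "C \<subseteq> U" using partial_repD(1)[OF C(3)] by blast
      then show ?thesis using less.hyps[OF smaller C(3)] C(1,2) by blast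
    qed
  qed
  then show ?thesis using \<open>\<exists>P. partial_rep U {} P\<close> by blast
qed

end

lemma contact_B0_VPG_iff_unobstructed:
  assumes G: "pair_graph G" and ch: "chordal G"
  shows "contact_B0_VPG G \<longleftrightarrow> \<not> adjacency.obstructed (parcs G) (pverts G)"
proof
  assume "contact_B0_VPG G"
  then show "\<not> adjacency.obstructed (parcs G) (pverts G)"
    unfolding contact_B0_VPG_def using contact_rep_not_obstructed[OF G] by blast
next
  interpret adjacency "parcs G" using adjacency_parcs[OF G] .
  assume unobs: "\<not> obstructed (pverts G)"
  have "separating (pverts G)"
    using chordal_no_long_induced_cycle[OF G ch] unobstructedD(2)[OF unobs]
    by (rule separating_if_no_induced_cycle)
  moreover have "finite (pverts G)" using G by (simp add: pair_graph_def pair_digraph_def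
      pair_fin_digraph_def pair_fin_digraph_axioms_def)
  ultimately obtain P where "represents (pverts G) P" using unobstructed_represents unobs by blast
  then have "contact_B0_VPG_rep G P"
    unfolding contact_B0_VPG_rep_def represents_def noncrossing_def touching_def by simp
  then show "contact_B0_VPG G" unfolding contact_B0_VPG_def by blast
qed

section \<open>Programs with bounded loops\<close>

definition set_reg :: "vname \<Rightarrow> nat \<Rightarrow> state \<Rightarrow> state" where
  "set_reg x m s = s\<lparr>reg := (reg s)(x := m)\<rparr>"

definition set_cell :: "vname \<Rightarrow> nat \<Rightarrow> nat \<Rightarrow> state \<Rightarrow> state" where
  "set_cell a i m s = s\<lparr>arr := (arr s)(a := (arr s a)(i := m))\<rparr>"

lemma set_reg_simps [simp]:
  "reg (set_reg x m s) y = (if y = x then m else reg s y)"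
  "arr (set_reg x m s) = arr s"
  "set_reg x m (set_reg x k s) = set_reg x m s"
  "set_reg x (reg s x) s = s"
  by (simp_all add: set_reg_def)

lemma set_cell_simps [simp]:
  "reg (set_cell a i m s) = reg s"
  "arr (set_cell a i m s) b j = (if b = a \<and> j = i then m else arr s b j)"
  by (simp_all add: set_cell_def)

lemma exec_Assign: "exec (Assign x e) s (acost e + 1) (set_reg x (aval e s) s)"
  unfolding set_reg_def by (rule exec.Assign)

lemma exec_Store: "exec (Store a e f) s (acost e + acost f + 1) (set_cell a (aval e s) (aval f s) s)"
  unfolding set_cell_def by (rule exec.Store)

text \<open>Programs whose only loops are bounded. They always halt, so their effect is a total
  function \<open>run\<close> and a polynomial bound can be read off the syntax; reasoning about
  \<open>exec\<close> is confined to \<open>exec_compile\<close>.\<close>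

datatype prog =
    PSkip
  | PAssign vname aexp
  | PStore vname aexp aexp
  | PSeq prog prog
  | PIf aexp prog prog
  | PFor vname prog

text \<open>The variable of a loop runs through the numbers below register \<open>n\<close>.\<close>

primrec compile :: "prog \<Rightarrow> com" where
  "compile PSkip = Skip"
| "compile (PAssign x e) = Assign x e"
| "compile (PStore a e f) = Store a e f"
| "compile (PSeq p q) = Seq (compile p) (compile q)"
| "compile (PIf e p q) = If e (compile p) (compile q)"
| "compile (PFor x p) = Seq (Assign x (N 0))
     (While (Minus (V ''n'') (V x)) (Seq (compile p) (Assign x (Plus (V x) (N 1)))))"

text \<open>Setting the loop variable before every pass turns the loop into a fold. This agrees with
  the increment in the compiled code, since a well-formed body leaves the variable alone. The final
  value is the one at which the guard fails.\<close>

primrec run :: "prog \<Rightarrow> state \<Rightarrow> state" where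
  "run PSkip = (\<lambda>s. s)"
| "run (PAssign x e) = (\<lambda>s. set_reg x (aval e s) s)"
| "run (PStore a e f) = (\<lambda>s. set_cell a (aval e s) (aval f s) s)"
| "run (PSeq p q) = (\<lambda>s. run q (run p s))"
| "run (PIf e p q) = (\<lambda>s. if aval e s \<noteq> 0 then run p s else run q s)"
| "run (PFor x p) = (\<lambda>s. set_reg x (reg s ''n'') (fold (\<lambda>i s. run p (set_reg x i s)) [0..<reg s ''n''] s))"

primrec regs :: "prog \<Rightarrow> vname set" where
  "regs PSkip = {}"
| "regs (PAssign x e) = {x}"
| "regs (PStore a e f) = {}"
| "regs (PSeq p q) = regs p \<union> regs q"
| "regs (PIf e p q) = regs p \<union> regs q"
| "regs (PFor x p) = insert x (regs p)"

primrec arrays :: "prog \<Rightarrow> vname set" where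
  "arrays PSkip = {}"
| "arrays (PAssign x e) = {}"
| "arrays (PStore a e f) = {a}"
| "arrays (PSeq p q) = arrays p \<union> arrays q"
| "arrays (PIf e p q) = arrays p \<union> arrays q"
| "arrays (PFor x p) = arrays p"

primrec well_formed :: "prog \<Rightarrow> bool" where
  "well_formed PSkip \<longleftrightarrow> True"
| "well_formed (PAssign x e) \<longleftrightarrow> x \<noteq> ''n''"
| "well_formed (PStore a e f) \<longleftrightarrow> True"
| "well_formed (PSeq p q) \<longleftrightarrow> well_formed p \<and> well_formed q"
| "well_formed (PIf e p q) \<longleftrightarrow> well_formed p \<and> well_formed q"
| "well_formed (PFor x p) \<longleftrightarrow> x \<noteq> ''n'' \<and> x \<notin> regs p \<and> well_formed p"

text \<open>Initialising a loop costs 2 and the failing guard 4, hence 6; every pass adds 4 for the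
  guard and 4 for the increment, hence 8. For a conditional, both branches are added as an upper
  bound. The indeterminate is the value of register \<open>n\<close>, which no well-formed program
  changes.\<close>

primrec cost :: "prog \<Rightarrow> nat poly" where
  "cost PSkip = [:1:]"
| "cost (PAssign x e) = [:acost e + 1:]"
| "cost (PStore a e f) = [:acost e + acost f + 1:]"
| "cost (PSeq p q) = cost p + cost q"
| "cost (PIf e p q) = [:acost e + 1:] + cost p + cost q"
| "cost (PFor x p) = [:6:] + [:0, 1:] * (cost p + [:8:])"

lemma fold_unchanged:
  assumes "\<And>i s. g (f i s) = g s"
  shows "g (fold f xs s) = g s"
  using assms by (induction xs arbitrary: s) auto

lemma reg_run: "x \<notin> regs p \<Longrightarrow> reg (run p s) x = reg s x"
proof (induction p arbitrary: s)
  case (PFor y p)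
  then have "reg (fold (\<lambda>i s. run p (set_reg y i s)) xs s) x = reg s x" for xs
    by (intro fold_unchanged[where g = "\<lambda>s. reg s x"]) auto
  then show ?case using PFor by auto
qed auto

lemma arr_run: "a \<notin> arrays p \<Longrightarrow> arr (run p s) a = arr s a"
proof (induction p arbitrary: s)
  case (PFor y p)
  then have "arr (fold (\<lambda>i s. run p (set_reg y i s)) xs s) a = arr s a" for xs
    by (intro fold_unchanged[where g = "\<lambda>s. arr s a"]) auto
  then show ?case by auto
qed auto

lemma well_formed_regs: "well_formed p \<Longrightarrow> ''n'' \<notin> regs p"
  by (induction p) auto

text \<open>The first pass overwrites the initial value; for the empty list the outer assignment
  does.\<close>

lemma fold_set_reg:
  "set_reg x m (fold (\<lambda>i s. f (set_reg x i s)) xs (set_reg x k s)) =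
   set_reg x m (fold (\<lambda>i s. f (set_reg x i s)) xs s)"
  by (cases xs) auto

lemma exec_loop:
  assumes body: "\<And>s. \<exists>t. exec c s t (f s) \<and> t \<le> T (reg s ''n'')"
    and f: "\<And>s. reg (f s) x = reg s x" "\<And>s. reg (f s) ''n'' = reg s ''n''" and x: "x \<noteq> ''n''"
    and s: "reg s x = i" "reg s ''n'' = m" "m - i = k" "i \<le> m"
  shows "\<exists>t. exec (While (Minus (V ''n'') (V x)) (Seq c (Assign x (Plus (V x) (N 1))))) s t
      (set_reg x m (fold (\<lambda>j s. f (set_reg x j s)) [i..<m] s)) \<and> t \<le> 4 + k * (T m + 8)"
  using s
proof (induction k arbitrary: s i)
  case 0
  then have "i = m" by simp
  moreover have "set_reg x m s = s" using 0(1) \<open>i = m\<close> by auto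
  ultimately show ?case
    using WhileFalse[of "Minus (V ''n'') (V x)" s] 0 by (intro exI[of _ 4]) (simp add: eval_nat_numeral)
next
  case (Suc k)
  then have i: "i < m" by simp
  \<comment> \<open>The variable already holds \<open>i\<close>, so the assignment at the start of
    the first pass changes nothing.\<close>
  have triv: "set_reg x i s = s" using Suc.prems(1) by auto
  obtain t1 where t1: "exec c s t1 (f s)" "t1 \<le> T m" using body[of s] Suc.prems(2) by auto
  let ?s = "set_reg x (Suc i) (f s)"
  have "exec (Assign x (Plus (V x) (N 1))) (f s) 4 ?s"
    using exec_Assign[of x "Plus (V x) (N 1)" "f s"] f(1) Suc.prems(1) by (simp add: eval_nat_numeral)
  with t1(1) have b: "exec (Seq c (Assign x (Plus (V x) (N 1)))) s (t1 + 4) ?s" by (rule Seq)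
  have "reg ?s x = Suc i" "reg ?s ''n'' = m" "m - Suc i = k" "Suc i \<le> m"
    using Suc.prems f x i by simp_all
  from Suc.IH[OF this] obtain t2 where t2:
    "exec (While (Minus (V ''n'') (V x)) (Seq c (Assign x (Plus (V x) (N 1))))) ?s t2
      (set_reg x m (fold (\<lambda>j s. f (set_reg x j s)) [Suc i..<m] ?s))" "t2 \<le> 4 + k * (T m + 8)" by blast
  have "set_reg x m (fold (\<lambda>j s. f (set_reg x j s)) [Suc i..<m] ?s) =
    set_reg x m (fold (\<lambda>j s. f (set_reg x j s)) [i..<m] s)"
    unfolding fold_set_reg using i triv by (simp add: upt_conv_Cons)
  then have t2': "exec (While (Minus (V ''n'') (V x)) (Seq c (Assign x (Plus (V x) (N 1))))) ?s t2
      (set_reg x m (fold (\<lambda>j s. f (set_reg x j s)) [i..<m] s))" using t2(1) by simp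
  have "aval (Minus (V ''n'') (V x)) s \<noteq> 0" using Suc.prems i by simp
  from WhileTrue[OF this b t2'] t1(2) t2(2) show ?case by (intro exI conjI) (assumption, simp)
qed

lemma exec_compile:
  "well_formed p \<Longrightarrow> \<exists>t. exec (compile p) s t (run p s) \<and> t \<le> poly (cost p) (reg s ''n'')"
proof (induction p arbitrary: s)
  case PSkip
  then show ?case using exec.Skip[of s] by (intro exI[of _ 1]) simp
next
  case (PAssign x e)
  then show ?case using exec_Assign[of x e s] by (intro exI[of _ "acost e + 1"]) simp
next
  case (PStore a e f)
  then show ?case using exec_Store[of a e f s] by (intro exI[of _ "acost e + acost f + 1"]) simp
next
  case (PSeq p q)
  obtain t where t: "exec (compile p) s t (run p s)" "t \<le> poly (cost p) (reg s ''n'')"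
    using PSeq.IH(1) PSeq.prems by auto
  obtain u where u: "exec (compile q) (run p s) u (run q (run p s))"
    "u \<le> poly (cost q) (reg (run p s) ''n'')"
    using PSeq.IH(2) PSeq.prems by auto
  have "reg (run p s) ''n'' = reg s ''n''" using PSeq.prems well_formed_regs reg_run by simp
  then show ?case using exec.Seq[OF t(1) u(1)] t(2) u(2) by (intro exI[of _ "t + u"]) simp
next
  case (PIf e p q)
  obtain t where t: "exec (compile p) s t (run p s)" "t \<le> poly (cost p) (reg s ''n'')"
    using PIf.IH(1) PIf.prems by auto
  obtain u where u: "exec (compile q) s u (run q s)" "u \<le> poly (cost q) (reg s ''n'')"
    using PIf.IH(2) PIf.prems by auto
  show ?case
  proof (cases "aval e s \<noteq> 0")
    case True
    then show ?thesis using IfTrue[OF True t(1)] t(2) by (intro exI[of _ "acost e + t + 1"]) simp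
  next
    case False
    then show ?thesis using IfFalse[of e s "compile q" u "run q s"] u by (intro exI[of _ "acost e + u + 1"]) simp
  qed
next
  case (PFor x p)
  let ?m = "reg s ''n''" and ?s = "set_reg x 0 s"
  have wf: "x \<noteq> ''n''" "x \<notin> regs p" "well_formed p" "''n'' \<notin> regs p"
    using PFor.prems well_formed_regs by auto
  have s: "reg ?s x = 0" "reg ?s ''n'' = ?m" "?m - 0 = ?m" "0 \<le> ?m" using wf(1) by simp_all
  obtain t where t: "exec (While (Minus (V ''n'') (V x)) (Seq (compile p) (Assign x (Plus (V x) (N 1))))) ?s t
      (set_reg x ?m (fold (\<lambda>j s. run p (set_reg x j s)) [0..<?m] ?s))"
      "t \<le> 4 + ?m * (poly (cost p) ?m + 8)"
    using exec_loop[OF PFor.IH[OF wf(3)] reg_run[OF wf(2)] reg_run[OF wf(4)] wf(1) s] by auto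
  have "exec (Assign x (N 0)) s 2 ?s" using exec_Assign[of x "N 0" s] by (simp add: numeral_2_eq_2)
  from exec.Seq[OF this t(1)] t(2) show ?case
    unfolding fold_set_reg by (intro exI[of _ "2 + t"]) (simp add: algebra_simps)
qed

lemma run_For_invariant:
  assumes "I 0 s" "reg s ''n'' = m"
    and step: "\<And>i s. i < m \<Longrightarrow> I i s \<Longrightarrow> I (Suc i) (run p (set_reg x i s))"
    and set: "\<And>s. I m s \<Longrightarrow> I m (set_reg x m s)"
  shows "I m (run (PFor x p) s)"
proof -
  have "I k (fold (\<lambda>i s. run p (set_reg x i s)) [0..<k] s)" if "k \<le> m" for k
    using that by (induction k) (auto intro: assms(1) step)
  then show ?thesis using set assms(2) by simp
qed

section \<open>Loops over tuples of vertices\<close>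

definition scan :: "vname list \<Rightarrow> prog \<Rightarrow> prog" where
  "scan xs p = foldr PFor xs p"

lemma scan_simps [simp]:
  "scan [] p = p" "scan (x # xs) p = PFor x (scan xs p)"
  by (simp_all add: scan_def)

text \<open>While \<open>I\<close> holds throughout, \<open>Q vs\<close> is established in the pass
  where the variables carry the values \<open>vs\<close>, and then has to survive all later passes.
  So it holds for all tuples at the end.\<close>

lemma scan_invariant:
  assumes xs: "distinct xs" "set xs \<inter> regs p = {}" "''n'' \<notin> regs p" "''n'' \<notin> set xs"
    and s: "I s" "reg s ''n'' = m"
    and I_set: "\<And>s x k. x \<in> set xs \<Longrightarrow> I s \<Longrightarrow> I (set_reg x k s)"
    and Q_set: "\<And>vs s x k. x \<in> set xs \<Longrightarrow> Q vs s \<Longrightarrow> Q vs (set_reg x k s)"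
    and body: "\<And>s. I s \<Longrightarrow> reg s ''n'' = m \<Longrightarrow> (\<forall>x\<in>set xs. reg s x < m) \<Longrightarrow>
      I (run p s) \<and> Q (map (reg s) xs) (run p s)"
    and stable: "\<And>s vs. I s \<Longrightarrow> reg s ''n'' = m \<Longrightarrow> (\<forall>x\<in>set xs. reg s x < m) \<Longrightarrow> Q vs s \<Longrightarrow> Q vs (run p s)"
  shows "I (run (scan xs p) s) \<and>
    (\<forall>vs. length vs = length xs \<and> set vs \<subseteq> {..<m} \<longrightarrow> Q vs (run (scan xs p) s))"
  using assms
proof (induction xs arbitrary: I Q s)
  case Nil
  then show ?case by simp
next
  case (Cons x xs)
  have x: "x \<notin> set xs" "x \<notin> regs p" "x \<noteq> ''n''" using Cons.prems by auto
  have n: "''n'' \<notin> regs (scan xs p)" using Cons.prems(3,4) by (induction xs) auto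
  \<comment> \<open>All tuples that begin with a value already finished by the outer loop.\<close>
  define before where "before i s \<longleftrightarrow> (\<forall>j<i. \<forall>vs. length vs = length xs \<and> set vs \<subseteq> {..<m} \<longrightarrow> Q (j # vs) s)" for i s
  define J where "J i s \<longleftrightarrow> I s \<and> reg s ''n'' = m \<and> before i s" for i s
  have "J m (run (PFor x (scan xs p)) s)"
  proof (rule run_For_invariant)
    show "J 0 s" using Cons.prems unfolding J_def before_def by simp
    show "reg s ''n'' = m" by fact
    have before_set: "before i (set_reg y k s)" if "y \<in> set (x # xs)" "before i s" for i y k s
      using that Cons.prems(8) unfolding before_def by blast
    show "J m (set_reg x m s)" if "J m s" for s
      using that Cons.prems(7)[of x s m] before_set[of x m s m] x unfolding J_def by simp
    show "J (Suc i) (run (scan xs p) (set_reg x i s))" if i: "i < m" "J i s" for i s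
    proof -
      \<comment> \<open>For the inner loops the outer variable is frozen: its value joins the
        invariant and is prepended in \<open>Q\<close>.\<close>
      let ?I = "\<lambda>s. I s \<and> reg s x = i \<and> before i s" and ?Q = "\<lambda>vs. Q (i # vs)" and ?s = "set_reg x i s"
      have *: "?I (run (scan xs p) ?s) \<and>
        (\<forall>vs. length vs = length xs \<and> set vs \<subseteq> {..<m} \<longrightarrow> ?Q vs (run (scan xs p) ?s))"
      proof (rule Cons.IH)
        show "distinct xs" "set xs \<inter> regs p = {}" "''n'' \<notin> regs p" "''n'' \<notin> set xs"
          using Cons.prems by auto
        show "?I ?s" using i(2) Cons.prems(7)[of x s i] before_set[of x i s i] unfolding J_def by simp
        show "reg ?s ''n'' = m" using i(2) x unfolding J_def by simp
        show "?I (set_reg y k s)" if "y \<in> set xs" "?I s" for s y k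
          using that Cons.prems(7)[of y s k] before_set[of y i s k] x(1) by auto
        show "?Q vs (set_reg y k s)" if "y \<in> set xs" "?Q vs s" for vs s y k
          using that Cons.prems(8) by simp
        show "?I (run p s) \<and> ?Q (map (reg s) xs) (run p s)"
          if h: "?I s" "reg s ''n'' = m" "\<forall>y\<in>set xs. reg s y < m" for s
        proof -
          have lt: "\<forall>y\<in>set (x # xs). reg s y < m" using h i(1) by simp
          have "before i (run p s)"
            using h(1) Cons.prems(10)[OF _ h(2) lt] unfolding before_def by blast
          then show ?thesis using Cons.prems(9)[OF _ h(2) lt] h(1) reg_run[OF x(2)] by simp
        qed
        show "?Q vs (run p s)"
          if h: "?I s" "reg s ''n'' = m" "\<forall>y\<in>set xs. reg s y < m" "?Q vs s" for s vs
          using Cons.prems(10)[OF _ h(2) _ h(4)] h(1,3) i(1) by simp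
      qed
      have "reg (run (scan xs p) ?s) ''n'' = m" using reg_run[OF n] i(2) x unfolding J_def by simp
      moreover have "before (Suc i) (run (scan xs p) ?s)"
        using * unfolding before_def less_Suc_eq by blast
      ultimately show ?thesis using * unfolding J_def by blast
    qed
  qed
  then have "I (run (PFor x (scan xs p)) s)" "before m (run (PFor x (scan xs p)) s)"
    unfolding J_def by blast+
  moreover have "\<exists>j ws. vs = j # ws \<and> j < m \<and> length ws = length xs \<and> set ws \<subseteq> {..<m}"
    if "length vs = length (x # xs)" "set vs \<subseteq> {..<m}" for vs
    using that by (cases vs) auto
  ultimately show ?case unfolding before_def scan_simps by blast
qed

definition PWhen :: "aexp list \<Rightarrow> prog \<Rightarrow> prog" where
  "PWhen es p = foldr (\<lambda>e q. PIf e q PSkip) es p"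

lemma PWhen_simps [simp]:
  "regs (PWhen es p) = regs p" "arrays (PWhen es p) = arrays p" "well_formed (PWhen es p) = well_formed p"
  by (induction es) (simp_all add: PWhen_def)

lemma run_PWhen: "run (PWhen es p) s = (if \<forall>e\<in>set es. aval e s \<noteq> 0 then run p s else s)"
  by (induction es) (auto simp: PWhen_def)

section \<open>Searching for obstructions\<close>

text \<open>The machine cannot multiply, so the offset of a matrix row is looked up in the table
  \<open>row\<close>, which \<open>load_rows\<close> fills by repeated addition.\<close>

definition edge :: "vname \<Rightarrow> vname \<Rightarrow> aexp" where
  "edge x y = Load ''adj'' (Plus (Load ''row'' (V x)) (V y))"

definition non_edge :: "vname \<Rightarrow> vname \<Rightarrow> aexp" where
  "non_edge x y = Minus (N 1) (edge x y)"

text \<open>The absolute difference, as a sum of two truncated differences.\<close>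

definition unequal :: "vname \<Rightarrow> vname \<Rightarrow> aexp" where
  "unequal x y = Plus (Minus (V x) (V y)) (Minus (V y) (V x))"

definition alive :: "vname \<Rightarrow> aexp" where
  "alive x = Load ''subgraph'' (V x)"

definition marked :: "vname \<Rightarrow> vname \<Rightarrow> aexp" where
  "marked x y = Load ''forced'' (Plus (Load ''row'' (V x)) (V y))"

definition set_mark :: "vname \<Rightarrow> vname \<Rightarrow> nat \<Rightarrow> prog" where
  "set_mark x y m = PStore ''forced'' (Plus (Load ''row'' (V x)) (V y)) (N m)"

definition clique4_guard :: "vname \<Rightarrow> vname \<Rightarrow> vname \<Rightarrow> vname \<Rightarrow> aexp list" where
  "clique4_guard a b c d = [edge a b, edge a c, edge a d, edge b c, edge b d, edge c d]"

definition diamond_guard :: "vname \<Rightarrow> vname \<Rightarrow> vname \<Rightarrow> vname \<Rightarrow> aexp list" where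
  "diamond_guard a b c d = [edge a b, edge a c, edge a d, edge b c, edge b d, unequal c d, non_edge c d]"

definition independent3_guard :: "vname \<Rightarrow> vname \<Rightarrow> vname \<Rightarrow> aexp list" where
  "independent3_guard a b c = [unequal a b, unequal a c, unequal b c, non_edge a b, non_edge a c, non_edge b c]"

definition found :: prog where
  "found = PAssign ''found'' (N 1)"

definition clear_marks :: prog where
  "clear_marks = scan [''a'', ''b''] (set_mark ''a'' ''b'' 0)"

definition mark_cliques :: prog where
  "mark_cliques = scan [''a'', ''b'', ''c'', ''d'']
     (PWhen (map alive [''a'', ''b'', ''c'', ''d''] @ clique4_guard ''a'' ''b'' ''c'' ''d'')
        (set_mark ''a'' ''b'' 1))"

definition find_diamond :: prog where
  "find_diamond = scan [''a'', ''b'', ''c'', ''d'']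
     (PWhen (map alive [''a'', ''b'', ''c'', ''d''] @ diamond_guard ''a'' ''b'' ''c'' ''d'') found)"

definition find_K5 :: prog where
  "find_K5 = scan [''a'', ''b'', ''c'', ''d'', ''e'']
     (PWhen (map alive [''a'', ''b'', ''c'', ''d'', ''e''] @ clique4_guard ''a'' ''b'' ''c'' ''d'' @
        [edge ''a'' ''e'', edge ''b'' ''e'', edge ''c'' ''e'', edge ''d'' ''e'']) found)"

definition mark_branches :: prog where
  "mark_branches = scan [''a'', ''b'', ''c'', ''d'']
     (PWhen (map alive [''a'', ''b'', ''c'', ''d''] @ [edge ''a'' ''b'', edge ''b'' ''c'', edge ''b'' ''d''] @
        independent3_guard ''a'' ''c'' ''d'' @ [marked ''b'' ''c'', marked ''b'' ''d''])
        (set_mark ''a'' ''b'' 1))"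

definition find_overcommitted :: prog where
  "find_overcommitted = scan [''a'', ''b'', ''c'', ''d'']
     (PWhen (map alive [''a'', ''b'', ''c'', ''d''] @ [edge ''a'' ''b'', edge ''a'' ''c'', edge ''a'' ''d''] @
        independent3_guard ''b'' ''c'' ''d'' @ [marked ''a'' ''b'', marked ''a'' ''c'', marked ''a'' ''d'']) found)"

text \<open>Runs are repeated on varying vertex sets, so flag and marks are reset first. The
  variables \<open>i\<close> and \<open>j\<close> merely count the rounds, one for each cell of the
  matrix.\<close>

definition search :: prog where
  "search = PSeq (PAssign ''found'' (N 0)) (PSeq clear_marks (PSeq mark_cliques (PSeq find_diamond
     (PSeq find_K5 (PSeq (scan [''i'', ''j''] mark_branches) find_overcommitted)))))"

lemmas program_defs = set_mark_def found_def clear_marks_def mark_cliques_def find_diamond_def find_K5_def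
  mark_branches_def find_overcommitted_def search_def

lemma well_formed_search: "well_formed search"
  by (simp add: program_defs)

lemma regs_search: "regs search = {''found'', ''a'', ''b'', ''c'', ''d'', ''e'', ''i'', ''j''}"
  by (auto simp: program_defs)

lemma arrays_search: "arrays search = {''forced''}"
  by (simp add: program_defs)

lemma returned_set_reg [simp]: "returned_vertices (set_reg x m s) = returned_vertices s"
  by (simp add: returned_vertices_def)

lemma returned_set_cell [simp]:
  "a \<noteq> ''subgraph'' \<Longrightarrow> returned_vertices (set_cell a i m s) = returned_vertices s"
  by (simp add: returned_vertices_def)

lemma cell_index_eq_iff:
  fixes m :: nat
  assumes "v < m" "y < m"
  shows "u * m + v = x * m + y \<longleftrightarrow> u = x \<and> v = y"
proof
  assume eq: "u * m + v = x * m + y"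
  then have "(u * m + v) div m = (x * m + y) div m" "(u * m + v) mod m = (x * m + y) mod m" by simp_all
  then show "u = x \<and> v = y" using assms by simp
qed simp

section \<open>Meaning of the scans and their fixed point\<close>

locale graph_input = adjacency E for E :: "nat rel" +
  fixes m :: nat
  assumes E_bound: "E \<subseteq> {..<m} \<times> {..<m}"
begin

definition loaded :: "state \<Rightarrow> bool" where
  "loaded s \<longleftrightarrow> reg s ''n'' = m \<and> (\<forall>u<m. arr s ''row'' u = u * m) \<and>
     (\<forall>u<m. \<forall>v<m. arr s ''adj'' (u * m + v) = (if (u, v) \<in> E then 1 else 0))"

definition marks :: "state \<Rightarrow> nat rel" where
  "marks s = {(u, v). u < m \<and> v < m \<and> arr s ''forced'' (u * m + v) \<noteq> 0}"

lemma loaded_simps [simp]: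
  "x \<noteq> ''n'' \<Longrightarrow> loaded (set_reg x k s) = loaded s"
  "a \<noteq> ''row'' \<Longrightarrow> a \<noteq> ''adj'' \<Longrightarrow> loaded (set_cell a i k s) = loaded s"
  by (simp_all add: loaded_def)

lemma marks_simps [simp]:
  "marks (set_reg x k s) = marks s"
  "a \<noteq> ''forced'' \<Longrightarrow> marks (set_cell a i k s) = marks s"
  by (simp_all add: marks_def)

lemma marks_bound: "marks s \<subseteq> {..<m} \<times> {..<m}"
  unfolding marks_def by auto

lemma finite_marks: "finite (marks s)"
  using finite_subset[OF marks_bound] by blast

lemma aval_guards:
  assumes "loaded s" "reg s x < m" "reg s y < m"
  shows "aval (edge x y) s \<noteq> 0 \<longleftrightarrow> (reg s x, reg s y) \<in> E"
    "aval (non_edge x y) s \<noteq> 0 \<longleftrightarrow> (reg s x, reg s y) \<notin> E"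
    "aval (marked x y) s \<noteq> 0 \<longleftrightarrow> (reg s x, reg s y) \<in> marks s"
  using assms unfolding edge_def non_edge_def marked_def loaded_def marks_def by auto

lemma aval_unequal: "aval (unequal x y) s \<noteq> 0 \<longleftrightarrow> reg s x \<noteq> reg s y"
  unfolding unequal_def by auto

lemma aval_alive: "aval (alive x) s \<noteq> 0 \<longleftrightarrow> reg s x \<in> returned_vertices s"
  unfolding alive_def returned_vertices_def by simp

lemma marks_set_mark:
  assumes "loaded s" "reg s x < m" "reg s y < m"
  shows "marks (run (set_mark x y k) s) =
    (if k = 0 then marks s - {(reg s x, reg s y)} else insert (reg s x, reg s y) (marks s))"
  using assms unfolding set_mark_def marks_def loaded_def by (auto simp: cell_index_eq_iff)

lemma run_set_mark_simps [simp]: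
  "loaded (run (set_mark x y k) s) = loaded s"
  "reg (run (set_mark x y k) s) = reg s"
  "returned_vertices (run (set_mark x y k) s) = returned_vertices s"
  by (simp_all add: set_mark_def)

lemma run_found [simp]: "run found s = set_reg ''found'' 1 s"
  by (simp add: found_def)

lemma clear_marks_correct:
  assumes "loaded s"
  shows "marks (run clear_marks s) = {}"
proof -
  have n: "reg s ''n'' = m" using assms unfolding loaded_def by simp
  have "loaded (run clear_marks s) \<and> (\<forall>vs. length vs = length [''a'', ''b''] \<and> set vs \<subseteq> {..<m} \<longrightarrow>
      (vs ! 0, vs ! 1) \<notin> marks (run clear_marks s))"
    unfolding clear_marks_def
  proof (rule scan_invariant[where I = loaded and Q = "\<lambda>vs s. (vs ! 0, vs ! 1) \<notin> marks s", OF _ _ _ _ assms n])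
  qed (auto simp: marks_set_mark, auto simp: set_mark_def)
  then have "(u, v) \<notin> marks (run clear_marks s)" if "u < m" "v < m" for u v
    using that by (auto dest: spec[of _ "[u, v]"])
  then show ?thesis using marks_bound by fastforce
qed

definition sound :: "nat set \<Rightarrow> state \<Rightarrow> bool" where
  "sound W s \<longleftrightarrow> loaded s \<and> returned_vertices s = W \<and> marks s \<subseteq> {(u, v). forced W u v} \<and>
     (reg s ''found'' \<noteq> 0 \<longrightarrow> obstructed W)"

lemma sound_set_reg [simp]: "x \<noteq> ''n'' \<Longrightarrow> x \<noteq> ''found'' \<Longrightarrow> sound W (set_reg x k s) = sound W s"
  by (simp add: sound_def)

lemma soundD:
  assumes "sound W s"
  shows "loaded s" "returned_vertices s = W" "marks s \<subseteq> {(u, v). forced W u v}"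
    "reg s ''found'' \<noteq> 0 \<longrightarrow> obstructed W" "reg s ''n'' = m"
  using assms unfolding sound_def loaded_def by simp_all

lemma sound_mark:
  assumes "sound W s" "reg s x < m" "reg s y < m" "forced W (reg s x) (reg s y)"
  shows "sound W (run (set_mark x y 1) s)"
  using assms marks_set_mark[OF soundD(1)[OF assms(1)] assms(2,3), of 1] unfolding sound_def by auto

lemma sound_found: "sound W s \<Longrightarrow> obstructed W \<Longrightarrow> sound W (set_reg ''found'' 1 s)"
  by (simp add: sound_def)

text \<open>The lower bound that complements the upper bound \<open>sound\<close>. The parameter
  \<open>F\<close> carries a success of an earlier stage through the later ones.\<close>

definition at_least :: "nat rel \<Rightarrow> bool \<Rightarrow> state \<Rightarrow> bool" where
  "at_least M F s \<longleftrightarrow> M \<subseteq> marks s \<and> (F \<longrightarrow> reg s ''found'' \<noteq> 0)"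

lemma at_least_set_reg [simp]: "x \<noteq> ''found'' \<Longrightarrow> at_least M F (set_reg x k s) = at_least M F s"
  by (simp add: at_least_def)

lemma at_least_found: "at_least M F s \<Longrightarrow> at_least M F (set_reg ''found'' 1 s)"
  by (simp add: at_least_def)

lemma at_least_mark:
  assumes "at_least M F s" "loaded s" "reg s x < m" "reg s y < m"
  shows "at_least M F (run (set_mark x y 1) s)"
  using assms(1) marks_set_mark[OF assms(2-4), of 1] unfolding at_least_def by auto

text \<open>The two \<open>guard\<close> premises are soundness and completeness of the test. The
  condition \<open>C\<close> sees only the tuple, because marks grow during the scan; completeness
  is measured against the fixed lower bound \<open>M\<close>.\<close>

lemma scan_marking:
  assumes xs: "distinct xs" "''n'' \<notin> set xs" "''found'' \<notin> set xs" "x \<in> set xs" "y \<in> set xs"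
    and s: "sound W s" "at_least M F s"
    and guard: "\<And>s. sound W s \<Longrightarrow> at_least M F s \<Longrightarrow> \<forall>x\<in>set xs. reg s x < m \<Longrightarrow> \<forall>e\<in>set es. aval e s \<noteq> 0 \<Longrightarrow>
        forced W (reg s x) (reg s y)"
      "\<And>s. sound W s \<Longrightarrow> at_least M F s \<Longrightarrow> \<forall>x\<in>set xs. reg s x < m \<Longrightarrow> C (map (reg s) xs) \<Longrightarrow>
        \<forall>e\<in>set es. aval e s \<noteq> 0"
    and res: "\<And>s :: state. res (map (reg s) xs) = (reg s x, reg s y)"
    and t: "t = run (scan xs (PWhen es (set_mark x y 1))) s"
  shows "sound W t \<and> at_least M F t \<and>
    (\<forall>vs. length vs = length xs \<and> set vs \<subseteq> {..<m} \<longrightarrow> C vs \<longrightarrow> res vs \<in> marks t)"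
proof -
  let ?I = "\<lambda>s. sound W s \<and> at_least M F s" and ?Q = "\<lambda>vs s. C vs \<longrightarrow> res vs \<in> marks s"
  have "?I (run (scan xs (PWhen es (set_mark x y 1))) s) \<and>
    (\<forall>vs. length vs = length xs \<and> set vs \<subseteq> {..<m} \<longrightarrow> ?Q vs (run (scan xs (PWhen es (set_mark x y 1))) s))"
  proof (rule scan_invariant)
    show "distinct xs" "''n'' \<notin> set xs" by fact+
    show "set xs \<inter> regs (PWhen es (set_mark x y 1)) = {}" "''n'' \<notin> regs (PWhen es (set_mark x y 1))"
      by (simp_all add: set_mark_def)
    show "?I s" using s by simp
    show "reg s ''n'' = m" using soundD(5)[OF s(1)] .
    show "?I (set_reg z k s)" if "z \<in> set xs" "?I s" for s z k
    proof -
      have "z \<noteq> ''n''" "z \<noteq> ''found''" using that(1) xs by auto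
      then show ?thesis using that(2) by simp
    qed
    show "?Q vs (set_reg z k s)" if "z \<in> set xs" "?Q vs s" for vs s z k using that by simp
    show "?I (run (PWhen es (set_mark x y 1)) s) \<and> ?Q (map (reg s) xs) (run (PWhen es (set_mark x y 1)) s)"
      if h: "?I s" "\<forall>x\<in>set xs. reg s x < m" for s
    proof (cases "\<forall>e\<in>set es. aval e s \<noteq> 0")
      case True
      have lt: "reg s x < m" "reg s y < m" using h(2) xs(4,5) by blast+
      have ld: "loaded s" using h(1) soundD(1) by blast
      have "?I (run (set_mark x y 1) s)"
        using sound_mark[OF _ lt guard(1)[OF _ _ h(2) True]] at_least_mark[OF _ ld lt] h(1) by blast
      moreover have "res (map (reg s) xs) \<in> marks (run (set_mark x y 1) s)"
        using marks_set_mark[OF ld lt, of 1] res by simp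
      ultimately show ?thesis using True by (simp add: run_PWhen)
    next
      case False
      then have "\<not> C (map (reg s) xs)" using guard(2)[OF _ _ h(2)] h(1) by blast
      then show ?thesis using h(1) False by (auto simp: run_PWhen)
    qed
    show "?Q vs (run (PWhen es (set_mark x y 1)) s)"
      if h: "?I s" "\<forall>x\<in>set xs. reg s x < m" "?Q vs s" for s vs
    proof -
      have lt: "reg s x < m" "reg s y < m" using h(2) xs(4,5) by blast+
      have ld: "loaded s" using h(1) soundD(1) by blast
      have "marks s \<subseteq> marks (run (PWhen es (set_mark x y 1)) s)"
        using marks_set_mark[OF ld lt, of 1] by (auto simp: run_PWhen)
      then show ?thesis using h(3) by blast
    qed
  qed
  then show ?thesis unfolding t by blast
qed

lemma scan_finding:
  assumes xs: "distinct xs" "''n'' \<notin> set xs" "''found'' \<notin> set xs"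
    and s: "sound W s" "at_least M F s"
    and guard: "\<And>s. sound W s \<Longrightarrow> at_least M F s \<Longrightarrow> \<forall>x\<in>set xs. reg s x < m \<Longrightarrow> \<forall>e\<in>set es. aval e s \<noteq> 0 \<Longrightarrow>
        obstructed W"
      "\<And>s. sound W s \<Longrightarrow> at_least M F s \<Longrightarrow> \<forall>x\<in>set xs. reg s x < m \<Longrightarrow> C (map (reg s) xs) \<Longrightarrow>
        \<forall>e\<in>set es. aval e s \<noteq> 0"
    and t: "t = run (scan xs (PWhen es found)) s"
  shows "sound W t \<and> at_least M F t \<and>
    (\<forall>vs. length vs = length xs \<and> set vs \<subseteq> {..<m} \<longrightarrow> C vs \<longrightarrow> reg t ''found'' \<noteq> 0)"
proof -
  let ?I = "\<lambda>s. sound W s \<and> at_least M F s" and ?Q = "\<lambda>vs s. C vs \<longrightarrow> reg s ''found'' \<noteq> 0"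
  have "?I (run (scan xs (PWhen es found)) s) \<and>
    (\<forall>vs. length vs = length xs \<and> set vs \<subseteq> {..<m} \<longrightarrow> ?Q vs (run (scan xs (PWhen es found)) s))"
  proof (rule scan_invariant)
    show "distinct xs" "''n'' \<notin> set xs" by fact+
    show "set xs \<inter> regs (PWhen es found) = {}" "''n'' \<notin> regs (PWhen es found)"
      using xs(3) by (simp_all add: found_def)
    show "?I s" using s by simp
    show "reg s ''n'' = m" using soundD(5)[OF s(1)] .
    show "?I (set_reg z k s)" if "z \<in> set xs" "?I s" for s z k
    proof -
      have "z \<noteq> ''n''" "z \<noteq> ''found''" using that(1) xs by auto
      then show ?thesis using that(2) by simp
    qed
    show "?Q vs (set_reg z k s)" if "z \<in> set xs" "?Q vs s" for vs s z k
    proof -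
      have "z \<noteq> ''found''" using that(1) xs by auto
      then show ?thesis using that(2) by simp
    qed
    show "?I (run (PWhen es found) s) \<and> ?Q (map (reg s) xs) (run (PWhen es found) s)"
      if h: "?I s" "\<forall>x\<in>set xs. reg s x < m" for s
    proof (cases "\<forall>e\<in>set es. aval e s \<noteq> 0")
      case True
      have "?I (set_reg ''found'' 1 s)"
        using sound_found[OF _ guard(1)[OF _ _ h(2) True]] at_least_found h(1) by blast
      then show ?thesis using True by (simp add: run_PWhen)
    next
      case False
      then have "\<not> C (map (reg s) xs)" using guard(2)[OF _ _ h(2)] h(1) by blast
      then show ?thesis using h(1) False by (auto simp: run_PWhen)
    qed
    show "?Q vs (run (PWhen es found) s)" if h: "?Q vs s" for s vs
      using h by (simp add: run_PWhen)
  qed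
  then show ?thesis unfolding t by blast
qed


text \<open>One simultaneous application of the branching rule to the contacts in \<open>M\<close>.
  Together with \<open>cliques\<close> this is the monotone operator whose least fixed point is
  \<open>forced W\<close>.\<close>

definition branching :: "nat set \<Rightarrow> nat rel \<Rightarrow> nat rel" where
  "branching W M = {(u, x). \<exists>y z. u \<in> W \<and> x \<in> W \<and> y \<in> W \<and> z \<in> W \<and>
     (u, x) \<in> E \<and> (x, y) \<in> E \<and> (x, z) \<in> E \<and> independent3 u y z \<and> (x, y) \<in> M \<and> (x, z) \<in> M}"

definition cliques :: "nat set \<Rightarrow> nat rel" where
  "cliques W = {(u, x). \<exists>a b. u \<in> W \<and> x \<in> W \<and> a \<in> W \<and> b \<in> W \<and> clique4 u x a b}"

lemma independent3_guard:
  assumes "loaded s" "reg s x < m" "reg s y < m" "reg s z < m"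
  shows "(\<forall>e\<in>set (independent3_guard x y z). aval e s \<noteq> 0) \<longleftrightarrow> independent3 (reg s x) (reg s y) (reg s z)"
  unfolding independent3_guard_def independent3_def list.set ball_simps aval_unequal
  using aval_guards(2)[OF assms(1)] assms(2-4) by auto

lemma clique4_guard:
  assumes "loaded s" "reg s x < m" "reg s y < m" "reg s z < m" "reg s w < m"
  shows "(\<forall>e\<in>set (clique4_guard x y z w). aval e s \<noteq> 0) \<longleftrightarrow> clique4 (reg s x) (reg s y) (reg s z) (reg s w)"
  unfolding clique4_guard_def clique4_def list.set ball_simps
  using aval_guards(1)[OF assms(1)] assms(2-5) by auto

lemma diamond_guard:
  assumes "loaded s" "reg s x < m" "reg s y < m" "reg s z < m" "reg s w < m"
  shows "(\<forall>e\<in>set (diamond_guard x y z w). aval e s \<noteq> 0) \<longleftrightarrow> diamond (reg s x) (reg s y) (reg s z) (reg s w)"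
  unfolding diamond_guard_def diamond_def list.set ball_simps aval_unequal
  using aval_guards(1,2)[OF assms(1)] assms(2-5) by auto

lemmas guard_simps = ball_Un set_append list.map list.set ball_simps aval_alive

lemma marking4:
  fixes s :: state
  assumes s: "sound W s" "at_least M F s"
    and pos: "\<And>s. sound W s \<Longrightarrow> \<forall>x\<in>{''a'', ''b'', ''c'', ''d''}. reg s x < m \<Longrightarrow> \<forall>e\<in>set es. aval e s \<noteq> 0 \<Longrightarrow>
      forced W (reg s ''a'') (reg s ''b'')"
    and neg: "\<And>s. sound W s \<Longrightarrow> at_least M F s \<Longrightarrow> \<forall>x\<in>{''a'', ''b'', ''c'', ''d''}. reg s x < m \<Longrightarrow>
      R (reg s ''a'') (reg s ''b'') (reg s ''c'') (reg s ''d'') \<Longrightarrow> \<forall>e\<in>set es. aval e s \<noteq> 0"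
    and t: "t = run (scan [''a'', ''b'', ''c'', ''d''] (PWhen es (set_mark ''a'' ''b'' 1))) s"
  shows "sound W t \<and> at_least M F t \<and>
    (\<forall>u x y z. u < m \<and> x < m \<and> y < m \<and> z < m \<and> R u x y z \<longrightarrow> (u, x) \<in> marks t)"
proof -
  let ?xs = "[''a'', ''b'', ''c'', ''d'']"
  let ?C = "\<lambda>vs. R (vs ! 0) (vs ! 1) (vs ! 2) (vs ! 3)" and ?res = "\<lambda>vs :: nat list. (vs ! 0, vs ! 1)"
  have 1: "forced W (reg s ''a'') (reg s ''b'')"
    if "sound W s" "at_least M F s" "\<forall>x\<in>set ?xs. reg s x < m" "\<forall>e\<in>set es. aval e s \<noteq> 0" for s
    using pos[OF that(1)] that(3,4) by simp
  have 2: "\<forall>e\<in>set es. aval e s \<noteq> 0"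
    if "sound W s" "at_least M F s" "\<forall>x\<in>set ?xs. reg s x < m" "?C (map (reg s) ?xs)" for s
    using neg[OF that(1,2)] that(3,4) by (simp add: eval_nat_numeral)
  have 3: "?res (map (reg s) ?xs) = (reg s ''a'', reg s ''b'')" for s :: state by simp
  have xs: "distinct ?xs" "''n'' \<notin> set ?xs" "''found'' \<notin> set ?xs" "''a'' \<in> set ?xs" "''b'' \<in> set ?xs"
    by simp_all
  have scan: "sound W t \<and> at_least M F t \<and>
    (\<forall>vs. length vs = length ?xs \<and> set vs \<subseteq> {..<m} \<longrightarrow> ?C vs \<longrightarrow> ?res vs \<in> marks t)"
    by (rule scan_marking[OF xs s 1 2 3 t]; assumption)
  have "(u, x) \<in> marks t" if "u < m" "x < m" "y < m" "z < m" "R u x y z" for u x y z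
    using scan[THEN conjunct2, THEN conjunct2, THEN spec, of "[u, x, y, z]"] that
    by (simp add: eval_nat_numeral)
  then show ?thesis using scan by blast
qed

lemma finding4:
  fixes s :: state
  assumes s: "sound W s" "at_least M F s"
    and pos: "\<And>s. sound W s \<Longrightarrow> \<forall>x\<in>{''a'', ''b'', ''c'', ''d''}. reg s x < m \<Longrightarrow> \<forall>e\<in>set es. aval e s \<noteq> 0 \<Longrightarrow>
      obstructed W"
    and neg: "\<And>s. sound W s \<Longrightarrow> at_least M F s \<Longrightarrow> \<forall>x\<in>{''a'', ''b'', ''c'', ''d''}. reg s x < m \<Longrightarrow>
      R (reg s ''a'') (reg s ''b'') (reg s ''c'') (reg s ''d'') \<Longrightarrow> \<forall>e\<in>set es. aval e s \<noteq> 0"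
    and t: "t = run (scan [''a'', ''b'', ''c'', ''d''] (PWhen es found)) s"
  shows "sound W t \<and> at_least M F t \<and>
    (\<forall>u x y z. u < m \<and> x < m \<and> y < m \<and> z < m \<and> R u x y z \<longrightarrow> reg t ''found'' \<noteq> 0)"
proof -
  let ?xs = "[''a'', ''b'', ''c'', ''d'']"
  let ?C = "\<lambda>vs. R (vs ! 0) (vs ! 1) (vs ! 2) (vs ! 3)"
  have 1: "obstructed W"
    if "sound W s" "at_least M F s" "\<forall>x\<in>set ?xs. reg s x < m" "\<forall>e\<in>set es. aval e s \<noteq> 0" for s
    using pos[OF that(1)] that(3,4) by simp
  have 2: "\<forall>e\<in>set es. aval e s \<noteq> 0"
    if "sound W s" "at_least M F s" "\<forall>x\<in>set ?xs. reg s x < m" "?C (map (reg s) ?xs)" for s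
    using neg[OF that(1,2)] that(3,4) by (simp add: eval_nat_numeral)
  have xs: "distinct ?xs" "''n'' \<notin> set ?xs" "''found'' \<notin> set ?xs" by simp_all
  have scan: "sound W t \<and> at_least M F t \<and>
    (\<forall>vs. length vs = length ?xs \<and> set vs \<subseteq> {..<m} \<longrightarrow> ?C vs \<longrightarrow> reg t ''found'' \<noteq> 0)"
    by (rule scan_finding[OF xs s 1 2 t]; assumption)
  have "reg t ''found'' \<noteq> 0" if "u < m" "x < m" "y < m" "z < m" "R u x y z" for u x y z
    using scan[THEN conjunct2, THEN conjunct2, THEN spec, of "[u, x, y, z]"] that
    by (simp add: eval_nat_numeral)
  then show ?thesis using scan by blast
qed

lemma mark_cliques_correct:
  assumes s: "sound W s" and W: "W \<subseteq> {..<m}"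
  shows "sound W (run mark_cliques s)" "cliques W \<subseteq> marks (run mark_cliques s)"
proof -
  let ?R = "\<lambda>u x a b. u \<in> W \<and> x \<in> W \<and> a \<in> W \<and> b \<in> W \<and> clique4 u x a b"
  let ?es = "map alive [''a'', ''b'', ''c'', ''d''] @ clique4_guard ''a'' ''b'' ''c'' ''d''"
  have iff: "(\<forall>e\<in>set ?es. aval e s \<noteq> 0) \<longleftrightarrow> ?R (reg s ''a'') (reg s ''b'') (reg s ''c'') (reg s ''d'')"
    if h: "sound W s" "\<forall>x\<in>{''a'', ''b'', ''c'', ''d''}. reg s x < m" for s
    using h(2) unfolding guard_simps soundD(2)[OF h(1)]
    by (simp add: clique4_guard[OF soundD(1)[OF h(1)]] del: neq0_conv)
  have a0: "at_least {} False s" unfolding at_least_def by simp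
  have pos: "forced W (reg s ''a'') (reg s ''b'')"
    if "sound W s" "\<forall>x\<in>{''a'', ''b'', ''c'', ''d''}. reg s x < m" "\<forall>e\<in>set ?es. aval e s \<noteq> 0" for s
    using iff[OF that(1,2)] that(3) forced.clique[of "reg s ''a''" W] by blast
  have neg: "\<forall>e\<in>set ?es. aval e s \<noteq> 0"
    if "sound W s" "\<forall>x\<in>{''a'', ''b'', ''c'', ''d''}. reg s x < m"
      "?R (reg s ''a'') (reg s ''b'') (reg s ''c'') (reg s ''d'')" for s
    using iff[OF that(1,2)] that(3) by blast
  let ?t = "run mark_cliques s"
  have t: "?t = run (scan [''a'', ''b'', ''c'', ''d''] (PWhen ?es (set_mark ''a'' ''b'' 1))) s"
    unfolding mark_cliques_def ..
  have scan: "sound W ?t \<and> at_least {} False ?t \<and>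
    (\<forall>u x y z. u < m \<and> x < m \<and> y < m \<and> z < m \<and> ?R u x y z \<longrightarrow> (u, x) \<in> marks ?t)"
    by (rule marking4[OF s a0 pos neg t]; assumption)
  show "sound W (run mark_cliques s)" using scan by blast
  have "(u, x) \<in> marks (run mark_cliques s)" if "?R u x a b" for u x a b
    using scan that W by blast
  then show "cliques W \<subseteq> marks (run mark_cliques s)" unfolding cliques_def by blast
qed

lemma find_diamond_correct:
  assumes s: "sound W s" "at_least M F s" and W: "W \<subseteq> {..<m}"
  shows "sound W (run find_diamond s)" "at_least M F (run find_diamond s)"
    "\<And>a b c d. a \<in> W \<Longrightarrow> b \<in> W \<Longrightarrow> c \<in> W \<Longrightarrow> d \<in> W \<Longrightarrow> diamond a b c d \<Longrightarrow> reg (run find_diamond s) ''found'' \<noteq> 0"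
proof -
  let ?R = "\<lambda>u x a b. u \<in> W \<and> x \<in> W \<and> a \<in> W \<and> b \<in> W \<and> diamond u x a b"
  let ?es = "map alive [''a'', ''b'', ''c'', ''d''] @ diamond_guard ''a'' ''b'' ''c'' ''d''"
  have iff: "(\<forall>e\<in>set ?es. aval e s \<noteq> 0) \<longleftrightarrow> ?R (reg s ''a'') (reg s ''b'') (reg s ''c'') (reg s ''d'')"
    if h: "sound W s" "\<forall>x\<in>{''a'', ''b'', ''c'', ''d''}. reg s x < m" for s
    using h(2) unfolding guard_simps soundD(2)[OF h(1)]
    by (simp add: diamond_guard[OF soundD(1)[OF h(1)]] del: neq0_conv)
  have pos: "obstructed W"
    if "sound W s" "\<forall>x\<in>{''a'', ''b'', ''c'', ''d''}. reg s x < m" "\<forall>e\<in>set ?es. aval e s \<noteq> 0" for s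
    using iff[OF that(1,2)] that(3) unfolding obstructed_def by blast
  have neg: "\<forall>e\<in>set ?es. aval e s \<noteq> 0"
    if "sound W s" "\<forall>x\<in>{''a'', ''b'', ''c'', ''d''}. reg s x < m"
      "?R (reg s ''a'') (reg s ''b'') (reg s ''c'') (reg s ''d'')" for s
    using iff[OF that(1,2)] that(3) by blast
  let ?t = "run find_diamond s"
  have t: "?t = run (scan [''a'', ''b'', ''c'', ''d''] (PWhen ?es found)) s"
    unfolding find_diamond_def ..
  have scan: "sound W ?t \<and> at_least M F ?t \<and>
    (\<forall>u x y z. u < m \<and> x < m \<and> y < m \<and> z < m \<and> ?R u x y z \<longrightarrow> reg ?t ''found'' \<noteq> 0)"
    by (rule finding4[OF s pos neg t]; assumption)
  show "sound W (run find_diamond s)" "at_least M F (run find_diamond s)" using scan by blast+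
  show "reg (run find_diamond s) ''found'' \<noteq> 0" if "a \<in> W" "b \<in> W" "c \<in> W" "d \<in> W" "diamond a b c d" for a b c d
    using scan that W by blast
qed

lemma find_K5_correct:
  assumes s: "sound W s" "at_least M F s" and W: "W \<subseteq> {..<m}"
  shows "sound W (run find_K5 s)" "at_least M F (run find_K5 s)"
    "\<And>a b c d e. a \<in> W \<Longrightarrow> b \<in> W \<Longrightarrow> c \<in> W \<Longrightarrow> d \<in> W \<Longrightarrow> e \<in> W \<Longrightarrow> clique4 a b c d \<Longrightarrow>
      (a, e) \<in> E \<Longrightarrow> (b, e) \<in> E \<Longrightarrow> (c, e) \<in> E \<Longrightarrow> (d, e) \<in> E \<Longrightarrow> reg (run find_K5 s) ''found'' \<noteq> 0"
proof -
  let ?xs = "[''a'', ''b'', ''c'', ''d'', ''e'']"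
  let ?R = "\<lambda>a b c d e. a \<in> W \<and> b \<in> W \<and> c \<in> W \<and> d \<in> W \<and> e \<in> W \<and> clique4 a b c d \<and>
    (a, e) \<in> E \<and> (b, e) \<in> E \<and> (c, e) \<in> E \<and> (d, e) \<in> E"
  let ?C = "\<lambda>vs. ?R (vs ! 0) (vs ! 1) (vs ! 2) (vs ! 3) (vs ! 4)"
  let ?es = "map alive ?xs @ clique4_guard ''a'' ''b'' ''c'' ''d'' @
    [edge ''a'' ''e'', edge ''b'' ''e'', edge ''c'' ''e'', edge ''d'' ''e'']"
  have iff: "(\<forall>e\<in>set ?es. aval e s \<noteq> 0) \<longleftrightarrow>
      ?R (reg s ''a'') (reg s ''b'') (reg s ''c'') (reg s ''d'') (reg s ''e'')"
    if h: "sound W s" "\<forall>x\<in>set ?xs. reg s x < m" for s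
    using h(2) unfolding guard_simps soundD(2)[OF h(1)]
    by (simp add: clique4_guard[OF soundD(1)[OF h(1)]] aval_guards(1)[OF soundD(1)[OF h(1)]] del: neq0_conv)
  have pos: "obstructed W"
    if "sound W s" "at_least M F s" "\<forall>x\<in>set ?xs. reg s x < m" "\<forall>e\<in>set ?es. aval e s \<noteq> 0" for s
    using iff[OF that(1,3)] that(4) unfolding obstructed_def by blast
  have neg: "\<forall>e\<in>set ?es. aval e s \<noteq> 0"
    if h: "sound W s" "at_least M F s" "\<forall>x\<in>set ?xs. reg s x < m" "?C (map (reg s) ?xs)" for s
  proof -
    have "?R (reg s ''a'') (reg s ''b'') (reg s ''c'') (reg s ''d'') (reg s ''e'')"
      using h(4) by (simp add: eval_nat_numeral)
    then show ?thesis using iff[OF h(1,3)] by blast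
  qed
  have xs: "distinct ?xs" "''n'' \<notin> set ?xs" "''found'' \<notin> set ?xs" by simp_all
  let ?t = "run find_K5 s"
  have t: "?t = run (scan ?xs (PWhen ?es found)) s" unfolding find_K5_def ..
  have scan: "sound W ?t \<and> at_least M F ?t \<and>
    (\<forall>vs. length vs = length ?xs \<and> set vs \<subseteq> {..<m} \<longrightarrow> ?C vs \<longrightarrow> reg ?t ''found'' \<noteq> 0)"
    by (rule scan_finding[OF xs s pos neg t]; assumption)
  show "sound W (run find_K5 s)" "at_least M F (run find_K5 s)" using scan by blast+
  show "reg (run find_K5 s) ''found'' \<noteq> 0"
    if "a \<in> W" "b \<in> W" "c \<in> W" "d \<in> W" "e \<in> W" "clique4 a b c d"
      "(a, e) \<in> E" "(b, e) \<in> E" "(c, e) \<in> E" "(d, e) \<in> E" for a b c d e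
    using scan[THEN conjunct2, THEN conjunct2, THEN spec, of "[a, b, c, d, e]"] that W
    by (auto simp: eval_nat_numeral)
qed

text \<open>A scan already uses the marks that it has just set, so it may derive more than one step
  of \<open>branching\<close>. Soundness refers to the current marks, completeness to the marks
  \<open>M\<close> present at the start.\<close>

lemma mark_branches_correct:
  assumes s: "sound W s" "at_least M F s" and W: "W \<subseteq> {..<m}"
  shows "sound W (run mark_branches s)" "at_least M F (run mark_branches s)"
    "branching W M \<subseteq> marks (run mark_branches s)"
proof -
  let ?R = "\<lambda>M u x y z. u \<in> W \<and> x \<in> W \<and> y \<in> W \<and> z \<in> W \<and>
     (u, x) \<in> E \<and> (x, y) \<in> E \<and> (x, z) \<in> E \<and> independent3 u y z \<and> (x, y) \<in> M \<and> (x, z) \<in> M"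
  let ?es = "map alive [''a'', ''b'', ''c'', ''d''] @ [edge ''a'' ''b'', edge ''b'' ''c'', edge ''b'' ''d''] @
        independent3_guard ''a'' ''c'' ''d'' @ [marked ''b'' ''c'', marked ''b'' ''d'']"
  have iff: "(\<forall>e\<in>set ?es. aval e s \<noteq> 0) \<longleftrightarrow>
      ?R (marks s) (reg s ''a'') (reg s ''b'') (reg s ''c'') (reg s ''d'')"
    if h: "sound W s" "\<forall>x\<in>{''a'', ''b'', ''c'', ''d''}. reg s x < m" for s
    using h(2) unfolding guard_simps soundD(2)[OF h(1)]
    by (simp add: independent3_guard[OF soundD(1)[OF h(1)]] aval_guards[OF soundD(1)[OF h(1)]] del: neq0_conv)
  have pos: "forced W (reg s ''a'') (reg s ''b'')"
    if h: "sound W s" "\<forall>x\<in>{''a'', ''b'', ''c'', ''d''}. reg s x < m" "\<forall>e\<in>set ?es. aval e s \<noteq> 0" for s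
  proof -
    have R: "?R (marks s) (reg s ''a'') (reg s ''b'') (reg s ''c'') (reg s ''d'')"
      using iff[OF h(1,2)] h(3) by blast
    then have "forced W (reg s ''b'') (reg s ''c'')" "forced W (reg s ''b'') (reg s ''d'')"
      using soundD(3)[OF h(1)] by blast+
    then show ?thesis using R forced.branch[of "reg s ''a''" W] by blast
  qed
  have neg: "\<forall>e\<in>set ?es. aval e s \<noteq> 0"
    if h: "sound W s" "at_least M F s" "\<forall>x\<in>{''a'', ''b'', ''c'', ''d''}. reg s x < m"
      "?R M (reg s ''a'') (reg s ''b'') (reg s ''c'') (reg s ''d'')" for s
    using iff[OF h(1,3)] h(2,4) unfolding at_least_def by blast
  let ?t = "run mark_branches s"
  have t: "?t = run (scan [''a'', ''b'', ''c'', ''d''] (PWhen ?es (set_mark ''a'' ''b'' 1))) s"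
    unfolding mark_branches_def ..
  have scan: "sound W ?t \<and> at_least M F ?t \<and>
    (\<forall>u x y z. u < m \<and> x < m \<and> y < m \<and> z < m \<and> ?R M u x y z \<longrightarrow> (u, x) \<in> marks ?t)"
    by (rule marking4[OF s pos neg t]; assumption)
  show "sound W (run mark_branches s)" "at_least M F (run mark_branches s)" using scan by blast+
  have "(u, x) \<in> marks (run mark_branches s)" if "?R M u x y z" for u x y z
    using scan that W by blast
  then show "branching W M \<subseteq> marks (run mark_branches s)" unfolding branching_def by blast
qed

lemma find_overcommitted_correct:
  assumes s: "sound W s" "at_least M F s" and W: "W \<subseteq> {..<m}" and M: "{(u, v). forced W u v} \<subseteq> M"
  shows "sound W (run find_overcommitted s)" "at_least M F (run find_overcommitted s)"
    "\<And>u. u \<in> W \<Longrightarrow> overcommitted W u \<Longrightarrow> reg (run find_overcommitted s) ''found'' \<noteq> 0"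
proof -
  let ?R = "\<lambda>M u x y z. u \<in> W \<and> x \<in> W \<and> y \<in> W \<and> z \<in> W \<and>
     (u, x) \<in> E \<and> (u, y) \<in> E \<and> (u, z) \<in> E \<and> independent3 x y z \<and> (u, x) \<in> M \<and> (u, y) \<in> M \<and> (u, z) \<in> M"
  let ?es = "map alive [''a'', ''b'', ''c'', ''d''] @ [edge ''a'' ''b'', edge ''a'' ''c'', edge ''a'' ''d''] @
        independent3_guard ''b'' ''c'' ''d'' @ [marked ''a'' ''b'', marked ''a'' ''c'', marked ''a'' ''d'']"
  have iff: "(\<forall>e\<in>set ?es. aval e s \<noteq> 0) \<longleftrightarrow>
      ?R (marks s) (reg s ''a'') (reg s ''b'') (reg s ''c'') (reg s ''d'')"
    if h: "sound W s" "\<forall>x\<in>{''a'', ''b'', ''c'', ''d''}. reg s x < m" for s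
    using h(2) unfolding guard_simps soundD(2)[OF h(1)]
    by (simp add: independent3_guard[OF soundD(1)[OF h(1)]] aval_guards[OF soundD(1)[OF h(1)]] del: neq0_conv)
  have pos: "obstructed W"
    if h: "sound W s" "\<forall>x\<in>{''a'', ''b'', ''c'', ''d''}. reg s x < m" "\<forall>e\<in>set ?es. aval e s \<noteq> 0" for s
  proof -
    have R: "?R (marks s) (reg s ''a'') (reg s ''b'') (reg s ''c'') (reg s ''d'')"
      using iff[OF h(1,2)] h(3) by blast
    then have "forced W (reg s ''a'') (reg s ''b'')" "forced W (reg s ''a'') (reg s ''c'')"
      "forced W (reg s ''a'') (reg s ''d'')"
      using soundD(3)[OF h(1)] by blast+
    then have "overcommitted W (reg s ''a'')" using R unfolding overcommitted_def by blast
    then show ?thesis using R unfolding obstructed_def by blast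
  qed
  have neg: "\<forall>e\<in>set ?es. aval e s \<noteq> 0"
    if h: "sound W s" "at_least M F s" "\<forall>x\<in>{''a'', ''b'', ''c'', ''d''}. reg s x < m"
      "?R M (reg s ''a'') (reg s ''b'') (reg s ''c'') (reg s ''d'')" for s
    using iff[OF h(1,3)] h(2,4) unfolding at_least_def by blast
  let ?t = "run find_overcommitted s"
  have t: "?t = run (scan [''a'', ''b'', ''c'', ''d''] (PWhen ?es found)) s"
    unfolding find_overcommitted_def ..
  have scan: "sound W ?t \<and> at_least M F ?t \<and>
    (\<forall>u x y z. u < m \<and> x < m \<and> y < m \<and> z < m \<and> ?R M u x y z \<longrightarrow> reg ?t ''found'' \<noteq> 0)"
    by (rule finding4[OF s pos neg t]; assumption)
  show "sound W (run find_overcommitted s)" "at_least M F (run find_overcommitted s)" using scan by blast+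
  show "reg (run find_overcommitted s) ''found'' \<noteq> 0" if u: "u \<in> W" "overcommitted W u" for u
  proof -
    obtain x y z where "?R M u x y z" using u M unfolding overcommitted_def by blast
    then show ?thesis using scan W by blast
  qed
qed

text \<open>Leastness of \<open>forced\<close>: marks that contain the cliques and are stable under
  a round already contain all forced contacts.\<close>

lemma forced_subset_if_closed:
  assumes "cliques W \<subseteq> M" "branching W M \<subseteq> M"
  shows "{(u, v). forced W u v} \<subseteq> M"
proof -
  have "(u, v) \<in> M" if "forced W u v" for u v
    using that
  proof (induction rule: forced.induct)
    case (clique u x a b)
    then have "(u, x) \<in> cliques W" unfolding cliques_def by blast
    then show ?case using assms(1) by blast
  next
    case (branch u x y z)
    then have "(u, x) \<in> branching W M" unfolding branching_def by blast
    then show ?case using assms(2) by blast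
  qed
  then show ?thesis by blast
qed

text \<open>
  A round that adds no mark has reached the fixed point, so one round for each possible mark suffices.
\<close>

lemma mark_rounds_correct:
  assumes s: "sound W s" "at_least (cliques W) F s" and W: "W \<subseteq> {..<m}"
  defines "t \<equiv> run (scan [''i'', ''j''] mark_branches) s"
  shows "sound W t" "at_least {(u, v). forced W u v} F t"
proof -
  let ?REQ = "{(u, v). forced W u v}"
  \<comment> \<open>Here \<open>k\<close> counts rounds: as long as the marks are incomplete, every
    round so far has added at least one.\<close>
  define J where "J k s \<longleftrightarrow> sound W s \<and> at_least (cliques W) F s \<and> (k \<le> card (marks s) \<or> ?REQ \<subseteq> marks s)" for k s
  have J_set: "J k (set_reg x i s)" if "J k s" "x \<noteq> ''n''" "x \<noteq> ''found''" for k x i s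
    using that unfolding J_def by simp
  have round: "J (Suc k) (run mark_branches s)" if h: "J k s" for k s
  proof -
    \<comment> \<open>The lower bound is raised to all present marks, so that a round without a new
      mark proves them closed.\<close>
    have h': "sound W s" "at_least (cliques W \<union> marks s) F s" using h unfolding J_def at_least_def by auto
    note b = mark_branches_correct[OF h' W]
    have le: "marks s \<subseteq> marks (run mark_branches s)" using b(2) unfolding at_least_def by blast
    have "Suc k \<le> card (marks (run mark_branches s)) \<or> ?REQ \<subseteq> marks (run mark_branches s)"
    proof (cases "marks (run mark_branches s) = marks s")
      case True
      have "branching W (marks s) \<subseteq> branching W (cliques W \<union> marks s)" unfolding branching_def by blast
      then have "branching W (marks s) \<subseteq> marks s" using b(3) True by blast
      moreover have "cliques W \<subseteq> marks s" using h unfolding J_def at_least_def by blast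
      ultimately show ?thesis using forced_subset_if_closed True by blast
    next
      case False
      then have "card (marks s) < card (marks (run mark_branches s))"
        using le finite_marks by (intro psubset_card_mono) auto
      then show ?thesis using h le unfolding J_def by auto
    qed
    moreover have "at_least (cliques W) F (run mark_branches s)" using b(2) unfolding at_least_def by blast
    ultimately show ?thesis using b(1) unfolding J_def by blast
  qed
  have n: "reg s ''n'' = m" if "J k s" for k s using that soundD(5) unfolding J_def by blast
  have inner: "J (i * m + m) (run (PFor ''j'' mark_branches) s)" if h: "J (i * m) s" for i s
  proof (rule run_For_invariant[where I = "\<lambda>j. J (i * m + j)", OF _ n[OF h]])
    show "J (i * m + 0) s" using h by simp
    show "J (i * m + Suc j) (run mark_branches (set_reg ''j'' j s))" if "J (i * m + j) s" for j s
      using round[OF J_set[OF that, of "''j''" j]] by simp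
    show "J (i * m + m) (set_reg ''j'' m s)" if "J (i * m + m) s" for s
      using J_set[OF that, of "''j''" m] by simp
  qed
  have J0: "J 0 s" using s unfolding J_def by simp
  have "J (m * m) (run (PFor ''i'' (PFor ''j'' mark_branches)) s)"
  proof (rule run_For_invariant[where I = "\<lambda>i. J (i * m)", OF _ n[OF J0]])
    show "J (0 * m) s" using J0 by simp
    show "J (Suc i * m) (run (PFor ''j'' mark_branches) (set_reg ''i'' i s))" if "J (i * m) s" for i s
      using inner[OF J_set[OF that, of "''i''" i]] by (simp add: add.commute)
    show "J (m * m) (set_reg ''i'' m s)" if "J (m * m) s" for s
      using J_set[OF that, of "''i''" m] by simp
  qed
  then have Jt: "J (m * m) t" unfolding t_def by simp
  have sub: "marks t \<subseteq> ?REQ" using soundD(3) Jt unfolding J_def by blast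
  have "?REQ \<subseteq> marks t"
  \<comment> \<open>That many marks cover every pair of numbers below \<open>m\<close>, in
    particular all forced contacts.\<close>
  proof (cases "m * m \<le> card (marks t)")
    case True
    then have "marks t = {..<m} \<times> {..<m}"
      using marks_bound[of t] by (intro card_seteq) (simp_all add: card_cartesian_product)
    then show ?thesis using W forced_mem by blast
  next
    case False
    then show ?thesis using Jt unfolding J_def by blast
  qed
  then show "sound W t" "at_least ?REQ F t" using Jt unfolding J_def at_least_def by blast+
qed

lemma search_correct:
  assumes s: "loaded s" "returned_vertices s \<subseteq> {..<m}"
  shows "reg (run search s) ''found'' \<noteq> 0 \<longleftrightarrow> obstructed (returned_vertices s)"
proof -
  define W where "W = returned_vertices s"
  have W: "W \<subseteq> {..<m}" using s(2) unfolding W_def .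
  define s0 where "s0 = set_reg ''found'' 0 s"
  define s1 where "s1 = run clear_marks s0"
  define s2 where "s2 = run mark_cliques s1"
  define s3 where "s3 = run find_diamond s2"
  define s4 where "s4 = run find_K5 s3"
  define s5 where "s5 = run (scan [''i'', ''j''] mark_branches) s4"
  define s6 where "s6 = run find_overcommitted s5"
  have res: "run search s = s6"
    unfolding s0_def s1_def s2_def s3_def s4_def s5_def s6_def search_def by simp
  have "loaded s0" using s(1) unfolding s0_def by simp
  have "reg s1 ''found'' = 0"
    unfolding s1_def using reg_run[of "''found''" clear_marks s0] by (simp add: program_defs s0_def)
  moreover have "reg s1 ''n'' = reg s0 ''n''"
    unfolding s1_def using reg_run[of "''n''" clear_marks s0] by (simp add: program_defs)
  moreover have "arr s1 ''row'' = arr s0 ''row''" "arr s1 ''adj'' = arr s0 ''adj''"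
    "arr s1 ''subgraph'' = arr s0 ''subgraph''"
    unfolding s1_def by (intro arr_run; simp add: program_defs)+
  ultimately have "sound W s1"
    using clear_marks_correct[OF \<open>loaded s0\<close>] \<open>loaded s0\<close>
    unfolding sound_def W_def loaded_def returned_vertices_def s1_def[symmetric] by (simp add: s0_def)
  note c = mark_cliques_correct[OF this W, folded s2_def]
  \<comment> \<open>At each stage the flag parameter is the present state of \<open>found\<close>,
    so an early success persists to the end.\<close>
  have "at_least (cliques W) (reg s2 ''found'' \<noteq> 0) s2" using c(2) unfolding at_least_def by simp
  note d = find_diamond_correct[OF c(1) this W, folded s3_def]
  have "at_least (cliques W) (reg s3 ''found'' \<noteq> 0) s3" using d(2) unfolding at_least_def by simp
  note k = find_K5_correct[OF d(1) this W, folded s4_def]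
  have "at_least (cliques W) (reg s4 ''found'' \<noteq> 0) s4" using k(2) unfolding at_least_def by simp
  note r = mark_rounds_correct[OF k(1) this W, folded s5_def]
  note o = find_overcommitted_correct[OF r W subset_refl, folded s6_def]
  have step3: "reg s4 ''found'' \<noteq> 0" if "reg s3 ''found'' \<noteq> 0" using k(2) that unfolding at_least_def by blast
  have step4: "reg s6 ''found'' \<noteq> 0" if "reg s4 ''found'' \<noteq> 0" using o(2) that unfolding at_least_def by blast
  have "reg s6 ''found'' \<noteq> 0" if obs: "obstructed W"
  proof -
    consider "\<exists>u\<in>W. overcommitted W u"
      | "\<exists>a\<in>W. \<exists>b\<in>W. \<exists>c\<in>W. \<exists>d\<in>W. diamond a b c d"
      | "\<exists>a\<in>W. \<exists>b\<in>W. \<exists>c\<in>W. \<exists>d\<in>W. \<exists>e\<in>W. clique4 a b c d \<and>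
          (a, e) \<in> E \<and> (b, e) \<in> E \<and> (c, e) \<in> E \<and> (d, e) \<in> E"
      using obs unfolding obstructed_def by argo
    then show ?thesis
    proof cases
      case 1 then show ?thesis using o(3) by (elim bexE)
    next
      case 2 then show ?thesis using d(3) step3 step4 by (elim bexE) blast
    next
      case 3 then show ?thesis using k(3) step4 by (elim bexE conjE) blast
    qed
  qed
  moreover have "obstructed W" if "reg s6 ''found'' \<noteq> 0" using soundD(4)[OF o(1)] that by blast
  ultimately show ?thesis unfolding res W_def[symmetric] by blast
qed

end

section \<open>The algorithm\<close>

definition load_rows :: prog where
  "load_rows = PFor ''a'' (PSeq (PStore ''row'' (V ''a'') (V ''offset''))
     (PAssign ''offset'' (Plus (V ''offset'') (V ''n''))))"

definition select_all :: prog where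
  "select_all = PFor ''a'' (PStore ''subgraph'' (V ''a'') (N 1))"

definition try_delete :: prog where
  "try_delete = PSeq (PStore ''subgraph'' (V ''v'') (N 0))
     (PSeq search (PIf (V ''found'') PSkip (PStore ''subgraph'' (V ''v'') (N 1))))"

definition recognize :: prog where
  "recognize = PSeq load_rows (PSeq select_all (PSeq search
     (PIf (V ''found'') (PFor ''v'' try_delete) (PAssign ''answer'' (N 1)))))"

lemmas recognize_defs = load_rows_def select_all_def try_delete_def recognize_def

lemma well_formed_recognize: "well_formed recognize"
  by (simp add: recognize_defs well_formed_search regs_search)

context graph_input begin

lemma load_rows_correct:
  assumes n: "reg s ''n'' = m" and offset: "reg s ''offset'' = 0"
    and adj: "\<forall>u<m. \<forall>v<m. arr s ''adj'' (u * m + v) = (if (u, v) \<in> E then 1 else 0)"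
  shows "loaded (run load_rows s)"
proof -
  let ?I = "\<lambda>i s. reg s ''n'' = m \<and> reg s ''offset'' = i * m \<and> (\<forall>u<i. arr s ''row'' u = u * m)"
  have "?I m (run load_rows s)"
    unfolding load_rows_def
    by (rule run_For_invariant[where I = ?I, OF _ n]) (use n offset in \<open>auto simp: less_Suc_eq\<close>)
  moreover have "arr (run load_rows s) ''adj'' = arr s ''adj''"
    by (rule arr_run) (simp add: load_rows_def)
  ultimately show ?thesis unfolding loaded_def using adj by simp
qed

lemma select_all_correct:
  assumes s: "loaded s" "returned_vertices s = {}"
  shows "loaded (run select_all s)" "returned_vertices (run select_all s) = {..<m}"
proof -
  let ?I = "\<lambda>i s. loaded s \<and> returned_vertices s = {..<i}"
  have n: "reg s ''n'' = m" using s unfolding loaded_def by simp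
  have "?I m (run select_all s)"
    unfolding select_all_def
    by (rule run_For_invariant[where I = ?I, OF _ n])
      (use s in \<open>auto simp: returned_vertices_def less_Suc_eq\<close>)
  then show "loaded (run select_all s)" "returned_vertices (run select_all s) = {..<m}" by blast+
qed

lemma run_search:
  assumes "loaded s"
  shows "loaded (run search s)" "returned_vertices (run search s) = returned_vertices s"
    "reg (run search s) ''answer'' = reg s ''answer''" "reg (run search s) ''v'' = reg s ''v''"
proof -
  have "reg (run search s) ''n'' = reg s ''n''" "arr (run search s) ''row'' = arr s ''row''"
    "arr (run search s) ''adj'' = arr s ''adj''"
    by (intro reg_run arr_run; simp add: regs_search arrays_search)+
  then show "loaded (run search s)" using assms unfolding loaded_def by simp
  have "arr (run search s) ''subgraph'' = arr s ''subgraph''"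
    by (rule arr_run) (simp add: arrays_search)
  then show "returned_vertices (run search s) = returned_vertices s"
    unfolding returned_vertices_def by simp
  show "reg (run search s) ''answer'' = reg s ''answer''" "reg (run search s) ''v'' = reg s ''v''"
    by (intro reg_run; simp add: regs_search)+
qed

lemma returned_set_subgraph:
  "returned_vertices (set_cell ''subgraph'' i k s) =
    (if k = 0 then returned_vertices s - {i} else insert i (returned_vertices s))"
  unfolding returned_vertices_def by auto

text \<open>A failed deletion stores 1 whether or not \<open>i\<close> was present before, hence
  \<open>insert i\<close> in the conclusion. The flag then says that the set without
  \<open>i\<close> is not obstructed.\<close>

lemma try_delete_correct:
  assumes s: "loaded s" "returned_vertices s \<subseteq> {..<m}" "obstructed (returned_vertices s)" "reg s ''v'' = i" "i < m"
  defines "t \<equiv> run try_delete s"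
  shows "loaded t" "reg t ''answer'' = reg s ''answer''" "obstructed (returned_vertices t)"
    "returned_vertices t = returned_vertices s - {i} \<or> returned_vertices t = insert i (returned_vertices s)"
    "i \<in> returned_vertices t \<Longrightarrow> \<not> obstructed (returned_vertices t - {i})"
proof -
  define W where "W = returned_vertices s"
  define s1 where "s1 = set_cell ''subgraph'' i 0 s"
  have s1: "loaded s1" "returned_vertices s1 = W - {i}" "reg s1 ''answer'' = reg s ''answer''"
    "reg s1 ''v'' = i"
    using s unfolding s1_def W_def by (simp_all add: returned_set_subgraph)
  define s2 where "s2 = run search s1"
  note s2 = run_search[OF s1(1), folded s2_def]
  have t: "t = (if reg s2 ''found'' \<noteq> 0 then s2 else set_cell ''subgraph'' i 1 s2)"
    unfolding t_def try_delete_def s2_def s1_def using s(4) run_search(4)[OF s1(1), unfolded s1_def]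
    by simp
  have found: "reg s2 ''found'' \<noteq> 0 \<longleftrightarrow> obstructed (W - {i})"
    using search_correct[OF s1(1)] s1(2) s(2) unfolding s2_def W_def by auto
  have "loaded t \<and> reg t ''answer'' = reg s ''answer'' \<and> obstructed (returned_vertices t) \<and>
    (returned_vertices t = W - {i} \<or> returned_vertices t = insert i W) \<and>
    (i \<in> returned_vertices t \<longrightarrow> \<not> obstructed (returned_vertices t - {i}))"
  proof (cases "obstructed (W - {i})")
    case True
    then have "t = s2" using t found by simp
    then show ?thesis using True s1 s2 by auto
  next
    case False
    then have t': "t = set_cell ''subgraph'' i 1 s2" using t found by simp
    have rt: "returned_vertices t = insert i W"
      unfolding t' returned_set_subgraph s2 s1 by auto
    have "obstructed (insert i W)" using s(3) obstructed_mono W_def by blast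
    moreover have "insert i W - {i} = W - {i}" by blast
    ultimately show ?thesis using False s1 s2 rt t' by simp
  qed
  then show "loaded t" "reg t ''answer'' = reg s ''answer''" "obstructed (returned_vertices t)"
    "returned_vertices t = returned_vertices s - {i} \<or> returned_vertices t = insert i (returned_vertices s)"
    "i \<in> returned_vertices t \<Longrightarrow> \<not> obstructed (returned_vertices t - {i})"
    unfolding W_def by blast+
qed

text \<open>One pass suffices: a vertex kept at its turn was indispensable in the set of that
  moment, and by monotonicity it stays indispensable in every smaller set.\<close>

lemma deletion_loop_correct:
  assumes s: "loaded s" "returned_vertices s = {..<m}" "obstructed {..<m}"
  defines "t \<equiv> run (PFor ''v'' try_delete) s"
  shows "reg t ''answer'' = reg s ''answer''" "returned_vertices t \<subseteq> {..<m}"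
    "obstructed (returned_vertices t)"
    "\<And>v. v \<in> returned_vertices t \<Longrightarrow> \<not> obstructed (returned_vertices t - {v})"
proof -
  \<comment> \<open>Vertices from \<open>i\<close> on have not been tried and are all present; so
    restoring \<open>i\<close> gives back exactly the previous set.\<close>
  define I where "I i r \<longleftrightarrow> loaded r \<and> reg r ''answer'' = reg s ''answer'' \<and>
    returned_vertices r \<subseteq> {..<m} \<and> {i..<m} \<subseteq> returned_vertices r \<and> obstructed (returned_vertices r) \<and>
    (\<forall>v\<in>returned_vertices r. v < i \<longrightarrow> \<not> obstructed (returned_vertices r - {v}))" for i r
  have n: "reg s ''n'' = m" using s(1) unfolding loaded_def by simp
  have "I m t"
    unfolding t_def
  proof (rule run_For_invariant[where I = I, OF _ n])
    show "I 0 s" unfolding I_def s(2) using s(1,3) by (intro conjI ballI impI) (assumption | force)+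
    show "I m (set_reg ''v'' m r)" if "I m r" for r using that unfolding I_def by simp
    fix i r assume i: "i < m" and r: "I i r"
    let ?r = "set_reg ''v'' i r" and ?W = "returned_vertices r" and ?W' = "returned_vertices (run try_delete (set_reg ''v'' i r))"
    have iW: "i \<in> ?W" using r i unfolding I_def by auto
    have pre: "loaded ?r" "returned_vertices ?r \<subseteq> {..<m}" "obstructed (returned_vertices ?r)" "reg ?r ''v'' = i"
      using r unfolding I_def by simp_all
    note d = try_delete_correct[OF pre i]
    have W': "?W' = ?W - {i} \<or> ?W' = ?W" using d(4) iW by (simp add: insert_absorb)
    then have sub: "?W' \<subseteq> ?W" by blast
    have "\<not> obstructed (?W' - {v})" if v: "v \<in> ?W'" "v < Suc i" for v
    proof (cases "v = i")
      case True then show ?thesis using d(5) v by blast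
    next
      case False
      then have "\<not> obstructed (?W - {v})" using r v sub unfolding I_def by auto
      then show ?thesis using obstructed_mono[of "?W' - {v}" "?W - {v}"] sub by blast
    qed
    moreover have "?W' \<subseteq> {..<m}" using sub pre(2) by simp
    moreover have "{Suc i..<m} \<subseteq> ?W'"
    proof -
      have "{i..<m} \<subseteq> ?W" using r unfolding I_def by blast
      then have "{Suc i..<m} \<subseteq> ?W - {i}" by (auto simp: subset_iff)
      then show ?thesis using W' by blast
    qed
    moreover have "reg (run try_delete ?r) ''answer'' = reg s ''answer''"
      using d(2) r unfolding I_def by simp
    ultimately show "I (Suc i) (run try_delete ?r)" unfolding I_def using d(1,3) by blast
  qed
  then have I: "reg t ''answer'' = reg s ''answer''" "returned_vertices t \<subseteq> {..<m}"
    "obstructed (returned_vertices t)"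
    "\<forall>v\<in>returned_vertices t. v < m \<longrightarrow> \<not> obstructed (returned_vertices t - {v})"
    unfolding I_def by simp_all
  show "reg t ''answer'' = reg s ''answer''" "returned_vertices t \<subseteq> {..<m}"
    "obstructed (returned_vertices t)" by fact+
  show "\<not> obstructed (returned_vertices t - {v})" if "v \<in> returned_vertices t" for v
    using I(2,4) that by auto
qed

lemma recognize_correct:
  assumes n: "reg s ''n'' = m" and zero: "reg s ''offset'' = 0" "reg s ''answer'' = 0" "arr s ''subgraph'' = (\<lambda>_. 0)"
    and adj: "\<forall>u<m. \<forall>v<m. arr s ''adj'' (u * m + v) = (if (u, v) \<in> E then 1 else 0)"
  defines "t \<equiv> run recognize s"
  shows "\<not> obstructed {..<m} \<Longrightarrow> answers_YES t"
    "obstructed {..<m} \<Longrightarrow> answers_NO t \<and> returned_vertices t \<subseteq> {..<m} \<and> obstructed (returned_vertices t) \<and>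
      (\<forall>v\<in>returned_vertices t. \<not> obstructed (returned_vertices t - {v}))"
proof -
  define s1 where "s1 = run load_rows s"
  define s2 where "s2 = run select_all s1"
  define s3 where "s3 = run search s2"
  have s1: "loaded s1" unfolding s1_def by (rule load_rows_correct[OF n zero(1) adj])
  have "arr s1 ''subgraph'' = arr s ''subgraph''" unfolding s1_def by (rule arr_run) (simp add: load_rows_def)
  then have "returned_vertices s1 = {}" using zero(3) unfolding returned_vertices_def by simp
  note s2 = select_all_correct[OF s1 this, folded s2_def]
  note s3 = run_search[OF s2(1), folded s3_def]
  have "reg s1 ''answer'' = reg s ''answer''" unfolding s1_def by (rule reg_run) (simp add: load_rows_def)
  moreover have "reg s2 ''answer'' = reg s1 ''answer''" unfolding s2_def by (rule reg_run) (simp add: select_all_def)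
  ultimately have answer: "reg s3 ''answer'' = 0" using zero(2) s3(3) by simp
  have found: "reg s3 ''found'' \<noteq> 0 \<longleftrightarrow> obstructed {..<m}"
    using search_correct[OF s2(1)] s2(2) unfolding s3_def by simp
  \<comment> \<open>The answer NO needs no assignment, since the register \<open>answer\<close> is
    initially 0 and neither search nor deletion touches it.\<close>
  have t: "t = (if reg s3 ''found'' \<noteq> 0 then run (PFor ''v'' try_delete) s3 else set_reg ''answer'' 1 s3)"
    unfolding t_def recognize_def s3_def s2_def s1_def by simp
  show "answers_YES t" if "\<not> obstructed {..<m}"
    using t found that unfolding answers_YES_def by simp
  show "answers_NO t \<and> returned_vertices t \<subseteq> {..<m} \<and> obstructed (returned_vertices t) \<and>
      (\<forall>v\<in>returned_vertices t. \<not> obstructed (returned_vertices t - {v}))" if obs: "obstructed {..<m}"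
  proof -
    have ret: "returned_vertices s3 = {..<m}" using s3(2) s2(2) by simp
    note d = deletion_loop_correct[OF s3(1) ret obs]
    have "t = run (PFor ''v'' try_delete) s3" using t found obs by simp
    then show ?thesis using d answer unfolding answers_NO_def by simp
  qed
qed

end

theorem mainTheorem2:
  shows "\<exists>(c :: com) (p :: nat poly).
    \<forall>G :: nat pair_pre_digraph.
      pair_graph G \<and> pverts G = {..<card (pverts G)} \<and> chordal G \<longrightarrow>
      (\<exists>t s. exec c (input_state G) t s \<and> t \<le> poly p (card (pverts G)) \<and>
        (contact_B0_VPG G \<longrightarrow> answers_YES s) \<and>
        (\<not> contact_B0_VPG G \<longrightarrow> answers_NO s \<and>
          (\<exists>H \<in> family_T \<union> {complete_graph 5, K4_minus}.
            induces_copy G (returned_vertices s) H)))"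
proof (intro exI[of _ "compile recognize"] exI[of _ "cost recognize"] allI impI, elim conjE)
  fix G :: "nat pair_pre_digraph"
  assume G: "pair_graph G" and verts: "pverts G = {..<card (pverts G)}" and ch: "chordal G"
  define m where "m = card (pverts G)"
  have V: "pverts G = {..<m}" using verts unfolding m_def .
  interpret pair_graph G by fact
  interpret adjacency "parcs G" using adjacency_parcs[OF G] .
  interpret graph_input "parcs G" m
  proof
    show "parcs G \<subseteq> {..<m} \<times> {..<m}"
    proof
      fix e assume "e \<in> parcs G"
      then show "e \<in> {..<m} \<times> {..<m}"
        using arc_fst_in_verts[of e] arc_snd_in_verts[of e] V by (cases e) simp
    qed
  qed
  let ?s = "input_state G" and ?t = "run recognize (input_state G)"
  have s: "reg ?s ''n'' = m" "reg ?s ''offset'' = 0" "reg ?s ''answer'' = 0" "arr ?s ''subgraph'' = (\<lambda>_. 0)"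
    unfolding input_state_def Let_def m_def by simp_all
  have adj: "\<forall>u<m. \<forall>v<m. arr ?s ''adj'' (u * m + v) = (if (u, v) \<in> parcs G then 1 else 0)"
  proof (intro allI impI)
    fix u v assume uv: "u < m" "v < m"
    \<comment> \<open>The matrix in \<open>input_state\<close> is cut off at \<open>m * m\<close>;
      the row-by-row index of a pair of vertices stays below this bound.\<close>
    have "u * m + v < Suc u * m" using uv(2) by simp
    also have "\<dots> \<le> m * m" using uv(1) by (intro mult_le_mono1) simp
    finally have "u * m + v < m * m" .
    moreover have "(u * m + v) div m = u" "(u * m + v) mod m = v" using uv by simp_all
    ultimately show "arr ?s ''adj'' (u * m + v) = (if (u, v) \<in> parcs G then 1 else 0)"
      unfolding input_state_def Let_def m_def[symmetric] by simp
  qed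
  note correct = recognize_correct[OF s adj]
  have contact: "contact_B0_VPG G \<longleftrightarrow> \<not> obstructed {..<m}"
    using contact_B0_VPG_iff_unobstructed[OF G ch] unfolding V .
  obtain t where t: "exec (compile recognize) ?s t ?t" "t \<le> poly (cost recognize) (reg ?s ''n'')"
    using exec_compile[OF well_formed_recognize] by blast
  have no: "\<exists>H \<in> family_T \<union> {complete_graph 5, K4_minus}. induces_copy G (returned_vertices ?t) H"
    if "obstructed {..<m}"
  proof (rule minimal_obstruction[OF G ch])
    show "returned_vertices ?t \<subseteq> pverts G" "obstructed (returned_vertices ?t)"
      "\<And>v. v \<in> returned_vertices ?t \<Longrightarrow> \<not> obstructed (returned_vertices ?t - {v})"
      using correct(2)[OF that] unfolding V by blast+
  qed
  show "\<exists>t s. exec (compile recognize) ?s t s \<and> t \<le> poly (cost recognize) (card (pverts G)) \<and>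
      (contact_B0_VPG G \<longrightarrow> answers_YES s) \<and>
      (\<not> contact_B0_VPG G \<longrightarrow> answers_NO s \<and>
        (\<exists>H \<in> family_T \<union> {complete_graph 5, K4_minus}. induces_copy G (returned_vertices s) H))"
  proof (intro exI conjI impI)
    show "exec (compile recognize) ?s t ?t" by (rule t(1))
    show "t \<le> poly (cost recognize) (card (pverts G))" using t(2) s(1) unfolding m_def by simp
    show "answers_YES ?t" if "contact_B0_VPG G" using correct(1) contact that by blast
    show "answers_NO ?t" if "\<not> contact_B0_VPG G" using correct(2) contact that by blast
    show "\<exists>H \<in> family_T \<union> {complete_graph 5, K4_minus}. induces_copy G (returned_vertices ?t) H"
      if "\<not> contact_B0_VPG G" using no contact that by blast
  qed
qed

end
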